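(* Let $G$ be a discrete group, $\mathcal{A}=\bigoplus_{g\in G}\mathcal{A}_g$ a unital $G$-graded $*$-algebra, $H$ a subgroup of $G$ and $(\pi,E)$ a system of imprimitivity for $\mathcal{A}$ over $G/H$. Suppose that the $*$-representation $\pi$ acts by bounded operators on $\mathcal{D}(\pi)=\mathcal{H}_\pi$. Fix one element $k_t\in G$ in each left coset $t\in G/H$. Then for every $t\in G/H$ there exists a bounded $*$-representation $\rho_t$ of $\mathcal{A}_{k_tHk_t^{-1}}$ on a Hilbert space $\mathcal{H}_t$ (possibly zero) such that: (i) $\rho_t$ is inducible (to $\mathcal{A}$); (ii) $(\pi,E)$ is the direct sum of systems of imprimitivity $(\pi_t,E_t)$, $t\in G/H$, for $\mathcal{A}$ over $G/H$ such that for each $t\in G/H$ the system $(\pi_t,E_t^{k_t})$ over $G/k_tHk_t^{-1}$, conjugated to $(\pi_t,E_t)$ by the element $k_t$, is unitarily equivalent to the system of imprimitivity induced by $\rho_t$.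
   Context: A $*$-algebra is a complex associative algebra with involution. A $*$-representation $\pi$ of a $*$-algebra $\mathcal{A}$ on a dense linear subspace $\mathcal{D}(\pi)$ of a Hilbert space $\mathcal{H}_\pi$ is an algebra homomorphism of $\mathcal{A}$ into the linear operators on $\mathcal{D}(\pi)$ with $\langle\pi(a)\varphi,\psi\rangle=\langle\varphi,\pi(a^* )\psi\rangle$. Convention: for unital $\mathcal{A}$, $\pi(\mathbf 1)\varphi=\varphi$ for all $\varphi\in\mathcal{D}(\pi)$. The graph topology of $\pi$ is given by the norms $\varphi\mapsto\|\varphi\|+\|\pi(a)\varphi\|$, $a\in\mathcal{A}$; the closure of $\pi$ is the extension of $\pi$ by continuity to the completion of $\mathcal{D}(\pi)$ in the graph topology. Grading: $\mathcal{A}_g\mathcal{A}_h\subseteq\mathcal{A}_{gh}$ and $(\mathcal{A}_g)^*\subseteq\mathcal{A}_{g^{-1}}$. For $X\subseteq G$ put $\mathcal{A}_X=\bigoplus_{g\in X}\mathcal{A}_g$. For a subgroup $K$ of $G$, $\mathcal{A}_K$ is a $*$-subalgebra and $p_K:\mathcal{A}\to\mathcal{A}_K$ is the projection $\sum_{g\in G} a_g\mapsto\sum_{g\in K}a_g$. $G/K$ is the set of left cosets. Induction: for a $*$-representation $\rho$ of $\mathcal{A}_K$ define on $\mathcal{A}\otimes_{\mathcal{A}_K}\mathcal{D}(\rho)$ the form $\langle a_1\otimes v_1,a_2\otimes v_2\rangle_0=\langle\rho(p_K(a_2^*a_1))v_1,v_2\rangle$. $\rho$ is inducible if this form is nonnegative.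 With $\mathcal{K}_\rho=\{\eta:\langle\eta,\eta\rangle_0=0\}$ and $[\eta]=\eta+\mathcal{K}_\rho$, $\mathrm{Ind}\,\rho$ is the closure of the $*$-representation $a\mapsto([b\otimes v]\mapsto[ab\otimes v])$ on $(\mathcal{A}\otimes_{\mathcal{A}_K}\mathcal{D}(\rho))/\mathcal{K}_\rho$. A system of imprimitivity for $\mathcal{A}$ over $G/K$ is a pair $(\pi,E)$ of a $*$-representation $\pi$ of $\mathcal{A}$ and a map $E$ from $G/K$ to the orthogonal projections of $\mathcal{H}_\pi$ such that $E(t_1)E(t_2)=0$ for $t_1\ne t_2$, $\sum_{t\in G/K}E(t)=I$, and $E(gt)\pi(a_g)\subseteq\pi(a_g)E(t)$ for all $g\in G$, $t\in G/K$, $a_g\in\mathcal{A}_g$. Direct sums are taken componentwise; unitary equivalence means a unitary intertwining both the representations (including domains) and the projections. The system of imprimitivity induced by an inducible $\rho$ of $\mathcal{A}_K$ is $(\mathrm{Ind}\,\rho,E)$, where $E(t)$ is the orthogonal projection onto the closure of the span of all $[a_t\otimes v]$, $a_t\in\mathcal{A}_t$, $v\in\mathcal{D}(\rho)$, $t\in G/K$. Conjugation: if $(\pi,E)$ is a system of imprimitivity for $\mathcal{A}$ over $G/H$ and $f\in G$, then $E^f(k(fHf^{-1})):=E(kfH)$, $k\in G$, defines a system of imprimitivity $(\pi,E^f)$ for $\mathcal{A}$ over $G/fHf^{-1}$, said to be conjugated to $(\pi,E)$ by $f$. *)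

theory Defs
  imports
    "HOL-Analysis.Infinite_Sum"
    "HOL-Algebra.Left_Coset"
    "HOL-Algebra.Module"
    "HOL-Algebra.AbelCoset"
begin

section \<open>Complex inner product spaces\<close>

definition complex_ring :: "complex ring" where
  "complex_ring = \<lparr>carrier = UNIV, mult = (*), one = 1, zero = 0, add = (+)\<rparr>"

text \<open>
  Vector spaces are modules in the sense of HOL-Algebra; the multiplicative fields that the record
  type \<open>module\<close> inherits from \<open>ring\<close> play no role for them.  Spaces carry their own carrier set
  because the induced representation lives on a space that is constructed from its parameters.
  The record itself does not require the form to be definite: it is also used for the
  intermediate spaces of the induction process.
\<close>

record 'v ip_space = "(complex, 'v) module" +
  cinner :: "'v \<Rightarrow> 'v \<Rightarrow> complex"  \<comment> \<open>linear in the first argument\<close>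

locale complex_ip_space = module complex_ring V for V :: "'v ip_space" (structure) +
  assumes cinner_add_left: "\<lbrakk>x \<in> carrier V; y \<in> carrier V; z \<in> carrier V\<rbrakk> \<Longrightarrow>
      cinner V (x \<oplus> y) z = cinner V x z + cinner V y z"
    and cinner_smult_left: "\<lbrakk>x \<in> carrier V; z \<in> carrier V\<rbrakk> \<Longrightarrow>
      cinner V (c \<odot> x) z = c * cinner V x z"
    and cinner_commute: "\<lbrakk>x \<in> carrier V; y \<in> carrier V\<rbrakk> \<Longrightarrow> cinner V x y = cnj (cinner V y x)"
    and cinner_nonneg: "x \<in> carrier V \<Longrightarrow> 0 \<le> Re (cinner V x x)"
    and cinner_definite: "\<lbrakk>x \<in> carrier V; cinner V x x = 0\<rbrakk> \<Longrightarrow> x = \<zero>"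

definition vnorm :: "'v ip_space \<Rightarrow> 'v \<Rightarrow> real" where
  "vnorm V x = sqrt (Re (cinner V x x))"

definition vdist :: "'v ip_space \<Rightarrow> 'v \<Rightarrow> 'v \<Rightarrow> real" where
  "vdist V x y = vnorm V (x \<ominus>\<^bsub>V\<^esub> y)"

definition cauchy_seqs :: "'v ip_space \<Rightarrow> (nat \<Rightarrow> 'v) set" where
  "cauchy_seqs V = {X. (\<forall>n. X n \<in> carrier V) \<and>
     (\<forall>e>0. \<exists>N. \<forall>m\<ge>N. \<forall>n\<ge>N. vdist V (X m) (X n) < e)}"

locale hilbert_space = complex_ip_space +
  assumes complete: "X \<in> cauchy_seqs V \<Longrightarrow> \<exists>x\<in>carrier V. (\<lambda>n. vdist V (X n) x) \<longlonglongrightarrow> 0"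

definition vspan :: "'v ip_space \<Rightarrow> 'v set \<Rightarrow> 'v set" where
  "vspan V S = \<Inter>{M. submodule M complex_ring V \<and> S \<subseteq> M}"

definition vclosure :: "'v ip_space \<Rightarrow> 'v set \<Rightarrow> 'v set" where
  "vclosure V S = {x \<in> carrier V. \<exists>X. (\<forall>n. X n \<in> S) \<and> (\<lambda>n. vdist V (X n) x) \<longlonglongrightarrow> 0}"

text \<open>Meaningful for a closed subspace \<open>M\<close> of a Hilbert space and \<open>x\<close> in the carrier.\<close>

definition orth_proj :: "'v ip_space \<Rightarrow> 'v set \<Rightarrow> 'v \<Rightarrow> 'v" where
  "orth_proj V M x = (THE y. y \<in> M \<and> (\<forall>z\<in>M. cinner V (x \<ominus>\<^bsub>V\<^esub> y) z = 0))"

definition vlinear :: "'v ip_space \<Rightarrow> 'w ip_space \<Rightarrow> ('v \<Rightarrow> 'w) \<Rightarrow> bool" where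
  "vlinear V W T \<longleftrightarrow> T \<in> carrier V \<rightarrow> carrier W \<and>
     (\<forall>x\<in>carrier V. \<forall>y\<in>carrier V. T (x \<oplus>\<^bsub>V\<^esub> y) = T x \<oplus>\<^bsub>W\<^esub> T y) \<and>
     (\<forall>c. \<forall>x\<in>carrier V. T (c \<odot>\<^bsub>V\<^esub> x) = c \<odot>\<^bsub>W\<^esub> T x)"

definition orthogonal_projection :: "'v ip_space \<Rightarrow> ('v \<Rightarrow> 'v) \<Rightarrow> bool" where
  "orthogonal_projection V P \<longleftrightarrow> vlinear V V P \<and>
     (\<forall>x\<in>carrier V. P (P x) = P x) \<and>
     (\<forall>x\<in>carrier V. \<forall>y\<in>carrier V. cinner V (P x) y = cinner V x (P y))"

definition unitary :: "'v ip_space \<Rightarrow> 'w ip_space \<Rightarrow> ('v \<Rightarrow> 'w) \<Rightarrow> bool" where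
  "unitary V W U \<longleftrightarrow> vlinear V W U \<and> bij_betw U (carrier V) (carrier W) \<and>
     (\<forall>x\<in>carrier V. \<forall>y\<in>carrier V. cinner W (U x) (U y) = cinner V x y)"


subsection \<open>Quotients and completion\<close>

text \<open>
  The operations are those induced on cosets; the form is evaluated on representatives, which is
  meaningful if \<open>N\<close> lies in the radical of the form of \<open>V\<close>.
\<close>

definition quotient_space :: "'v ip_space \<Rightarrow> 'v set \<Rightarrow> 'v set ip_space" where
  "quotient_space V N =
     \<lparr>carrier = a_rcosets\<^bsub>V\<^esub> N, mult = undefined, one = undefined,
      zero = N, add = set_add V,
      smult = (\<lambda>c X. \<Union>x\<in>X. N +>\<^bsub>V\<^esub> (c \<odot>\<^bsub>V\<^esub> x)),
      cinner = (\<lambda>X Y. cinner V (SOME x. x \<in> X) (SOME y. y \<in> Y))\<rparr>"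

definition null_vectors :: "'v ip_space \<Rightarrow> 'v set" where
  "null_vectors V = {x \<in> carrier V. cinner V x x = 0}"

definition cauchy_rel :: "'v ip_space \<Rightarrow> ((nat \<Rightarrow> 'v) \<times> (nat \<Rightarrow> 'v)) set" where
  "cauchy_rel V = {(X, Y). X \<in> cauchy_seqs V \<and> Y \<in> cauchy_seqs V \<and>
     (\<lambda>n. vdist V (X n) (Y n)) \<longlonglongrightarrow> 0}"

definition completion_embed :: "'v ip_space \<Rightarrow> 'v \<Rightarrow> (nat \<Rightarrow> 'v) set" where
  "completion_embed V x = cauchy_rel V `` {\<lambda>_. x}"

definition hilbert_completion :: "'v ip_space \<Rightarrow> (nat \<Rightarrow> 'v) set ip_space" where
  "hilbert_completion V =
     \<lparr>carrier = cauchy_seqs V // cauchy_rel V, mult = undefined, one = undefined,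
      zero = completion_embed V \<zero>\<^bsub>V\<^esub>,
      add = (\<lambda>P Q. \<Union>X\<in>P. \<Union>Y\<in>Q. cauchy_rel V `` {\<lambda>n. X n \<oplus>\<^bsub>V\<^esub> Y n}),
      smult = (\<lambda>c P. \<Union>X\<in>P. cauchy_rel V `` {\<lambda>n. c \<odot>\<^bsub>V\<^esub> X n}),
      cinner = (\<lambda>P Q. lim (\<lambda>n. cinner V ((SOME X. X \<in> P) n) ((SOME Y. Y \<in> Q) n)))\<rparr>"


section \<open>Graded \<open>*\<close>-algebras\<close>

record 'a star_algebra = "(complex, 'a) module" +
  star :: "'a \<Rightarrow> 'a"

locale unital_star_algebra = module complex_ring A + ring A
  for A :: "'a star_algebra" (structure) +
  assumes smult_mult_left: "\<lbrakk>x \<in> carrier A; y \<in> carrier A\<rbrakk> \<Longrightarrow> (c \<odot> x) \<otimes> y = c \<odot> (x \<otimes> y)"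
    and smult_mult_right: "\<lbrakk>x \<in> carrier A; y \<in> carrier A\<rbrakk> \<Longrightarrow> x \<otimes> (c \<odot> y) = c \<odot> (x \<otimes> y)"
    and star_closed: "x \<in> carrier A \<Longrightarrow> star A x \<in> carrier A"
    and star_star: "x \<in> carrier A \<Longrightarrow> star A (star A x) = x"
    and star_add: "\<lbrakk>x \<in> carrier A; y \<in> carrier A\<rbrakk> \<Longrightarrow> star A (x \<oplus> y) = star A x \<oplus> star A y"
    and star_smult: "x \<in> carrier A \<Longrightarrow> star A (c \<odot> x) = cnj c \<odot> star A x"
    and star_mult: "\<lbrakk>x \<in> carrier A; y \<in> carrier A\<rbrakk> \<Longrightarrow> star A (x \<otimes> y) = star A y \<otimes> star A x"

definition homogeneous_decomp ::
  "'g monoid \<Rightarrow> 'a star_algebra \<Rightarrow> ('g \<Rightarrow> 'a set) \<Rightarrow> 'a \<Rightarrow> ('g \<Rightarrow> 'a) \<Rightarrow> bool" where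
  "homogeneous_decomp G A gr a f \<longleftrightarrow> f \<in> (\<Pi>\<^sub>E g\<in>carrier G. gr g) \<and>
     finite {g \<in> carrier G. f g \<noteq> \<zero>\<^bsub>A\<^esub>} \<and>
     a = (\<Oplus>\<^bsub>A\<^esub>g\<in>{g \<in> carrier G. f g \<noteq> \<zero>\<^bsub>A\<^esub>}. f g)"

locale graded_star_algebra = G: group G + unital_star_algebra A
  for G :: "'g monoid" and A :: "'a star_algebra" +
  fixes gr :: "'g \<Rightarrow> 'a set"
  assumes gr_submodule: "g \<in> carrier G \<Longrightarrow> submodule (gr g) complex_ring A"
    and gr_direct: "a \<in> carrier A \<Longrightarrow> \<exists>!f. homogeneous_decomp G A gr a f"
    and gr_mult: "\<lbrakk>g \<in> carrier G; h \<in> carrier G; a \<in> gr g; b \<in> gr h\<rbrakk> \<Longrightarrow>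
      a \<otimes>\<^bsub>A\<^esub> b \<in> gr (g \<otimes>\<^bsub>G\<^esub> h)"
    and gr_star: "\<lbrakk>g \<in> carrier G; a \<in> gr g\<rbrakk> \<Longrightarrow> star A a \<in> gr (inv\<^bsub>G\<^esub> g)"

definition graded_part :: "'a star_algebra \<Rightarrow> ('g \<Rightarrow> 'a set) \<Rightarrow> 'g set \<Rightarrow> 'a set" where
  "graded_part A gr X =
     {(\<Oplus>\<^bsub>A\<^esub>g\<in>S. f g) |S f. finite S \<and> S \<subseteq> X \<and> f \<in> (\<Pi> g\<in>S. gr g)}"

definition graded_proj ::
  "'g monoid \<Rightarrow> 'a star_algebra \<Rightarrow> ('g \<Rightarrow> 'a set) \<Rightarrow> 'g set \<Rightarrow> 'a \<Rightarrow> 'a" where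
  "graded_proj G A gr K a =
     (let f = (THE f. homogeneous_decomp G A gr a f)
      in \<Oplus>\<^bsub>A\<^esub>g\<in>{g \<in> K. f g \<noteq> \<zero>\<^bsub>A\<^esub>}. f g)"

abbreviation subalgebra_on ::
  "'a star_algebra \<Rightarrow> ('g \<Rightarrow> 'a set) \<Rightarrow> 'g set \<Rightarrow> 'a star_algebra" where
  "subalgebra_on A gr K \<equiv> A\<lparr>carrier := graded_part A gr K\<rparr>"


section \<open>\<open>*\<close>-representations\<close>

record ('a, 'v) rep =
  rep_space :: "'v ip_space"
  rep_dom :: "'v set"
  rep_op :: "'a \<Rightarrow> 'v \<Rightarrow> 'v"  \<comment> \<open>relevant only on \<open>rep_dom\<close>\<close>

definition star_rep :: "'a star_algebra \<Rightarrow> ('a, 'v) rep \<Rightarrow> bool" where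
  "star_rep A \<pi> \<longleftrightarrow>
     (let V = rep_space \<pi>; D = rep_dom \<pi>; op = rep_op \<pi> in
      hilbert_space V \<and> submodule D complex_ring V \<and> vclosure V D = carrier V \<and>
      (\<forall>a\<in>carrier A. vlinear (V\<lparr>carrier := D\<rparr>) (V\<lparr>carrier := D\<rparr>) (op a)) \<and>
      (\<forall>a\<in>carrier A. \<forall>b\<in>carrier A. \<forall>x\<in>D. op (a \<oplus>\<^bsub>A\<^esub> b) x = op a x \<oplus>\<^bsub>V\<^esub> op b x) \<and>
      (\<forall>c. \<forall>a\<in>carrier A. \<forall>x\<in>D. op (c \<odot>\<^bsub>A\<^esub> a) x = c \<odot>\<^bsub>V\<^esub> op a x) \<and>
      (\<forall>a\<in>carrier A. \<forall>b\<in>carrier A. \<forall>x\<in>D. op (a \<otimes>\<^bsub>A\<^esub> b) x = op a (op b x)) \<and>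
      (\<forall>x\<in>D. op \<one>\<^bsub>A\<^esub> x = x) \<and>
      (\<forall>a\<in>carrier A. \<forall>x\<in>D. \<forall>y\<in>D. cinner V (op a x) y = cinner V x (op (star A a) y)))"

definition bounded_rep :: "'a star_algebra \<Rightarrow> ('a, 'v) rep \<Rightarrow> bool" where
  "bounded_rep A \<pi> \<longleftrightarrow> rep_dom \<pi> = carrier (rep_space \<pi>) \<and>
     (\<forall>a\<in>carrier A. \<exists>C. \<forall>x\<in>rep_dom \<pi>.
        vnorm (rep_space \<pi>) (rep_op \<pi> a x) \<le> C * vnorm (rep_space \<pi>) x)"

text \<open>
  The map sending \<open>y \<in> D(\<pi>)\<close> to \<open>(y, (\<pi>(a) y)\<^sub>a)\<close> is a homeomorphism from \<open>D(\<pi>)\<close> with the graph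
  topology onto its image in a product of copies of the (complete) Hilbert space, so the completion
  of \<open>D(\<pi>)\<close> is the closure of that image: the pairs \<open>(x, (f(a))\<^sub>a)\<close> such that \<open>x\<close> and all \<open>f(a)\<close>
  are simultaneous limits of a net in \<open>D(\<pi>)\<close>.  The value \<open>f(a)\<close> of the closure of \<open>\<pi>\<close>
  is determined by \<open>x\<close> because the operators \<open>\<pi>(a)\<close> have densely defined adjoints.
\<close>

definition graph_limit :: "'a star_algebra \<Rightarrow> ('a, 'v) rep \<Rightarrow> 'v \<Rightarrow> ('a \<Rightarrow> 'v) \<Rightarrow> bool" where
  "graph_limit A \<pi> x f \<longleftrightarrow>
     x \<in> carrier (rep_space \<pi>) \<and> f \<in> carrier A \<rightarrow> carrier (rep_space \<pi>) \<and>
     (\<forall>S e. finite S \<and> S \<subseteq> carrier A \<and> 0 < e \<longrightarrow>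
        (\<exists>y\<in>rep_dom \<pi>. vdist (rep_space \<pi>) y x < e \<and>
           (\<forall>a\<in>S. vdist (rep_space \<pi>) (rep_op \<pi> a y) (f a) < e)))"

definition rep_closure :: "'a star_algebra \<Rightarrow> ('a, 'v) rep \<Rightarrow> ('a, 'v) rep" where
  "rep_closure A \<pi> =
     \<lparr>rep_space = rep_space \<pi>, rep_dom = {x. \<exists>f. graph_limit A \<pi> x f},
      rep_op = (\<lambda>a x. (SOME f. graph_limit A \<pi> x f) a)\<rparr>"


section \<open>Systems of imprimitivity\<close>

type_synonym ('g, 'a, 'v) system = "('a, 'v) rep \<times> ('g set \<Rightarrow> 'v \<Rightarrow> 'v)"

text \<open>
  In the last clause both sides are partially defined: \<open>E(gt) \<pi>(a)\<close> has domain \<open>D(\<pi>)\<close> and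
  \<open>\<pi>(a) E(t)\<close> is defined where \<open>E(t)\<close> takes values in \<open>D(\<pi>)\<close>.
\<close>

definition imprimitivity_system ::
  "'g monoid \<Rightarrow> 'a star_algebra \<Rightarrow> ('g \<Rightarrow> 'a set) \<Rightarrow> 'g set \<Rightarrow> ('g, 'a, 'v) system \<Rightarrow> bool" where
  "imprimitivity_system G A gr K = (\<lambda>(\<pi>, E).
     let V = rep_space \<pi>; T = lcosets\<^bsub>G\<^esub> K in
     star_rep A \<pi> \<and>
     (\<forall>t\<in>T. orthogonal_projection V (E t)) \<and>
     (\<forall>t\<in>T. \<forall>s\<in>T. t \<noteq> s \<longrightarrow> (\<forall>x\<in>carrier V. E t (E s x) = \<zero>\<^bsub>V\<^esub>)) \<and>
     (\<forall>x\<in>carrier V. \<forall>e>0. \<exists>S. finite S \<and> S \<subseteq> T \<and>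
        (\<forall>S'. finite S' \<and> S \<subseteq> S' \<and> S' \<subseteq> T \<longrightarrow> vdist V (\<Oplus>\<^bsub>V\<^esub>t\<in>S'. E t x) x < e)) \<and>
     (\<forall>g\<in>carrier G. \<forall>t\<in>T. \<forall>a\<in>gr g. \<forall>x\<in>rep_dom \<pi>.
        E t x \<in> rep_dom \<pi> \<and> E (g <#\<^bsub>G\<^esub> t) (rep_op \<pi> a x) = rep_op \<pi> a (E t x)))"

definition intertwines ::
  "'a star_algebra \<Rightarrow> 'g set set \<Rightarrow> ('v \<Rightarrow> 'w) \<Rightarrow> ('g, 'a, 'v) system \<Rightarrow> ('g, 'a, 'w) system \<Rightarrow> bool"
where
  "intertwines A T U = (\<lambda>(\<pi>, E) (\<pi>', E').
     unitary (rep_space \<pi>) (rep_space \<pi>') U \<and>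
     U ` rep_dom \<pi> = rep_dom \<pi>' \<and>
     (\<forall>a\<in>carrier A. \<forall>x\<in>rep_dom \<pi>. U (rep_op \<pi> a x) = rep_op \<pi>' a (U x)) \<and>
     (\<forall>t\<in>T. \<forall>x\<in>carrier (rep_space \<pi>). U (E t x) = E' t (U x)))"

definition unitarily_equivalent ::
  "'a star_algebra \<Rightarrow> 'g set set \<Rightarrow> ('g, 'a, 'v) system \<Rightarrow> ('g, 'a, 'w) system \<Rightarrow> bool" where
  "unitarily_equivalent A T \<sigma> \<tau> \<longleftrightarrow> (\<exists>U. intertwines A T U \<sigma> \<tau>)"


subsection \<open>Direct sums\<close>

definition hilbert_sum :: "'i set \<Rightarrow> ('i \<Rightarrow> 'v ip_space) \<Rightarrow> ('i \<Rightarrow> 'v) ip_space" where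
  "hilbert_sum I V =
     \<lparr>carrier = {x \<in> (\<Pi>\<^sub>E i\<in>I. carrier (V i)). (\<lambda>i. (vnorm (V i) (x i))\<^sup>2) summable_on I},
      mult = undefined, one = undefined,
      zero = (\<lambda>i\<in>I. \<zero>\<^bsub>V i\<^esub>), add = (\<lambda>x y. \<lambda>i\<in>I. x i \<oplus>\<^bsub>V i\<^esub> y i),
      smult = (\<lambda>c x. \<lambda>i\<in>I. c \<odot>\<^bsub>V i\<^esub> x i),
      cinner = (\<lambda>x y. \<Sum>\<^sub>\<infinity>i\<in>I. cinner (V i) (x i) (y i))\<rparr>"

definition system_sum ::
  "'a star_algebra \<Rightarrow> 'i set \<Rightarrow> ('i \<Rightarrow> ('g, 'a, 'v) system) \<Rightarrow> ('g, 'a, 'i \<Rightarrow> 'v) system" where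
  "system_sum A I \<sigma> =
     (\<lparr>rep_space = hilbert_sum I (\<lambda>i. rep_space (fst (\<sigma> i))),
       rep_dom = {x \<in> (\<Pi>\<^sub>E i\<in>I. rep_dom (fst (\<sigma> i))).
         (\<lambda>i. (vnorm (rep_space (fst (\<sigma> i))) (x i))\<^sup>2) summable_on I \<and>
         (\<forall>a\<in>carrier A.
           (\<lambda>i. (vnorm (rep_space (fst (\<sigma> i))) (rep_op (fst (\<sigma> i)) a (x i)))\<^sup>2) summable_on I)},
       rep_op = (\<lambda>a x. \<lambda>i\<in>I. rep_op (fst (\<sigma> i)) a (x i))\<rparr>,
      (\<lambda>t x. \<lambda>i\<in>I. snd (\<sigma> i) t (x i)))"

text \<open>
  Internal direct sums: the components live on subspaces of the space of \<open>\<tau>\<close> (closed ones, when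
  they are Hilbert spaces), and sending a vector to its orthogonal projections identifies \<open>\<tau>\<close>
  with the componentwise sum.
\<close>

definition is_direct_sum ::
  "'a star_algebra \<Rightarrow> 'g set set \<Rightarrow> 'i set \<Rightarrow> ('g, 'a, 'v) system \<Rightarrow> ('i \<Rightarrow> ('g, 'a, 'v) system) \<Rightarrow> bool"
where
  "is_direct_sum A T I \<tau> \<sigma> \<longleftrightarrow>
     (let V = rep_space (fst \<tau>); M = (\<lambda>i. carrier (rep_space (fst (\<sigma> i)))) in
      (\<forall>i\<in>I. submodule (M i) complex_ring V \<and>
         rep_space (fst (\<sigma> i)) = V\<lparr>carrier := M i\<rparr>) \<and>
      intertwines A T (\<lambda>x. \<lambda>i\<in>I. orth_proj V (M i) x) \<tau> (system_sum A I \<sigma>))"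


subsection \<open>Conjugation\<close>

definition conj_subgroup :: "'g monoid \<Rightarrow> 'g \<Rightarrow> 'g set \<Rightarrow> 'g set" where
  "conj_subgroup G f H = (f <#\<^bsub>G\<^esub> H) #>\<^bsub>G\<^esub> inv\<^bsub>G\<^esub> f"

text \<open>
  If \<open>s\<close> is the left coset \<open>k(fHf\<inverse>)\<close>, then \<open>sf = kfH\<close>; see \<open>conj_system_coset\<close>.
\<close>

definition conj_system :: "'g monoid \<Rightarrow> 'g \<Rightarrow> ('g, 'a, 'v) system \<Rightarrow> ('g, 'a, 'v) system" where
  "conj_system G f = (\<lambda>(\<pi>, E). (\<pi>, \<lambda>s. E (s #>\<^bsub>G\<^esub> f)))"

lemma conj_system_coset:
  assumes "group G" "subgroup H G" "f \<in> carrier G" "k \<in> carrier G"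
  shows "snd (conj_system G f (\<pi>, E)) (k <#\<^bsub>G\<^esub> conj_subgroup G f H) = E ((k \<otimes>\<^bsub>G\<^esub> f) <#\<^bsub>G\<^esub> H)"
proof -
  interpret group G by fact
  have H: "H \<subseteq> carrier G" using assms(2) by (rule subgroup.subset)
  have "k \<otimes>\<^bsub>G\<^esub> (f \<otimes>\<^bsub>G\<^esub> h \<otimes>\<^bsub>G\<^esub> inv\<^bsub>G\<^esub> f) \<otimes>\<^bsub>G\<^esub> f = k \<otimes>\<^bsub>G\<^esub> f \<otimes>\<^bsub>G\<^esub> h" if "h \<in> H" for h
    using that H assms by (simp add: m_assoc subset_eq)
  then have "(k <#\<^bsub>G\<^esub> conj_subgroup G f H) #>\<^bsub>G\<^esub> f = (k \<otimes>\<^bsub>G\<^esub> f) <#\<^bsub>G\<^esub> H"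
    by (auto simp: conj_subgroup_def l_coset_def r_coset_def)
  then show ?thesis by (simp add: conj_system_def)
qed


section \<open>Induction\<close>

definition supp :: "('x \<Rightarrow> complex) \<Rightarrow> 'x set" where
  "supp f = {x. f x \<noteq> 0}"

definition single :: "'x \<Rightarrow> 'x \<Rightarrow> complex" where
  "single x = (\<lambda>y. if y = x then 1 else 0)"

text \<open>
  The free vector space on the symbols \<open>(a, v)\<close>, with the sesquilinear extension of
  \<open>\<langle>(a, v), (b, w)\<rangle> = \<langle>\<rho>(p\<^sub>K(b\<^sup>* a)) v, w\<rangle>\<close>.
\<close>

definition free_space ::
  "'g monoid \<Rightarrow> 'a star_algebra \<Rightarrow> ('g \<Rightarrow> 'a set) \<Rightarrow> 'g set \<Rightarrow> ('a, 'v) rep \<Rightarrow>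
   ('a \<times> 'v \<Rightarrow> complex) ip_space"
where
  "free_space G A gr K \<rho> =
     \<lparr>carrier = {f. finite (supp f) \<and> supp f \<subseteq> carrier A \<times> rep_dom \<rho>},
      mult = undefined, one = undefined,
      zero = (\<lambda>_. 0), add = (\<lambda>f f' x. f x + f' x), smult = (\<lambda>c f x. c * f x),
      cinner = (\<lambda>f f'. \<Sum>(a, v)\<in>supp f. \<Sum>(b, w)\<in>supp f'.
        f (a, v) * cnj (f' (b, w)) *
        cinner (rep_space \<rho>) (rep_op \<rho> (graded_proj G A gr K (star A b \<otimes>\<^bsub>A\<^esub> a)) v) w)\<rparr>"

definition tensor_relations ::
  "'a star_algebra \<Rightarrow> 'a set \<Rightarrow> ('a, 'v) rep \<Rightarrow> ('a \<times> 'v \<Rightarrow> complex) set" where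
  "tensor_relations A B \<rho> = (let V = rep_space \<rho>; D = rep_dom \<rho> in
     {(\<lambda>x. single (a \<oplus>\<^bsub>A\<^esub> b, v) x - single (a, v) x - single (b, v) x) |a b v.
        a \<in> carrier A \<and> b \<in> carrier A \<and> v \<in> D} \<union>
     {(\<lambda>x. single (a, v \<oplus>\<^bsub>V\<^esub> w) x - single (a, v) x - single (a, w) x) |a v w.
        a \<in> carrier A \<and> v \<in> D \<and> w \<in> D} \<union>
     {(\<lambda>x. single (c \<odot>\<^bsub>A\<^esub> a, v) x - c * single (a, v) x) |c a v. a \<in> carrier A \<and> v \<in> D} \<union>
     {(\<lambda>x. single (a, c \<odot>\<^bsub>V\<^esub> v) x - c * single (a, v) x) |c a v. a \<in> carrier A \<and> v \<in> D} \<union>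
     {(\<lambda>x. single (a \<otimes>\<^bsub>A\<^esub> b, v) x - single (a, rep_op \<rho> b v) x) |a b v.
        a \<in> carrier A \<and> b \<in> B \<and> v \<in> D})"

definition tensor_kernel ::
  "'g monoid \<Rightarrow> 'a star_algebra \<Rightarrow> ('g \<Rightarrow> 'a set) \<Rightarrow> 'g set \<Rightarrow> ('a, 'v) rep \<Rightarrow>
   ('a \<times> 'v \<Rightarrow> complex) set"
where
  "tensor_kernel G A gr K \<rho> =
     vspan (free_space G A gr K \<rho>) (tensor_relations A (graded_part A gr K) \<rho>)"

text \<open>The tensor product of \<open>A\<close> and \<open>D(\<rho>)\<close> over \<open>A\<^sub>K\<close>, with the form of the induction process.\<close>

definition tensor_space ::
  "'g monoid \<Rightarrow> 'a star_algebra \<Rightarrow> ('g \<Rightarrow> 'a set) \<Rightarrow> 'g set \<Rightarrow> ('a, 'v) rep \<Rightarrow>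
   ('a \<times> 'v \<Rightarrow> complex) set ip_space"
where
  "tensor_space G A gr K \<rho> = quotient_space (free_space G A gr K \<rho>) (tensor_kernel G A gr K \<rho>)"

definition inducible ::
  "'g monoid \<Rightarrow> 'a star_algebra \<Rightarrow> ('g \<Rightarrow> 'a set) \<Rightarrow> 'g set \<Rightarrow> ('a, 'v) rep \<Rightarrow> bool" where
  "inducible G A gr K \<rho> \<longleftrightarrow>
     (let T = tensor_space G A gr K \<rho> in
      \<forall>\<eta>\<in>carrier T. cinner T \<eta> \<eta> \<in> \<real> \<and> 0 \<le> Re (cinner T \<eta> \<eta>))"

definition ind_pre_space ::
  "'g monoid \<Rightarrow> 'a star_algebra \<Rightarrow> ('g \<Rightarrow> 'a set) \<Rightarrow> 'g set \<Rightarrow> ('a, 'v) rep \<Rightarrow>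
   ('a \<times> 'v \<Rightarrow> complex) set set ip_space"
where
  "ind_pre_space G A gr K \<rho> =
     quotient_space (tensor_space G A gr K \<rho>) (null_vectors (tensor_space G A gr K \<rho>))"

type_synonym ('a, 'v) ind_vector = "(nat \<Rightarrow> ('a \<times> 'v \<Rightarrow> complex) set set) set"

text \<open>The vector \<open>[\<Sum> f(a, v) (a \<otimes> v)]\<close> of the completed quotient.\<close>

definition ind_class ::
  "'g monoid \<Rightarrow> 'a star_algebra \<Rightarrow> ('g \<Rightarrow> 'a set) \<Rightarrow> 'g set \<Rightarrow> ('a, 'v) rep \<Rightarrow>
   ('a \<times> 'v \<Rightarrow> complex) \<Rightarrow> ('a, 'v) ind_vector"
where
  "ind_class G A gr K \<rho> f =
     (let F = free_space G A gr K \<rho>; T = tensor_space G A gr K \<rho> in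
      completion_embed (ind_pre_space G A gr K \<rho>)
        (null_vectors T +>\<^bsub>T\<^esub> (tensor_kernel G A gr K \<rho> +>\<^bsub>F\<^esub> f)))"

text \<open>Linear extension of \<open>(b, v) \<mapsto> (a b, v)\<close>; see \<open>free_lmult_single\<close>.\<close>

definition free_lmult ::
  "'a star_algebra \<Rightarrow> 'a \<Rightarrow> ('a \<times> 'v \<Rightarrow> complex) \<Rightarrow> ('a \<times> 'v \<Rightarrow> complex)" where
  "free_lmult A a f = (\<lambda>y. \<Sum>x | x \<in> supp f \<and> (a \<otimes>\<^bsub>A\<^esub> fst x, snd x) = y. f x)"

lemma free_lmult_single: "free_lmult A a (single (b, v)) = single (a \<otimes>\<^bsub>A\<^esub> b, v)"
proof
  fix y
  have "{x. x \<in> supp (single (b, v)) \<and> (a \<otimes>\<^bsub>A\<^esub> fst x, snd x) = y} =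
      (if y = (a \<otimes>\<^bsub>A\<^esub> b, v) then {(b, v)} else {})"
    by (auto simp: supp_def single_def)
  then show "free_lmult A a (single (b, v)) y = single (a \<otimes>\<^bsub>A\<^esub> b, v) y"
    by (simp add: free_lmult_def single_def)
qed

definition ind_rep_core ::
  "'g monoid \<Rightarrow> 'a star_algebra \<Rightarrow> ('g \<Rightarrow> 'a set) \<Rightarrow> 'g set \<Rightarrow> ('a, 'v) rep \<Rightarrow>
   ('a, ('a, 'v) ind_vector) rep"
where
  "ind_rep_core G A gr K \<rho> =
     (let F = free_space G A gr K \<rho>; cls = ind_class G A gr K \<rho> in
      \<lparr>rep_space = hilbert_completion (ind_pre_space G A gr K \<rho>),
       rep_dom = cls ` carrier F,
       rep_op = (\<lambda>a \<xi>. cls (free_lmult A a (SOME f. f \<in> carrier F \<and> cls f = \<xi>)))\<rparr>)"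

definition ind_rep ::
  "'g monoid \<Rightarrow> 'a star_algebra \<Rightarrow> ('g \<Rightarrow> 'a set) \<Rightarrow> 'g set \<Rightarrow> ('a, 'v) rep \<Rightarrow>
   ('a, ('a, 'v) ind_vector) rep"
where
  "ind_rep G A gr K \<rho> = rep_closure A (ind_rep_core G A gr K \<rho>)"

definition ind_system ::
  "'g monoid \<Rightarrow> 'a star_algebra \<Rightarrow> ('g \<Rightarrow> 'a set) \<Rightarrow> 'g set \<Rightarrow> ('a, 'v) rep \<Rightarrow>
   ('g, 'a, ('a, 'v) ind_vector) system"
where
  "ind_system G A gr K \<rho> =
     (let W = rep_space (ind_rep G A gr K \<rho>) in
      (ind_rep G A gr K \<rho>,
       \<lambda>t. orth_proj W (vclosure W (vspan W
         {ind_class G A gr K \<rho> (single (a, v)) |a v. a \<in> graded_part A gr t \<and> v \<in> rep_dom \<rho>}))))"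

end

theory Submission
  imports Defs
begin

text \<open>
  The projections \<open>E t\<close> grade the Hilbert space by the left cosets of \<open>H\<close>, and a homogeneous element
  of degree \<open>g\<close> carries the range of \<open>E t\<close> into the range of \<open>E (gt)\<close>.  Fix a coset \<open>t = fH\<close>.  The
  degrees that fix \<open>t\<close> form the group \<open>K = fHf\<inverse>\<close>, so \<open>A\<^sub>K\<close> acts on the range of \<open>E t\<close>.  Let \<open>L\<close> be
  a closed subspace of this range that \<open>A\<^sub>K\<close> leaves invariant, and \<open>\<rho>\<close> the representation on \<open>L\<close>.
  For \<open>v\<close> and \<open>w\<close> in \<open>L\<close> the inner product of \<open>\<pi>(a)v\<close> and \<open>\<pi>(b)w\<close> is that of \<open>\<pi>(b\<^sup>*a)v\<close> and \<open>w\<close>; since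
  \<open>w = E t w\<close>, only the components of \<open>b\<^sup>*a\<close> with degree in \<open>K\<close> contribute, and what remains is exactly
  the form of the induction process (lemma \<open>induction_form\<close>).  Hence \<open>\<rho>\<close> is inducible, and
  \<open>a \<otimes> v \<mapsto> \<pi>(a)v\<close> identifies the completed quotient of the tensor product with the closed subspace
  \<open>M\<close> spanned by all \<open>\<pi>(a)v\<close>.  This identification respects the action and, up to conjugation by \<open>f\<close>,
  the projections (lemma \<open>component_equivalent\<close>); boundedness makes the closure of the induced
  representation everywhere defined.

  A single coset need not generate everything, because products of homogeneous elements may vanish.
  The cosets are therefore exhausted one after the other along a well-ordering.  For a coset \<open>t\<close>, let
  the residual space consist of all \<open>x\<close> with \<open>E s (\<pi>(a)x) = 0\<close> for all \<open>a\<close> and all \<open>s\<close> before \<open>t\<close>; it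
  reduces \<open>\<pi>\<close> and all projections.  The space \<open>L\<close> used for \<open>t\<close> is the intersection of the residual
  space with the range of \<open>E t\<close>.

  The generated subspaces are orthogonal: for \<open>s\<close> before \<open>t\<close>, the inner product of \<open>\<pi>(a)v\<close> and
  \<open>\<pi>(b)w\<close> equals that of \<open>v\<close> and \<open>E s (\<pi>(a\<^sup>*b)w) = 0\<close> (lemma \<open>fibres_orthogonal\<close>).  They are total
  (lemma \<open>fibres_total\<close>): if \<open>x\<close> is orthogonal to all of them, then \<open>E t (\<pi>(a)x) = 0\<close> by well-founded
  induction on \<open>t\<close>.  Indeed \<open>x\<close> lies in the residual space of \<open>t\<close> by the induction hypothesis, so
  \<open>z = E t (\<pi>(a)x)\<close> lies in the space \<open>L\<close> belonging to \<open>t\<close>, and the inner product of \<open>z\<close> with itself is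
  that of \<open>x\<close> with \<open>\<pi>(a\<^sup>*)z\<close>, which is \<open>0\<close>.  With \<open>a = 1\<close> all \<open>E t x\<close> vanish, so \<open>x = 0\<close>.
  An orthogonal and total family of closed subspaces that reduce \<open>\<pi>\<close> and \<open>E\<close> decomposes the system
  into a direct sum (lemma \<open>direct_sum_of_components\<close>).
\<close>

section \<open>Complex scalars\<close>

lemma complex_ring_simps [simp]:
  "carrier complex_ring = UNIV" "mult complex_ring = (*)" "one complex_ring = 1"
  "zero complex_ring = 0" "add complex_ring = (+)"
  by (simp_all add: complex_ring_def)

lemma cring_complex_ring: "cring complex_ring"
proof (rule cringI)
  show "abelian_group complex_ring"
  proof (rule abelian_groupI)
    show "\<exists>y\<in>carrier complex_ring. y \<oplus>\<^bsub>complex_ring\<^esub> x = \<zero>\<^bsub>complex_ring\<^esub>" for x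
      by (simp add: exI[of _ "- x"])
  qed (simp_all add: algebra_simps)
  show "Group.comm_monoid complex_ring"
    by (rule Group.comm_monoidI) (simp_all add: algebra_simps)
qed (simp add: algebra_simps)

lemma complex_ring_minus [simp]: "a_inv complex_ring c = - c"
proof -
  interpret cring complex_ring by (rule cring_complex_ring)
  show ?thesis by (rule minus_equality) simp_all
qed

section \<open>Geometry of inner product spaces\<close>

context complex_ip_space
begin

lemma smult_in [simp, intro]: "x \<in> carrier V \<Longrightarrow> c \<odot> x \<in> carrier V"
  by simp

lemma neg_eq_smult: "x \<in> carrier V \<Longrightarrow> \<ominus> x = (-1) \<odot> x"
  using smult_l_minus[of 1 x] smult_one[of x] by simp

lemma cinner_add_right:
  "\<lbrakk>x \<in> carrier V; y \<in> carrier V; z \<in> carrier V\<rbrakk> \<Longrightarrow>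
    cinner V x (y \<oplus> z) = cinner V x y + cinner V x z"
  by (subst (1 2 3) cinner_commute) (simp_all add: cinner_add_left)

lemma cinner_smult_right:
  "\<lbrakk>x \<in> carrier V; y \<in> carrier V\<rbrakk> \<Longrightarrow> cinner V x (c \<odot> y) = cnj c * cinner V x y"
  by (subst (1 2) cinner_commute) (simp_all add: cinner_smult_left)

lemma cinner_neg:
  "\<lbrakk>x \<in> carrier V; y \<in> carrier V\<rbrakk> \<Longrightarrow> cinner V (\<ominus> x) y = - cinner V x y"
  "\<lbrakk>x \<in> carrier V; y \<in> carrier V\<rbrakk> \<Longrightarrow> cinner V x (\<ominus> y) = - cinner V x y"
  by (simp_all add: neg_eq_smult cinner_smult_left cinner_smult_right)

lemma cinner_diff_left:
  "\<lbrakk>x \<in> carrier V; y \<in> carrier V; z \<in> carrier V\<rbrakk> \<Longrightarrow>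
    cinner V (x \<ominus> y) z = cinner V x z - cinner V y z"
  by (simp add: a_minus_def cinner_add_left cinner_neg)

lemma cinner_diff_right:
  "\<lbrakk>x \<in> carrier V; y \<in> carrier V; z \<in> carrier V\<rbrakk> \<Longrightarrow>
    cinner V x (y \<ominus> z) = cinner V x y - cinner V x z"
  by (simp add: a_minus_def cinner_add_right cinner_neg)

lemma cinner_zero [simp]:
  "x \<in> carrier V \<Longrightarrow> cinner V \<zero> x = 0" "x \<in> carrier V \<Longrightarrow> cinner V x \<zero> = 0"
  using cinner_smult_left[of \<zero> x 0] cinner_smult_right[of x \<zero> 0] by simp_all

lemmas cinner_simps = cinner_add_left cinner_add_right cinner_smult_left cinner_smult_right
  cinner_neg cinner_diff_left cinner_diff_right

lemma cinner_finsum_left: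
  assumes "finite S" "\<And>i. i \<in> S \<Longrightarrow> f i \<in> carrier V" "z \<in> carrier V"
  shows "cinner V (\<Oplus>i\<in>S. f i) z = (\<Sum>i\<in>S. cinner V (f i) z)"
  using assms by (induction S) (simp_all add: cinner_add_left Pi_def)

lemma cinner_finsum_right:
  assumes "finite S" "\<And>i. i \<in> S \<Longrightarrow> f i \<in> carrier V" "z \<in> carrier V"
  shows "cinner V z (\<Oplus>i\<in>S. f i) = (\<Sum>i\<in>S. cinner V z (f i))"
  using assms by (induction S) (simp_all add: cinner_add_right Pi_def)

lemma cinner_self: "x \<in> carrier V \<Longrightarrow> cinner V x x = of_real ((vnorm V x)\<^sup>2)"
proof -
  assume x: "x \<in> carrier V"
  have "Im (cinner V x x) = Im (cnj (cinner V x x))"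
    by (rule arg_cong[OF cinner_commute]) (rule x)+
  then show ?thesis using cinner_nonneg[OF x] by (simp add: vnorm_def complex_eq_iff)
qed

lemma vnorm_sq: "x \<in> carrier V \<Longrightarrow> (vnorm V x)\<^sup>2 = Re (cinner V x x)"
  using cinner_nonneg[of x] by (simp add: vnorm_def)

lemma vnorm_nonneg [simp]: "x \<in> carrier V \<Longrightarrow> 0 \<le> vnorm V x"
  using cinner_nonneg[of x] by (simp add: vnorm_def)

lemma vnorm_eq_0_iff: "x \<in> carrier V \<Longrightarrow> vnorm V x = 0 \<longleftrightarrow> x = \<zero>"
proof
  assume "x \<in> carrier V" "vnorm V x = 0"
  then show "x = \<zero>" by (intro cinner_definite) (simp_all add: cinner_self)
qed (simp add: vnorm_def)

lemma diff_eq_zero_iff: "\<lbrakk>x \<in> carrier V; y \<in> carrier V\<rbrakk> \<Longrightarrow> x \<ominus> y = \<zero> \<longleftrightarrow> x = y"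
  by (metis M.minus_eq M.r_neg M.minus_minus M.minus_equality M.a_inv_closed)

text \<open>Weak testing: it turns identities between vectors into identities between complex numbers.\<close>

lemma eq_by_testing:
  assumes "x \<in> carrier V" "y \<in> carrier V" "\<And>z. z \<in> carrier V \<Longrightarrow> cinner V x z = cinner V y z"
  shows "x = y"
proof -
  have "cinner V (x \<ominus> y) (x \<ominus> y) = 0"
    using assms by (simp add: cinner_diff_left)
  then show ?thesis using assms cinner_definite[of "x \<ominus> y"] by (simp add: diff_eq_zero_iff)
qed

lemma cauchy_schwarz:
  assumes x: "x \<in> carrier V" and y: "y \<in> carrier V"
  shows "cmod (cinner V x y) \<le> vnorm V x * vnorm V y"
proof (cases "vnorm V y = 0")
  case True
  then show ?thesis using assms by (simp add: vnorm_eq_0_iff)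
next
  case False
  \<comment> \<open>\<open>c \<odot> y\<close> is the component of \<open>x\<close> along \<open>y\<close>\<close>
  define p N c where "p = cinner V x y" and "N = (vnorm V y)\<^sup>2" and "c = p / of_real N"
  have N: "N > 0" using False by (simp add: N_def)
  have yy: "cinner V y y = of_real N" using y by (simp add: cinner_self N_def)
  have yx: "cinner V y x = cnj p" unfolding p_def by (rule cinner_commute[OF y x])
  have "cinner V (x \<ominus> c \<odot> y) (x \<ominus> c \<odot> y) =
      cinner V x x - cnj c * p - c * cnj p + c * cnj c * of_real N"
    using x y by (simp add: cinner_simps yy yx p_def[symmetric] algebra_simps)
  also have "\<dots> = cinner V x x - p * cnj p / of_real N"
    using N by (simp add: c_def field_simps)
  also have "p * cnj p / of_real N = of_real ((cmod p)\<^sup>2 / N)"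
    by (simp add: complex_norm_square del: of_real_power)
  finally have "cinner V (x \<ominus> c \<odot> y) (x \<ominus> c \<odot> y) = cinner V x x - of_real ((cmod p)\<^sup>2 / N)" .
  moreover have "0 \<le> Re (cinner V (x \<ominus> c \<odot> y) (x \<ominus> c \<odot> y))"
    using x y by (intro cinner_nonneg) simp
  ultimately have "(cmod p)\<^sup>2 / N \<le> (vnorm V x)\<^sup>2"
    using x by (simp add: vnorm_sq)
  then have "(cmod p)\<^sup>2 \<le> (vnorm V x * vnorm V y)\<^sup>2"
    using N by (simp add: pos_divide_le_eq power_mult_distrib flip: N_def)
  then show ?thesis unfolding p_def by (rule power2_le_imp_le) (use x y in simp)
qed

lemma vnorm_add_sq:
  assumes "x \<in> carrier V" "y \<in> carrier V"
  shows "(vnorm V (x \<oplus> y))\<^sup>2 = (vnorm V x)\<^sup>2 + 2 * Re (cinner V x y) + (vnorm V y)\<^sup>2"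
  using assms cinner_commute[of y x] by (simp add: vnorm_sq cinner_simps)

lemma vnorm_diff_sq:
  assumes "x \<in> carrier V" "y \<in> carrier V"
  shows "(vnorm V (x \<ominus> y))\<^sup>2 = (vnorm V x)\<^sup>2 - 2 * Re (cinner V x y) + (vnorm V y)\<^sup>2"
  using assms cinner_commute[of y x] by (simp add: vnorm_sq cinner_simps)

lemma vnorm_triangle:
  assumes x: "x \<in> carrier V" and y: "y \<in> carrier V"
  shows "vnorm V (x \<oplus> y) \<le> vnorm V x + vnorm V y"
proof -
  have "Re (cinner V x y) \<le> vnorm V x * vnorm V y"
    using cauchy_schwarz[OF x y] complex_Re_le_cmod[of "cinner V x y"] by linarith
  then have "(vnorm V (x \<oplus> y))\<^sup>2 \<le> (vnorm V x + vnorm V y)\<^sup>2"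
    using x y by (simp add: vnorm_add_sq power2_sum)
  then show ?thesis by (rule power2_le_imp_le) (use x y in simp)
qed

lemma vnorm_smult: "x \<in> carrier V \<Longrightarrow> vnorm V (c \<odot> x) = cmod c * vnorm V x"
proof -
  assume x: "x \<in> carrier V"
  have "(vnorm V (c \<odot> x))\<^sup>2 = Re ((c * cnj c) * cinner V x x)"
    using x by (simp only: vnorm_sq cinner_simps smult_in mult_ac)
  also have "\<dots> = Re (of_real ((cmod c)\<^sup>2 * (vnorm V x)\<^sup>2))"
    using x by (simp only: cinner_self complex_norm_square[symmetric] of_real_mult)
  also have "\<dots> = (cmod c * vnorm V x)\<^sup>2"
    by (simp only: Re_complex_of_real power_mult_distrib)
  finally show ?thesis using x by (simp add: power2_eq_iff_nonneg)
qed

lemma vdist_nonneg [simp]: "\<lbrakk>x \<in> carrier V; y \<in> carrier V\<rbrakk> \<Longrightarrow> 0 \<le> vdist V x y"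
  by (simp add: vdist_def)

lemma vdist_eq_0_iff: "\<lbrakk>x \<in> carrier V; y \<in> carrier V\<rbrakk> \<Longrightarrow> vdist V x y = 0 \<longleftrightarrow> x = y"
  by (simp add: vdist_def vnorm_eq_0_iff diff_eq_zero_iff)

lemma vdist_same [simp]: "x \<in> carrier V \<Longrightarrow> vdist V x x = 0"
  by (simp add: vdist_eq_0_iff)

lemma vdist_commute: "\<lbrakk>x \<in> carrier V; y \<in> carrier V\<rbrakk> \<Longrightarrow> vdist V x y = vdist V y x"
  by (rule power2_eq_imp_eq)
    (simp_all add: vdist_def vnorm_diff_sq, subst cinner_commute, simp_all)

lemma vdist_triangle:
  assumes "x \<in> carrier V" "y \<in> carrier V" "z \<in> carrier V"
  shows "vdist V x z \<le> vdist V x y + vdist V y z"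
proof -
  have "x \<ominus> z = (x \<ominus> y) \<oplus> (y \<ominus> z)"
    using assms by (intro eq_by_testing) (simp_all add: cinner_simps)
  then show ?thesis using assms vnorm_triangle[of "x \<ominus> y" "y \<ominus> z"] by (simp add: vdist_def)
qed

definition vlim :: "(nat \<Rightarrow> 'v) \<Rightarrow> 'v \<Rightarrow> bool" where
  "vlim X x \<longleftrightarrow> (\<forall>n. X n \<in> carrier V) \<and> x \<in> carrier V \<and> (\<lambda>n. vdist V (X n) x) \<longlonglongrightarrow> 0"

lemma vlimD:
  assumes "vlim X x"
  shows "X n \<in> carrier V" "x \<in> carrier V" "(\<lambda>n. vdist V (X n) x) \<longlonglongrightarrow> 0"
  using assms by (auto simp: vlim_def)

lemma vlim_squeeze:
  assumes "\<And>n. X n \<in> carrier V" "x \<in> carrier V" "\<And>n. vdist V (X n) x \<le> B n" "B \<longlonglongrightarrow> 0"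
  shows "vlim X x"
  unfolding vlim_def
  using assms by (auto intro!: tendsto_sandwich[OF _ _ tendsto_const assms(4)] eventuallyI)

lemma vlim_const: "x \<in> carrier V \<Longrightarrow> vlim (\<lambda>_. x) x"
  by (simp add: vlim_def)

lemma vlim_cinner:
  assumes X: "vlim X x" and Y: "vlim Y y"
  shows "(\<lambda>n. cinner V (X n) (Y n)) \<longlonglongrightarrow> cinner V x y"
proof (rule LIM_zero_cancel, rule tendsto_0_le[where K = 1])
  note [simp] = vlimD(1,2)[OF X] vlimD(1,2)[OF Y]
  show "(\<lambda>n. vdist V (X n) x * (vdist V (Y n) y + vnorm V y) + vnorm V x * vdist V (Y n) y)
      \<longlonglongrightarrow> 0"
    using vlimD(3)[OF X] vlimD(3)[OF Y] by (auto intro!: tendsto_eq_intros)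
  show "\<forall>\<^sub>F n in sequentially. norm (cinner V (X n) (Y n) - cinner V x y) \<le>
      norm (vdist V (X n) x * (vdist V (Y n) y + vnorm V y) + vnorm V x * vdist V (Y n) y) * 1"
  proof (rule eventuallyI)
    fix n
    have "cinner V (X n) (Y n) - cinner V x y =
        cinner V (X n \<ominus> x) (Y n \<ominus> y) + cinner V (X n \<ominus> x) y + cinner V x (Y n \<ominus> y)"
      by (simp add: cinner_simps)
    also have "norm \<dots> \<le> vdist V (X n) x * vdist V (Y n) y + vdist V (X n) x * vnorm V y +
        vnorm V x * vdist V (Y n) y"
      unfolding vdist_def by (intro norm_triangle_mono cauchy_schwarz) simp_all
    finally show "norm (cinner V (X n) (Y n) - cinner V x y) \<le>
      norm (vdist V (X n) x * (vdist V (Y n) y + vnorm V y) + vnorm V x * vdist V (Y n) y) * 1"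
      by (simp add: algebra_simps)
  qed
qed

lemma vlim_unique:
  assumes "vlim X x" "vlim X y"
  shows "x = y"
proof (rule eq_by_testing)
  fix z assume "z \<in> carrier V"
  then show "cinner V x z = cinner V y z"
    using assms by (intro LIMSEQ_unique[of "\<lambda>n. cinner V (X n) z"] vlim_cinner vlim_const)
qed (use assms in \<open>auto dest: vlimD\<close>)

lemma vlim_vnorm: "vlim X x \<Longrightarrow> (\<lambda>n. (vnorm V (X n))\<^sup>2) \<longlonglongrightarrow> (vnorm V x)\<^sup>2"
  using tendsto_Re[OF vlim_cinner[of X x X x]] by (simp add: vnorm_sq vlimD)

lemma vdist_add_le:
  assumes "x \<in> carrier V" "y \<in> carrier V" "x' \<in> carrier V" "y' \<in> carrier V"
  shows "vdist V (x \<oplus> y) (x' \<oplus> y') \<le> vdist V x x' + vdist V y y'"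
proof -
  have "(x \<oplus> y) \<ominus> (x' \<oplus> y') = (x \<ominus> x') \<oplus> (y \<ominus> y')"
    using assms by (intro eq_by_testing) (simp_all add: cinner_simps)
  then show ?thesis using assms vnorm_triangle[of "x \<ominus> x'" "y \<ominus> y'"] by (simp add: vdist_def)
qed

lemma vdist_smult:
  assumes "x \<in> carrier V" "y \<in> carrier V"
  shows "vdist V (c \<odot> x) (c \<odot> y) = cmod c * vdist V x y"
proof -
  have "c \<odot> x \<ominus> c \<odot> y = c \<odot> (x \<ominus> y)"
    using assms by (intro eq_by_testing) (simp_all add: cinner_simps algebra_simps)
  then show ?thesis using assms by (simp add: vdist_def vnorm_smult)
qed

lemma vlim_add:
  assumes X: "vlim X x" and Y: "vlim Y y"
  shows "vlim (\<lambda>n. X n \<oplus> Y n) (x \<oplus> y)"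
proof (rule vlim_squeeze)
  show "(\<lambda>n. vdist V (X n) x + vdist V (Y n) y) \<longlonglongrightarrow> 0"
    using tendsto_add[OF vlimD(3)[OF X] vlimD(3)[OF Y]] by simp
qed (simp_all add: vdist_add_le vlimD[OF X] vlimD[OF Y])

lemma vlim_smult:
  assumes X: "vlim X x"
  shows "vlim (\<lambda>n. c \<odot> X n) (c \<odot> x)"
proof (rule vlim_squeeze)
  show "(\<lambda>n. cmod c * vdist V (X n) x) \<longlonglongrightarrow> 0"
    using tendsto_mult[OF tendsto_const vlimD(3)[OF X], of "cmod c"] by simp
qed (simp_all add: vdist_smult vlimD[OF X])

lemma vlim_cauchy:
  assumes X: "vlim X x"
  shows "X \<in> cauchy_seqs V"
  unfolding cauchy_seqs_def mem_Collect_eq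
proof (intro conjI allI impI)
  fix e :: real assume e: "e > 0"
  then obtain N where N: "\<And>n. n \<ge> N \<Longrightarrow> vdist V (X n) x < e / 2"
    using order_tendstoD(2)[OF vlimD(3)[OF X], of "e/2"] by (auto simp: eventually_sequentially)
  show "\<exists>N. \<forall>m\<ge>N. \<forall>n\<ge>N. vdist V (X m) (X n) < e"
  proof (intro exI[of _ N] allI impI)
    fix m n assume "N \<le> m" "N \<le> n"
    then show "vdist V (X m) (X n) < e"
      using vdist_triangle[of "X m" x "X n"] N[of m] N[of n]
      by (simp add: vlimD[OF X] vdist_commute[of x])
  qed
qed (rule vlimD(1)[OF X])

lemma vclosure_iff_vlim:
  "S \<subseteq> carrier V \<Longrightarrow> x \<in> vclosure V S \<longleftrightarrow> (\<exists>X. (\<forall>n. X n \<in> S) \<and> vlim X x)"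
  by (auto simp: vclosure_def vlim_def)

lemma vclosure_iff:
  assumes "S \<subseteq> carrier V"
  shows "x \<in> vclosure V S \<longleftrightarrow> x \<in> carrier V \<and> (\<forall>e>0. \<exists>s\<in>S. vdist V s x < e)"
proof (intro iffI conjI allI impI)
  assume "x \<in> vclosure V S"
  then obtain X where X: "\<And>n. X n \<in> S" "vlim X x"
    using assms by (auto simp: vclosure_iff_vlim)
  show "x \<in> carrier V" using X by (simp add: vlimD)
  fix e :: real assume "e > 0"
  then have "\<forall>\<^sub>F n in sequentially. vdist V (X n) x < e"
    using vlimD(3)[OF X(2)] by (auto dest: order_tendstoD)
  then show "\<exists>s\<in>S. vdist V s x < e"
    using X(1) by (auto simp: eventually_sequentially)
next
  assume R: "x \<in> carrier V \<and> (\<forall>e>0. \<exists>s\<in>S. vdist V s x < e)"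
  have "\<exists>s\<in>S. vdist V s x < inverse (real (Suc n))" for n
    using R by simp
  then obtain X where X: "\<And>n. X n \<in> S" "\<And>n. vdist V (X n) x < inverse (real (Suc n))"
    by metis
  have "vlim X x"
    using X assms R by (intro vlim_squeeze[OF _ _ _ LIMSEQ_inverse_real_of_nat])
      (auto intro: less_imp_le)
  then show "x \<in> vclosure V S" using X(1) assms by (auto simp: vclosure_iff_vlim)
qed

lemma vclosure_superset:
  assumes "S \<subseteq> carrier V"
  shows "S \<subseteq> vclosure V S"
proof
  fix x assume x: "x \<in> S"
  with assms show "x \<in> vclosure V S"
    by (auto simp: vclosure_iff[OF assms] intro!: bexI[of _ x])
qed

lemma vclosure_subset_carrier: "vclosure V S \<subseteq> carrier V"
  by (auto simp: vclosure_def)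

lemma vclosure_idem:
  assumes S: "S \<subseteq> carrier V"
  shows "vclosure V (vclosure V S) \<subseteq> vclosure V S"
proof
  fix x assume "x \<in> vclosure V (vclosure V S)"
  then have x: "x \<in> carrier V" and *: "\<And>e. e > 0 \<Longrightarrow> \<exists>y\<in>vclosure V S. vdist V y x < e"
    by (auto simp: vclosure_iff[OF vclosure_subset_carrier])
  show "x \<in> vclosure V S"
    unfolding vclosure_iff[OF S]
  proof (intro conjI allI impI x)
    fix e :: real assume e: "e > 0"
    then obtain y where y: "y \<in> vclosure V S" "vdist V y x < e / 2" using *[of "e/2"] by auto
    then obtain s where s: "s \<in> S" "vdist V s y < e / 2"
      using e unfolding vclosure_iff[OF S] by (meson half_gt_zero)
    have "vdist V s x \<le> vdist V s y + vdist V y x"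
      using x y s S vclosure_subset_carrier by (intro vdist_triangle) auto
    then show "\<exists>s\<in>S. vdist V s x < e" using s y by (intro bexI[of _ s]) auto
  qed
qed

lemma submodule_iff:
  "submodule M complex_ring V \<longleftrightarrow>
    M \<subseteq> carrier V \<and> \<zero> \<in> M \<and> (\<forall>x\<in>M. \<forall>y\<in>M. x \<oplus> y \<in> M) \<and> (\<forall>c. \<forall>x\<in>M. c \<odot> x \<in> M)"
proof
  assume M: "submodule M complex_ring V"
  then show "M \<subseteq> carrier V \<and> \<zero> \<in> M \<and> (\<forall>x\<in>M. \<forall>y\<in>M. x \<oplus> y \<in> M) \<and> (\<forall>c. \<forall>x\<in>M. c \<odot> x \<in> M)"
    using submoduleE(1,4,5)[OF M] subgroup.one_closed[OF submodule.axioms(1)[OF M]] by auto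
next
  assume "M \<subseteq> carrier V \<and> \<zero> \<in> M \<and> (\<forall>x\<in>M. \<forall>y\<in>M. x \<oplus> y \<in> M) \<and> (\<forall>c. \<forall>x\<in>M. c \<odot> x \<in> M)"
  then show "submodule M complex_ring V"
    by (intro submoduleI) (auto simp: neg_eq_smult subset_iff)
qed

lemma submodule_finsum:
  assumes "submodule M complex_ring V" "finite S" "\<And>i. i \<in> S \<Longrightarrow> f i \<in> M"
  shows "(\<Oplus>i\<in>S. f i) \<in> M"
  using assms(2,3)
proof (induction S)
  case (insert i S)
  then have "\<And>j. j \<in> insert i S \<Longrightarrow> f j \<in> carrier V"
    using assms(1) by (auto simp: submodule_iff)
  then show ?case using insert assms(1) by (simp add: submodule_iff Pi_def)
qed (use assms(1) in \<open>simp add: submodule_iff\<close>)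

lemma vclosure_submodule:
  assumes M: "submodule M complex_ring V"
  shows "submodule (vclosure V M) complex_ring V"
proof -
  have MV: "M \<subseteq> carrier V" using M by (simp add: submodule_iff)
  have "x \<oplus> y \<in> vclosure V M" if xy: "x \<in> vclosure V M" "y \<in> vclosure V M" for x y
  proof -
    obtain X Y where "\<And>n. X n \<in> M" "vlim X x" "\<And>n. Y n \<in> M" "vlim Y y"
      using xy by (auto simp: vclosure_iff_vlim[OF MV])
    then show ?thesis
      using M by (auto simp: vclosure_iff_vlim[OF MV] submodule_iff
          intro!: exI[of _ "\<lambda>n. X n \<oplus> Y n"] vlim_add)
  qed
  moreover have "c \<odot> x \<in> vclosure V M" if x: "x \<in> vclosure V M" for c x
  proof -
    obtain X where "\<And>n. X n \<in> M" "vlim X x"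
      using x by (auto simp: vclosure_iff_vlim[OF MV])
    then show ?thesis
      using M by (auto simp: vclosure_iff_vlim[OF MV] submodule_iff
          intro!: exI[of _ "\<lambda>n. c \<odot> X n"] vlim_smult)
  qed
  ultimately show ?thesis
    using M vclosure_superset[OF MV] vclosure_subset_carrier by (auto simp: submodule_iff)
qed

text \<open>The projection is a definite description, so it is computed by exhibiting its value.\<close>

lemma orth_projI:
  assumes M: "M \<subseteq> carrier V" and x: "x \<in> carrier V" and y: "y \<in> M"
    and orth: "\<And>z. z \<in> M \<Longrightarrow> cinner V (x \<ominus> y) z = 0"
  shows "orth_proj V M x = y"
  unfolding orth_proj_def
proof (rule the_equality)
  show "y \<in> M \<and> (\<forall>z\<in>M. cinner V (x \<ominus> y) z = 0)" using y orth by blast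
  fix w assume w: "w \<in> M \<and> (\<forall>z\<in>M. cinner V (x \<ominus> w) z = 0)"
  have c: "w \<in> carrier V" "y \<in> carrier V" using w y M by auto
  have "cinner V (w \<ominus> y) (w \<ominus> y) = 0"
    using w y orth[of w] orth[of y] bspec[OF conjunct2[OF w], of w] bspec[OF conjunct2[OF w], of y] c x
    by (simp add: cinner_simps)
  then show "w = y" using c cinner_definite[of "w \<ominus> y"] by (simp add: diff_eq_zero_iff)
qed

text \<open>Orthogonality to \<open>w\<close> is a linear and closed condition, so it passes from generators to the
  closed span.\<close>

lemma orthogonal_vspan:
  assumes S: "S \<subseteq> carrier V" and w: "w \<in> carrier V"
    and "\<And>z. z \<in> S \<Longrightarrow> cinner V w z = 0" and z: "z \<in> vclosure V (vspan V S)"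
  shows "cinner V w z = 0"
proof -
  have "submodule {z \<in> carrier V. cinner V w z = 0} complex_ring V"
    using w by (auto simp: submodule_iff cinner_simps)
  then have sub: "vspan V S \<subseteq> {z \<in> carrier V. cinner V w z = 0}"
    using assms unfolding vspan_def by (intro Inter_lower) auto
  then obtain X where X: "\<And>n. X n \<in> vspan V S" "vlim X z"
    using z vclosure_iff_vlim[of "vspan V S" z] by blast
  have "(\<lambda>n. cinner V w (X n)) \<longlonglongrightarrow> cinner V w z"
    by (intro vlim_cinner vlim_const w X)
  moreover have "cinner V w (X n) = 0" for n using X(1)[of n] sub by auto
  ultimately show ?thesis by (simp add: LIMSEQ_const_iff)
qed

text \<open>Restricting the carrier to a submodule changes neither the algebra nor the metric there;
  the subtraction of the restricted record is a description over the smaller carrier and has to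
  be identified with the ambient one.\<close>

lemma subspace_complex_ip_space:
  assumes M: "submodule M complex_ring V"
  shows "complex_ip_space (V\<lparr>carrier := M\<rparr>)"
proof -
  have MV: "M \<subseteq> carrier V" using M by (simp add: submodule_iff)
  have "module complex_ring (V\<lparr>carrier := M\<rparr>)"
    by (rule submodule.submodule_is_module[OF M module_axioms])
  then show ?thesis
    using MV by (intro complex_ip_space.intro complex_ip_space_axioms.intro)
      (auto simp: cinner_simps subset_iff intro: cinner_nonneg cinner_commute cinner_definite)
qed

lemma subspace_minus:
  assumes M: "submodule M complex_ring V" and x: "x \<in> M" and y: "y \<in> M"
  shows "x \<ominus>\<^bsub>V\<lparr>carrier := M\<rparr>\<^esub> y = x \<ominus> y"
proof -
  interpret S: complex_ip_space "V\<lparr>carrier := M\<rparr>" by (rule subspace_complex_ip_space[OF M])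
  have "y \<in> carrier V" using M y by (auto simp: submodule_iff)
  then show ?thesis using y S.neg_eq_smult[of y] by (simp add: a_minus_def neg_eq_smult)
qed

lemma subspace_vnorm: "vnorm (V\<lparr>carrier := M\<rparr>) x = vnorm V x"
  by (simp add: vnorm_def)

lemma subspace_vdist:
  "\<lbrakk>submodule M complex_ring V; x \<in> M; y \<in> M\<rbrakk> \<Longrightarrow> vdist (V\<lparr>carrier := M\<rparr>) x y = vdist V x y"
  by (simp add: vdist_def subspace_minus subspace_vnorm)

lemma subspace_finsum:
  assumes M: "submodule M complex_ring V" and "finite S" "\<And>i. i \<in> S \<Longrightarrow> f i \<in> M"
  shows "(\<Oplus>\<^bsub>V\<lparr>carrier := M\<rparr>\<^esub>i\<in>S. f i) = (\<Oplus>i\<in>S. f i)"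
  using assms(2,3)
proof (induction S)
  interpret S: complex_ip_space "V\<lparr>carrier := M\<rparr>" by (rule subspace_complex_ip_space[OF M])
  {
    case empty
    show ?case by simp
  next
    case (insert i S)
    have "\<And>j. j \<in> insert i S \<Longrightarrow> f j \<in> carrier V" using insert M by (auto simp: submodule_iff)
    then show ?case using insert by (simp add: Pi_def)
  }
qed

end


section \<open>Orthogonal projections in Hilbert spaces\<close>

definition closed_subspace :: "'v ip_space \<Rightarrow> 'v set \<Rightarrow> bool" where
  "closed_subspace V M \<longleftrightarrow> submodule M complex_ring V \<and> vclosure V M \<subseteq> M"

context hilbert_space
begin

lemma closed_subspace_hilbert:
  assumes "closed_subspace V M"
  shows "hilbert_space (V\<lparr>carrier := M\<rparr>)"
proof -
  have M: "submodule M complex_ring V" "vclosure V M \<subseteq> M"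
    using assms by (auto simp: closed_subspace_def)
  have MV: "M \<subseteq> carrier V" using M by (simp add: submodule_iff)
  interpret S: complex_ip_space "V\<lparr>carrier := M\<rparr>" by (rule subspace_complex_ip_space[OF M(1)])
  show ?thesis
  proof unfold_locales
    fix X assume X: "X \<in> cauchy_seqs (V\<lparr>carrier := M\<rparr>)"
    then have XM: "X n \<in> M" for n by (simp add: cauchy_seqs_def)
    have "X \<in> cauchy_seqs V"
      using X XM MV by (auto simp: cauchy_seqs_def subspace_vdist[OF M(1)])
    then obtain x where x: "x \<in> carrier V" "(\<lambda>n. vdist V (X n) x) \<longlonglongrightarrow> 0"
      using complete by blast
    then have "x \<in> M" using M XM by (auto simp: vclosure_def)
    then show "\<exists>x\<in>carrier (V\<lparr>carrier := M\<rparr>). (\<lambda>n. vdist (V\<lparr>carrier := M\<rparr>) (X n) x) \<longlonglongrightarrow> 0"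
      using x XM by (auto simp: subspace_vdist[OF M(1)])
  qed
qed

lemma cauchy_vlim:
  assumes "X \<in> cauchy_seqs V"
  obtains x where "vlim X x"
  using complete[OF assms] assms by (auto simp: vlim_def cauchy_seqs_def)

text \<open>The projection of \<open>x\<close> is the limit of a sequence in \<open>M\<close> that minimises the distance to \<open>x\<close>;
  it is Cauchy by the parallelogram law.\<close>

lemma projection_exists:
  assumes "closed_subspace V M" and x: "x \<in> carrier V"
  obtains y where "y \<in> M" "\<And>z. z \<in> M \<Longrightarrow> cinner V (x \<ominus> y) z = 0"
proof -
  have M: "submodule M complex_ring V" "vclosure V M \<subseteq> M"
    using assms by (auto simp: closed_subspace_def)
  have MV: "M \<subseteq> carrier V" using M by (simp add: submodule_iff)
  define D where "D = (\<lambda>m. (vnorm V (x \<ominus> m))\<^sup>2) ` M"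
  define d where "d = Inf D"
  have ne: "D \<noteq> {}" using M by (auto simp: D_def submodule_iff)
  have bdd: "bdd_below D" by (intro bdd_belowI[of _ 0]) (auto simp: D_def)
  have d_le: "d \<le> (vnorm V (x \<ominus> m))\<^sup>2" if "m \<in> M" for m
    unfolding d_def using that by (intro cInf_lower bdd) (simp add: D_def)
  have "\<exists>m\<in>M. (vnorm V (x \<ominus> m))\<^sup>2 < d + inverse (real (Suc n))" for n
  proof -
    have "\<exists>r\<in>D. r < d + inverse (real (Suc n))"
      unfolding d_def using ne by (intro cInf_lessD) auto
    then show ?thesis by (auto simp: D_def)
  qed
  then obtain Y where Y: "\<And>n. Y n \<in> M" "\<And>n. (vnorm V (x \<ominus> Y n))\<^sup>2 < d + inverse (real (Suc n))"
    by metis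
  have YV [simp]: "Y n \<in> carrier V" for n using Y(1) MV by auto
  \<comment> \<open>parallelogram law: the midpoint of two almost minimising points is no better than \<open>d\<close>\<close>
  have par: "(vdist V (Y m) (Y n))\<^sup>2 \<le> 2 * inverse (real (Suc m)) + 2 * inverse (real (Suc n))" for m n
  proof -
    let ?h = "(1/2) \<odot> (Y m \<oplus> Y n)"
    have h: "?h \<in> M" using M Y by (simp add: submodule_iff)
    have "(vdist V (Y m) (Y n))\<^sup>2 =
        2 * (vnorm V (x \<ominus> Y m))\<^sup>2 + 2 * (vnorm V (x \<ominus> Y n))\<^sup>2 - 4 * (vnorm V (x \<ominus> ?h))\<^sup>2"
      using x by (simp add: vdist_def vnorm_sq cinner_simps algebra_simps)
    then show ?thesis using d_le[OF h] Y(2)[of m] Y(2)[of n] by linarith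
  qed
  have "Y \<in> cauchy_seqs V"
    unfolding cauchy_seqs_def mem_Collect_eq
  proof (intro conjI allI impI YV)
    fix e :: real assume e: "e > 0"
    then obtain N where N: "inverse (real (Suc N)) < e\<^sup>2 / 4"
      using reals_Archimedean[of "e\<^sup>2 / 4"] by auto
    show "\<exists>N. \<forall>m\<ge>N. \<forall>n\<ge>N. vdist V (Y m) (Y n) < e"
    proof (intro exI[of _ N] allI impI)
      fix m n assume mn: "N \<le> m" "N \<le> n"
      have "inverse (real (Suc m)) \<le> inverse (real (Suc N))"
        "inverse (real (Suc n)) \<le> inverse (real (Suc N))"
        using mn by (simp_all add: inverse_le_iff_le)
      then have "(vdist V (Y m) (Y n))\<^sup>2 < e\<^sup>2" using par[of m n] N by linarith
      then show "vdist V (Y m) (Y n) < e" by (rule power2_less_imp_less) (use e in simp)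
    qed
  qed
  then obtain y where y: "vlim Y y" by (rule cauchy_vlim)
  have yM: "y \<in> M" using M Y(1) y vclosure_iff_vlim[OF MV] by blast
  have yV [simp]: "y \<in> carrier V" using y by (simp add: vlimD)
  have "vlim (\<lambda>n. x \<ominus> Y n) (x \<ominus> y)"
    using vlim_add[OF vlim_const[OF x] vlim_smult[OF y, of "-1"]] x
    by (simp add: a_minus_def neg_eq_smult)
  then have "(\<lambda>n. (vnorm V (x \<ominus> Y n))\<^sup>2) \<longlonglongrightarrow> (vnorm V (x \<ominus> y))\<^sup>2"
    by (rule vlim_vnorm)
  moreover have "(\<lambda>n. d + inverse (real (Suc n))) \<longlonglongrightarrow> d"
    using tendsto_add[OF tendsto_const LIMSEQ_inverse_real_of_nat, of d] by simp
  ultimately have yd: "(vnorm V (x \<ominus> y))\<^sup>2 \<le> d"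
    by (rule LIMSEQ_le) (use Y(2) in \<open>auto intro: less_imp_le\<close>)
  show ?thesis
  proof (rule that[OF yM])
    fix z assume z: "z \<in> M"
    then have zV [simp]: "z \<in> carrier V" using MV by auto
    show "cinner V (x \<ominus> y) z = 0"
    proof (cases "z = \<zero>")
      case False
      \<comment> \<open>moving \<open>y\<close> along \<open>z\<close> by this \<open>c\<close> would decrease the distance unless \<open>p = 0\<close>\<close>
      define w p N c where "w = x \<ominus> y" and "p = cinner V w z" and "N = (vnorm V z)\<^sup>2"
        and "c = p / of_real N"
      have w: "w \<in> carrier V" using x by (simp add: w_def)
      have N: "N > 0" using False vnorm_eq_0_iff[of z] by (simp add: N_def)
      have "y \<oplus> c \<odot> z \<in> M" using M yM z by (simp add: submodule_iff)
      then have "d \<le> (vnorm V (x \<ominus> (y \<oplus> c \<odot> z)))\<^sup>2" by (rule d_le)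
      also have "x \<ominus> (y \<oplus> c \<odot> z) = w \<ominus> c \<odot> z"
        using x by (intro eq_by_testing) (simp_all add: w_def cinner_simps)
      also have "(vnorm V (w \<ominus> c \<odot> z))\<^sup>2 = (vnorm V w)\<^sup>2 - 2 * Re (cnj c * p) + (cmod c)\<^sup>2 * N"
        using w by (simp add: vnorm_diff_sq vnorm_smult cinner_simps p_def N_def power_mult_distrib)
      also have "cnj c * p = of_real ((cmod p)\<^sup>2 / N)"
        by (simp add: c_def complex_norm_square mult.commute del: of_real_power)
      also have "(cmod c)\<^sup>2 * N = (cmod p)\<^sup>2 / N"
        using N by (simp add: c_def norm_divide power_divide power2_eq_square)
      finally have "(cmod p)\<^sup>2 / N \<le> 0" using yd by (simp add: w_def)
      then show ?thesis using N by (simp add: p_def w_def divide_le_0_iff)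
    qed (use x in simp)
  qed
qed

lemma orth_proj_in:
  assumes "closed_subspace V M" "x \<in> carrier V"
  shows "orth_proj V M x \<in> M"
    and "z \<in> M \<Longrightarrow> cinner V (x \<ominus> orth_proj V M x) z = 0"
proof -
  obtain y where y: "y \<in> M" "\<And>z. z \<in> M \<Longrightarrow> cinner V (x \<ominus> y) z = 0"
    using projection_exists[OF assms] by blast
  have "orth_proj V M x = y"
    using assms y by (intro orth_projI) (auto simp: closed_subspace_def submodule_iff)
  then show "orth_proj V M x \<in> M" and "z \<in> M \<Longrightarrow> cinner V (x \<ominus> orth_proj V M x) z = 0"
    using y by auto
qed

end


section \<open>Linear isometries, quotients and completions\<close>

lemma module_diff:
  assumes "module complex_ring V" "x \<in> carrier V" "y \<in> carrier V"
  shows "x \<ominus>\<^bsub>V\<^esub> y = x \<oplus>\<^bsub>V\<^esub> (-1) \<odot>\<^bsub>V\<^esub> y"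
proof -
  interpret module complex_ring V by fact
  show ?thesis using assms smult_l_minus[of 1 y] smult_one[of y] by (simp add: a_minus_def)
qed

lemma vlinearD:
  assumes "vlinear V W T"
  shows "x \<in> carrier V \<Longrightarrow> T x \<in> carrier W"
    and "\<lbrakk>x \<in> carrier V; y \<in> carrier V\<rbrakk> \<Longrightarrow> T (x \<oplus>\<^bsub>V\<^esub> y) = T x \<oplus>\<^bsub>W\<^esub> T y"
    and "x \<in> carrier V \<Longrightarrow> T (c \<odot>\<^bsub>V\<^esub> x) = c \<odot>\<^bsub>W\<^esub> T x"
  using assms by (auto simp: vlinear_def)

lemma vlinear_zero:
  assumes "module complex_ring V" "module complex_ring W" "vlinear V W T"
  shows "T \<zero>\<^bsub>V\<^esub> = \<zero>\<^bsub>W\<^esub>"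
proof -
  interpret V: module complex_ring V by fact
  interpret W: module complex_ring W by fact
  have "T (0 \<odot>\<^bsub>V\<^esub> \<zero>\<^bsub>V\<^esub>) = 0 \<odot>\<^bsub>W\<^esub> T \<zero>\<^bsub>V\<^esub>"
    by (rule vlinearD(3)[OF assms(3)]) simp
  then show ?thesis
    using V.smult_l_null[of "\<zero>\<^bsub>V\<^esub>"] W.smult_l_null[of "T \<zero>\<^bsub>V\<^esub>"] vlinearD(1)[OF assms(3), of "\<zero>\<^bsub>V\<^esub>"]
    by simp
qed

lemma vlinear_diff:
  assumes "module complex_ring V" "module complex_ring W" "vlinear V W T"
    and "x \<in> carrier V" "y \<in> carrier V"
  shows "T (x \<ominus>\<^bsub>V\<^esub> y) = T x \<ominus>\<^bsub>W\<^esub> T y"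
proof -
  interpret V: module complex_ring V by fact
  have "(-1) \<odot>\<^bsub>V\<^esub> y \<in> carrier V" using assms by simp
  then show ?thesis
    using assms by (simp add: module_diff vlinearD[OF assms(3)])
qed

lemma vdist_isometry:
  assumes "module complex_ring V" "module complex_ring W" "vlinear V W T"
    and "\<And>x y. \<lbrakk>x \<in> carrier V; y \<in> carrier V\<rbrakk> \<Longrightarrow> cinner W (T x) (T y) = cinner V x y"
    and "x \<in> carrier V" "y \<in> carrier V"
  shows "vdist W (T x) (T y) = vdist V x y"
proof -
  interpret V: module complex_ring V by fact
  have "x \<ominus>\<^bsub>V\<^esub> y \<in> carrier V" using assms by simp
  then show ?thesis
    using assms by (simp add: vdist_def vnorm_def flip: vlinear_diff[OF assms(1-3)])
qed

lemma vlinear_image_submodule: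
  assumes "module complex_ring V" "complex_ip_space W" "vlinear V W T"
  shows "submodule (T ` carrier V) complex_ring W"
proof -
  interpret V: module complex_ring V by fact
  interpret W: complex_ip_space W by fact
  note T = vlinearD[OF assms(3)]
  have "\<zero>\<^bsub>W\<^esub> = T \<zero>\<^bsub>V\<^esub>"
    using vlinear_zero[OF assms(1) W.module_axioms assms(3)] by simp
  then show ?thesis
    unfolding W.submodule_iff
    by (auto simp: T simp flip: T(2,3))
qed

lemma vlinear_kernel_submodule:
  assumes "module complex_ring V" "complex_ip_space W" "vlinear V W T"
  shows "submodule {x \<in> carrier V. T x = \<zero>\<^bsub>W\<^esub>} complex_ring V"
proof -
  interpret V: module complex_ring V by fact
  interpret W: complex_ip_space W by fact
  note T = vlinearD[OF assms(3)]
  have zero: "T \<zero>\<^bsub>V\<^esub> = \<zero>\<^bsub>W\<^esub>"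
    by (rule vlinear_zero[OF assms(1) W.module_axioms assms(3)])
  have neg: "T (\<ominus>\<^bsub>V\<^esub> x) = \<zero>\<^bsub>W\<^esub>" if "x \<in> carrier V" "T x = \<zero>\<^bsub>W\<^esub>" for x
    using vlinear_diff[OF assms(1) W.module_axioms assms(3) V.M.zero_closed that(1)] that zero
    by (simp add: a_minus_def)
  show ?thesis
    by (rule V.submoduleI) (auto simp: T zero neg)
qed

lemma vspan_submodule:
  assumes "module complex_ring V" "S \<subseteq> carrier V"
  shows "submodule (vspan V S) complex_ring V"
proof -
  interpret V: module complex_ring V by fact
  have zero: "\<zero>\<^bsub>V\<^esub> \<in> M" if "submodule M complex_ring V" for M
    using subgroup.one_closed[OF submodule.axioms(1)[OF that]] by simp
  show ?thesis
  proof (rule V.submoduleI)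
    show "vspan V S \<subseteq> carrier V"
      unfolding vspan_def using assms(2) V.carrier_is_submodule by (intro Inter_lower) auto
  qed (auto simp: vspan_def zero V.submoduleE)
qed

lemma vspan_superset: "S \<subseteq> vspan V S"
  by (auto simp: vspan_def)

lemma vspan_minimal: "\<lbrakk>submodule M complex_ring V; S \<subseteq> M\<rbrakk> \<Longrightarrow> vspan V S \<subseteq> M"
  by (auto simp: vspan_def)

text \<open>A completion consists of classes of sequences.  It inherits the axioms through a bijection with
  a known space, which avoids checking them on representatives.\<close>

lemma complex_ip_space_transport:
  assumes "complex_ip_space V" and U: "unitary V W U" and zero: "U \<zero>\<^bsub>V\<^esub> = \<zero>\<^bsub>W\<^esub>"
  shows "complex_ip_space W"
proof -
  interpret V: complex_ip_space V by fact
  have lin: "vlinear V W U" and img: "carrier W = U ` carrier V"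
    and inj: "inj_on U (carrier V)"
    and iso: "\<And>x y. \<lbrakk>x \<in> carrier V; y \<in> carrier V\<rbrakk> \<Longrightarrow> cinner W (U x) (U y) = cinner V x y"
    using U by (auto simp: unitary_def bij_betw_def)
  note T = vlinearD(2,3)[OF lin, symmetric]
  have "abelian_group W"
  proof (rule abelian_groupI)
    fix x assume "x \<in> carrier W"
    then obtain v where v: "x = U v" "v \<in> carrier V" by (auto simp: img)
    then have "U (\<ominus>\<^bsub>V\<^esub> v) \<oplus>\<^bsub>W\<^esub> x = \<zero>\<^bsub>W\<^esub>" by (simp add: T V.l_neg zero)
    then show "\<exists>y\<in>carrier W. y \<oplus>\<^bsub>W\<^esub> x = \<zero>\<^bsub>W\<^esub>"
      using v by (auto simp: img)
  qed (auto simp: img T V.a_ac simp flip: zero)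
  then have "module complex_ring W"
    by (rule moduleI[OF cring_complex_ring])
      (auto simp: img T V.smult_l_distr[simplified] V.smult_r_distr
        V.smult_assoc1[simplified] V.smult_one[simplified])
  then show ?thesis
  proof (intro complex_ip_space.intro complex_ip_space_axioms.intro)
    show "cinner W x y = cnj (cinner W y x)" if "x \<in> carrier W" "y \<in> carrier W" for x y
      using that by (auto simp: img iso intro: V.cinner_commute)
    show "x = \<zero>\<^bsub>W\<^esub>" if "x \<in> carrier W" "cinner W x x = 0" for x
      using that V.cinner_definite by (auto simp: img iso simp flip: zero)
  qed (auto simp: img iso T V.cinner_simps V.cinner_nonneg)
qed

lemma complex_ip_space_pullback:
  assumes "module complex_ring V" "complex_ip_space W" "vlinear V W T" "inj_on T (carrier V)"
    and iso: "\<And>x y. \<lbrakk>x \<in> carrier V; y \<in> carrier V\<rbrakk> \<Longrightarrow> cinner W (T x) (T y) = cinner V x y"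
  shows "complex_ip_space V"
proof -
  interpret V: module complex_ring V by fact
  interpret W: complex_ip_space W by fact
  note T = vlinearD[OF assms(3)]
  have zero: "T \<zero>\<^bsub>V\<^esub> = \<zero>\<^bsub>W\<^esub>"
    by (rule vlinear_zero[OF assms(1) W.module_axioms assms(3)])
  have sm: "c \<odot>\<^bsub>V\<^esub> x \<in> carrier V" if "x \<in> carrier V" for c x using that by simp
  show ?thesis
  proof unfold_locales
    show "cinner V x y = cnj (cinner V y x)" if "x \<in> carrier V" "y \<in> carrier V" for x y
      using that W.cinner_commute[of "T x" "T y"] by (simp add: T flip: iso)
    show "x = \<zero>\<^bsub>V\<^esub>" if "x \<in> carrier V" "cinner V x x = 0" for x
    proof -
      have "T x = T \<zero>\<^bsub>V\<^esub>" using that W.cinner_definite[of "T x"] by (simp add: T zero iso)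
      then show ?thesis using assms(4) that by (auto dest: inj_onD)
    qed
    show "0 \<le> Re (cinner V x x)" if "x \<in> carrier V" for x
      using that W.cinner_nonneg[of "T x"] by (simp add: T iso)
    show "cinner V (x \<oplus>\<^bsub>V\<^esub> y) z = cinner V x z + cinner V y z"
      if "x \<in> carrier V" "y \<in> carrier V" "z \<in> carrier V" for x y z
      using that by (simp add: T W.cinner_simps flip: iso)
    show "cinner V (c \<odot>\<^bsub>V\<^esub> x) z = c * cinner V x z"
      if "x \<in> carrier V" "z \<in> carrier V" for c x z
      using that by (simp add: T sm W.cinner_simps flip: iso)
  qed
qed


subsection \<open>Quotients\<close>

locale quotient_setup = module complex_ring V for V :: "'v ip_space" (structure) +
  fixes N
  assumes N: "submodule N complex_ring V"
begin

sublocale abelian_subgroup N V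
  by (rule abelian_subgroupI3)
    (auto intro: additive_subgroupI submodule.axioms(1)[OF N] abelian_group_axioms)

lemma coset_eq_iff:
  assumes "x \<in> carrier V" "y \<in> carrier V"
  shows "N +> x = N +> y \<longleftrightarrow> x \<ominus> y \<in> N"
proof
  assume "N +> x = N +> y"
  then have "N +> (x \<ominus> y) = N"
    using assms a_subset by (simp add: a_minus_def a_coset_add_inv2)
  then show "x \<ominus> y \<in> N"
    using assms a_rcos_self[of "x \<ominus> y"] by simp
next
  assume "x \<ominus> y \<in> N"
  then have "N +> (x \<ominus> y) = N"
    using assms a_subgroup by (intro a_coset_join2) auto
  then show "N +> x = N +> y"
    using assms a_subset by (simp add: a_minus_def a_coset_add_inv1)
qed

text \<open>The form of the quotient is evaluated on chosen representatives, hence the interest in what the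
  choice yields.\<close>

lemma coset_rep:
  assumes x: "x \<in> carrier V"
  shows "(SOME y. y \<in> N +> x) \<in> carrier V" and "N +> (SOME y. y \<in> N +> x) = N +> x"
proof -
  have *: "(SOME y. y \<in> N +> x) \<in> N +> x"
    using a_rcos_self[OF x] by (rule someI)
  then show "(SOME y. y \<in> N +> x) \<in> carrier V"
    using a_r_coset_subset_G[OF a_subset x] by blast
  show "N +> (SOME y. y \<in> N +> x) = N +> x"
    by (rule a_repr_independence[OF * x a_subgroup, symmetric])
qed

lemma carrier_quotient: "carrier (quotient_space V N) = (\<lambda>x. N +> x) ` carrier V"
  by (auto simp: quotient_space_def A_RCOSETS_def')

lemma add_quotient:
  "\<lbrakk>x \<in> carrier V; y \<in> carrier V\<rbrakk> \<Longrightarrow>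
    (N +> x) \<oplus>\<^bsub>quotient_space V N\<^esub> (N +> y) = N +> (x \<oplus> y)"
  by (simp add: quotient_space_def a_rcos_sum)

lemma zero_quotient: "\<zero>\<^bsub>quotient_space V N\<^esub> = N +> \<zero>"
  using a_subset by (simp add: quotient_space_def)

lemma smult_quotient:
  assumes x: "x \<in> carrier V"
  shows "c \<odot>\<^bsub>quotient_space V N\<^esub> (N +> x) = N +> (c \<odot> x)"
proof -
  have "N +> (c \<odot> y) = N +> (c \<odot> x)" if y: "y \<in> N +> x" for y
  proof -
    have yc: "y \<in> carrier V" using a_r_coset_subset_G[OF a_subset x] y by blast
    have "N +> y = N +> x"
      by (rule a_repr_independence[OF y x a_subgroup, symmetric])
    then have "c \<odot> (y \<ominus> x) \<in> N"
      using x yc submoduleE(4)[OF N] by (simp add: coset_eq_iff)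
    also have "c \<odot> (y \<ominus> x) = c \<odot> y \<ominus> c \<odot> x"
      using x yc by (simp add: a_minus_def smult_r_distr smult_r_minus)
    finally show ?thesis using x yc by (simp add: coset_eq_iff)
  qed
  then have "(\<Union>y\<in>N +> x. N +> (c \<odot> y)) = (\<Union>y\<in>N +> x. N +> (c \<odot> x))"
    by (intro SUP_cong refl)
  also have "\<dots> = N +> (c \<odot> x)"
    using a_rcos_self[OF x] by (subst UN_constant) (simp split: if_splits, blast)
  finally show ?thesis by (simp add: quotient_space_def)
qed

lemma module_quotient: "module complex_ring (quotient_space V N)"
proof (rule moduleI[OF cring_complex_ring])
  show "abelian_group (quotient_space V N)"
  proof (rule abelian_groupI)
    fix X assume "X \<in> carrier (quotient_space V N)"
    then obtain x where x: "X = N +> x" "x \<in> carrier V" by (auto simp: carrier_quotient)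
    then have "(N +> \<ominus> x) \<oplus>\<^bsub>quotient_space V N\<^esub> X = \<zero>\<^bsub>quotient_space V N\<^esub>"
      by (simp add: add_quotient zero_quotient M.l_neg)
    then show "\<exists>Y\<in>carrier (quotient_space V N). Y \<oplus>\<^bsub>quotient_space V N\<^esub> X = \<zero>\<^bsub>quotient_space V N\<^esub>"
      using x by (auto simp: carrier_quotient)
  qed (auto simp: carrier_quotient add_quotient zero_quotient M.a_ac)
qed (auto simp: carrier_quotient add_quotient smult_quotient smult_l_distr[simplified] smult_r_distr
      smult_assoc1[simplified] smult_one[simplified])

text \<open>Two representatives of a coset differ by an element of \<open>N\<close>, which \<open>T\<close> kills.  This makes the
  evaluation of the form on chosen representatives independent of the choice, since \<open>T\<close> computes
  the form.\<close>

lemma quotient_map: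
  assumes W: "module complex_ring W" and T: "vlinear V W T"
    and iso: "\<And>x y. \<lbrakk>x \<in> carrier V; y \<in> carrier V\<rbrakk> \<Longrightarrow> cinner W (T x) (T y) = cinner V x y"
    and ker: "\<And>x. x \<in> N \<Longrightarrow> T x = \<zero>\<^bsub>W\<^esub>"
  defines "T' \<equiv> \<lambda>X. T (SOME x. x \<in> X)"
  shows "x \<in> carrier V \<Longrightarrow> T' (N +> x) = T x"
    and "vlinear (quotient_space V N) W T'"
    and "\<lbrakk>X \<in> carrier (quotient_space V N); Y \<in> carrier (quotient_space V N)\<rbrakk> \<Longrightarrow>
      cinner W (T' X) (T' Y) = cinner (quotient_space V N) X Y"
proof -
  interpret W: module complex_ring W by fact
  note TD = vlinearD[OF T]
  have T': "T' (N +> x) = T x" if x: "x \<in> carrier V" for x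
  proof -
    let ?y = "SOME y. y \<in> N +> x"
    have y: "?y \<in> carrier V" "?y \<ominus> x \<in> N"
      using coset_rep[OF x] x by (simp_all flip: coset_eq_iff)
    then have 0: "T ?y \<ominus>\<^bsub>W\<^esub> T x = \<zero>\<^bsub>W\<^esub>"
      using ker x by (simp flip: vlinear_diff[OF module_axioms W T])
    have "T ?y = (T ?y \<ominus>\<^bsub>W\<^esub> T x) \<oplus>\<^bsub>W\<^esub> T x"
      using y(1) x by (simp add: TD a_minus_def W.M.a_assoc W.M.l_neg)
    then show ?thesis using x by (simp add: T'_def 0 TD)
  qed
  then show "x \<in> carrier V \<Longrightarrow> T' (N +> x) = T x" .
  show "vlinear (quotient_space V N) W T'"
    by (auto simp: vlinear_def carrier_quotient add_quotient smult_quotient T' TD)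
  show "cinner W (T' X) (T' Y) = cinner (quotient_space V N) X Y"
    if XY: "X \<in> carrier (quotient_space V N)" "Y \<in> carrier (quotient_space V N)"
  proof -
    obtain x y where "X = N +> x" "Y = N +> y" "x \<in> carrier V" "y \<in> carrier V"
      using XY by (auto simp: carrier_quotient)
    then show ?thesis
      by (simp add: T'_def iso coset_rep(1) quotient_space_def)
  qed
qed

end


subsection \<open>Completions\<close>

text \<open>The completion of a space that embeds isometrically into a Hilbert space \<open>W\<close> is realised by
  the closure of the image: a point \<open>y\<close> of the closure corresponds to the class of all sequences
  whose images converge to \<open>y\<close>.\<close>

definition completion_point :: "'v ip_space \<Rightarrow> 'w ip_space \<Rightarrow> ('v \<Rightarrow> 'w) \<Rightarrow> 'w \<Rightarrow> (nat \<Rightarrow> 'v) set" where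
  "completion_point P W \<phi> y =
     {X. (\<forall>n. X n \<in> carrier P) \<and> (\<lambda>n. vdist W (\<phi> (X n)) y) \<longlonglongrightarrow> 0}"

lemma completion_realised:
  assumes P: "complex_ip_space P" and W: "hilbert_space W" and \<phi>: "vlinear P W \<phi>"
    and iso: "\<And>x y. \<lbrakk>x \<in> carrier P; y \<in> carrier P\<rbrakk> \<Longrightarrow> cinner W (\<phi> x) (\<phi> y) = cinner P x y"
  defines "M \<equiv> vclosure W (\<phi> ` carrier P)"
  shows "unitary (W\<lparr>carrier := M\<rparr>) (hilbert_completion P) (completion_point P W \<phi>)"
    and "x \<in> carrier P \<Longrightarrow> completion_point P W \<phi> (\<phi> x) = completion_embed P x"
    and "completion_point P W \<phi> \<zero>\<^bsub>W\<^esub> = \<zero>\<^bsub>hilbert_completion P\<^esub>"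
proof -
  interpret P: complex_ip_space P by fact
  interpret W: hilbert_space W by fact
  let ?\<Psi> = "completion_point P W \<phi>"
  let ?C = "hilbert_completion P"
  note \<phi>D = vlinearD[OF \<phi>]
  have img: "\<phi> ` carrier P \<subseteq> carrier W" using \<phi>D(1) by auto
  have dist: "vdist W (\<phi> x) (\<phi> y) = vdist P x y" if "x \<in> carrier P" "y \<in> carrier P" for x y
    by (rule vdist_isometry[OF P.module_axioms W.module_axioms \<phi> iso that])
  have MW: "M \<subseteq> carrier W" unfolding M_def by (rule W.vclosure_subset_carrier)
  have lim: "W.vlim (\<lambda>n. \<phi> (X n)) y" if "X \<in> ?\<Psi> y" "y \<in> carrier W" for X y
    using that \<phi>D(1) by (auto simp: completion_point_def W.vlim_def)
  have mem: "X \<in> ?\<Psi> y" if "\<And>n. X n \<in> carrier P" "W.vlim (\<lambda>n. \<phi> (X n)) y" for X y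
    using that by (auto simp: completion_point_def W.vlim_def)
  have car: "X n \<in> carrier P" if "X \<in> ?\<Psi> y" for X y n
    using that by (auto simp: completion_point_def)
  have cauchy: "X \<in> cauchy_seqs P" if X: "X \<in> ?\<Psi> y" and y: "y \<in> carrier W" for X y
    using W.vlim_cauchy[OF lim[OF X y]] car[OF X] by (simp add: cauchy_seqs_def dist)
  \<comment> \<open>sequences with the same limit are equivalent, and sequences equivalent to one with limit \<open>y\<close>
     have limit \<open>y\<close>: the sets \<open>?\<Psi> y\<close> are precisely the classes\<close>
  have cls: "?\<Psi> y = cauchy_rel P `` {X}" if X: "X \<in> ?\<Psi> y" and y: "y \<in> carrier W" for X y
  proof (intro equalityI subsetI)
    fix Y assume Y: "Y \<in> ?\<Psi> y"
    have "(\<lambda>n. vdist P (X n) (Y n)) \<longlonglongrightarrow> 0"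
    proof (rule tendsto_sandwich[OF _ _ tendsto_const])
      show "(\<lambda>n. vdist W (\<phi> (X n)) y + vdist W (\<phi> (Y n)) y) \<longlonglongrightarrow> 0"
        using tendsto_add[OF W.vlimD(3)[OF lim[OF X y]] W.vlimD(3)[OF lim[OF Y y]]] by simp
      show "\<forall>\<^sub>F n in sequentially. vdist P (X n) (Y n) \<le> vdist W (\<phi> (X n)) y + vdist W (\<phi> (Y n)) y"
      proof (rule eventuallyI)
        fix n
        have c: "X n \<in> carrier P" "Y n \<in> carrier P" using car X Y by auto
        show "vdist P (X n) (Y n) \<le> vdist W (\<phi> (X n)) y + vdist W (\<phi> (Y n)) y"
          using W.vdist_triangle[of "\<phi> (X n)" y "\<phi> (Y n)"] c y
          by (simp add: \<phi>D dist W.vdist_commute[of y])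
      qed
    qed (use car[OF X] car[OF Y] in simp)
    then show "Y \<in> cauchy_rel P `` {X}"
      using cauchy X Y y by (simp add: cauchy_rel_def)
  next
    fix Y assume "Y \<in> cauchy_rel P `` {X}"
    then have Yc: "\<And>n. Y n \<in> carrier P" and Yd: "(\<lambda>n. vdist P (X n) (Y n)) \<longlonglongrightarrow> 0"
      by (auto simp: cauchy_rel_def cauchy_seqs_def)
    have "W.vlim (\<lambda>n. \<phi> (Y n)) y"
    proof (rule W.vlim_squeeze)
      fix n
      show "vdist W (\<phi> (Y n)) y \<le> vdist P (X n) (Y n) + vdist W (\<phi> (X n)) y"
        using W.vdist_triangle[of "\<phi> (Y n)" "\<phi> (X n)" y] Yc[of n] car[OF X, of n] y
        by (simp add: \<phi>D dist P.vdist_commute[of "Y n"])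
    next
      show "(\<lambda>n. vdist P (X n) (Y n) + vdist W (\<phi> (X n)) y) \<longlonglongrightarrow> 0"
        using tendsto_add[OF Yd W.vlimD(3)[OF lim[OF X y]]] by simp
    qed (use y Yc in \<open>simp_all add: \<phi>D\<close>)
    then show "Y \<in> ?\<Psi> y" by (rule mem[OF Yc])
  qed
  have ne: "\<exists>X. X \<in> ?\<Psi> y" if y: "y \<in> M" for y
  proof -
    obtain Z where Z: "\<And>n. Z n \<in> \<phi> ` carrier P" "W.vlim Z y"
      using y by (auto simp: M_def W.vclosure_iff_vlim[OF img])
    then obtain X where X: "\<And>n. X n \<in> carrier P" "\<And>n. Z n = \<phi> (X n)"
      unfolding image_iff by metis
    then have "Z = (\<lambda>n. \<phi> (X n))" by auto
    then show ?thesis using mem[of X y] X Z by auto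
  qed
  have inC: "?\<Psi> y \<in> carrier ?C" if y: "y \<in> M" for y
  proof -
    obtain X where X: "X \<in> ?\<Psi> y" using ne[OF y] by blast
    then show ?thesis
      using cls[OF X] cauchy[OF X] subsetD[OF MW y] by (simp add: hilbert_completion_def quotientI)
  qed
  have onto: "\<exists>y\<in>M. Q = ?\<Psi> y" if Q: "Q \<in> carrier ?C" for Q
  proof -
    obtain X where X: "X \<in> cauchy_seqs P" "Q = cauchy_rel P `` {X}"
      using Q by (auto simp: hilbert_completion_def elim: quotientE)
    then have "(\<lambda>n. \<phi> (X n)) \<in> cauchy_seqs W"
      by (simp add: cauchy_seqs_def dist \<phi>D)
    then obtain y where y: "W.vlim (\<lambda>n. \<phi> (X n)) y" by (rule W.cauchy_vlim)
    have Xc: "X n \<in> carrier P" for n using X by (simp add: cauchy_seqs_def)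
    have "y \<in> M"
      unfolding M_def W.vclosure_iff_vlim[OF img]
      using y Xc by (intro exI[of _ "\<lambda>n. \<phi> (X n)"]) auto
    moreover have "Q = ?\<Psi> y" using cls[OF mem[OF Xc y]] y X by (simp add: W.vlimD)
    ultimately show ?thesis by blast
  qed
  have inj: "inj_on ?\<Psi> M"
  proof
    fix y z assume yz: "y \<in> M" "z \<in> M" "?\<Psi> y = ?\<Psi> z"
    obtain X where "X \<in> ?\<Psi> y" using ne[OF yz(1)] by blast
    then show "y = z" using yz MW by (intro W.vlim_unique[OF lim lim]) auto
  qed
  have Ms: "submodule M complex_ring W"
    unfolding M_def
    by (intro W.vclosure_submodule vlinear_image_submodule[OF P.module_axioms _ \<phi>])
      (rule W.complex_ip_space_axioms)
  have add: "?\<Psi> (y \<oplus>\<^bsub>W\<^esub> z) = ?\<Psi> y \<oplus>\<^bsub>?C\<^esub> ?\<Psi> z" if y: "y \<in> M" and z: "z \<in> M" for y z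
  proof -
    have yz: "y \<in> carrier W" "z \<in> carrier W" using y z MW by auto
    have "cauchy_rel P `` {\<lambda>n. X n \<oplus>\<^bsub>P\<^esub> Y n} = ?\<Psi> (y \<oplus>\<^bsub>W\<^esub> z)"
      if X: "X \<in> ?\<Psi> y" and Y: "Y \<in> ?\<Psi> z" for X Y
    proof (rule cls[symmetric])
      show "(\<lambda>n. X n \<oplus>\<^bsub>P\<^esub> Y n) \<in> ?\<Psi> (y \<oplus>\<^bsub>W\<^esub> z)"
        using W.vlim_add[OF lim[OF X yz(1)] lim[OF Y yz(2)]] car[OF X] car[OF Y]
        by (intro mem) (simp_all add: \<phi>D)
    qed (use yz in simp)
    then show ?thesis using ne[OF y] ne[OF z] by (auto simp: hilbert_completion_def)
  qed
  have smult: "?\<Psi> (c \<odot>\<^bsub>W\<^esub> y) = c \<odot>\<^bsub>?C\<^esub> ?\<Psi> y" if y: "y \<in> M" for c y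
  proof -
    have yc: "y \<in> carrier W" using y MW by auto
    have "cauchy_rel P `` {\<lambda>n. c \<odot>\<^bsub>P\<^esub> X n} = ?\<Psi> (c \<odot>\<^bsub>W\<^esub> y)" if X: "X \<in> ?\<Psi> y" for X
    proof (rule cls[symmetric])
      show "(\<lambda>n. c \<odot>\<^bsub>P\<^esub> X n) \<in> ?\<Psi> (c \<odot>\<^bsub>W\<^esub> y)"
        using W.vlim_smult[OF lim[OF X yc], of c] car[OF X]
        by (intro mem) (simp_all add: \<phi>D)
    qed (use yc in simp)
    then show ?thesis using ne[OF y] by (auto simp: hilbert_completion_def)
  qed
  have inner: "cinner ?C (?\<Psi> y) (?\<Psi> z) = cinner W y z" if y: "y \<in> M" and z: "z \<in> M" for y z
  proof -
    let ?X = "SOME X. X \<in> ?\<Psi> y" and ?Y = "SOME Y. Y \<in> ?\<Psi> z"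
    have X: "?X \<in> ?\<Psi> y" using ne[OF y] by (rule someI_ex)
    have Y: "?Y \<in> ?\<Psi> z" using ne[OF z] by (rule someI_ex)
    have "(\<lambda>n. cinner W (\<phi> (?X n)) (\<phi> (?Y n))) \<longlonglongrightarrow> cinner W y z"
      using y z MW by (intro W.vlim_cinner lim[OF X] lim[OF Y]) auto
    then have "(\<lambda>n. cinner P (?X n) (?Y n)) \<longlonglongrightarrow> cinner W y z"
      by (simp add: iso car[OF X] car[OF Y])
    then show ?thesis by (simp add: hilbert_completion_def limI)
  qed
  show "unitary (W\<lparr>carrier := M\<rparr>) ?C ?\<Psi>"
    unfolding unitary_def vlinear_def bij_betw_def
    using inC onto inj add smult inner by (auto simp: image_iff)
  show emb: "?\<Psi> (\<phi> x) = completion_embed P x" if x: "x \<in> carrier P" for x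
    unfolding completion_embed_def
    by (rule cls) (use x in \<open>auto intro!: mem W.vlim_const simp: \<phi>D\<close>)
  show "?\<Psi> \<zero>\<^bsub>W\<^esub> = \<zero>\<^bsub>?C\<^esub>"
    using emb[of "\<zero>\<^bsub>P\<^esub>"] vlinear_zero[OF P.module_axioms W.module_axioms \<phi>]
    by (simp add: hilbert_completion_def)
qed


section \<open>Orthogonal decompositions\<close>

context hilbert_space
begin

lemma cinner_orth_proj:
  assumes "closed_subspace V M" "x \<in> carrier V" "z \<in> M"
  shows "cinner V (orth_proj V M x) z = cinner V x z"
    and "cinner V z (orth_proj V M x) = cinner V z x"
proof -
  have c: "z \<in> carrier V" "orth_proj V M x \<in> carrier V"
    using assms orth_proj_in(1)[OF assms(1,2)] by (auto simp: closed_subspace_def submodule_iff)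
  show 1: "cinner V (orth_proj V M x) z = cinner V x z"
    using orth_proj_in(2)[OF assms] assms(2) c by (simp add: cinner_simps)
  show "cinner V z (orth_proj V M x) = cinner V z x"
    using cinner_commute[of z "orth_proj V M x"] cinner_commute[of z x] c assms(2) 1 by simp
qed

end

locale orthogonal_family = hilbert_space V for V :: "'v ip_space" (structure) +
  fixes I :: "'i set" and M :: "'i \<Rightarrow> 'v set"
  assumes closed: "i \<in> I \<Longrightarrow> closed_subspace V (M i)"
    and orth: "\<lbrakk>i \<in> I; j \<in> I; i \<noteq> j; x \<in> M i; y \<in> M j\<rbrakk> \<Longrightarrow> cinner V x y = 0"
    and total: "\<lbrakk>x \<in> carrier V; \<And>i y. \<lbrakk>i \<in> I; y \<in> M i\<rbrakk> \<Longrightarrow> cinner V x y = 0\<rbrakk> \<Longrightarrow> x = \<zero>"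
begin

abbreviation comp :: "'i \<Rightarrow> 'v \<Rightarrow> 'v" where "comp i x \<equiv> orth_proj V (M i) x"

lemma sub: "i \<in> I \<Longrightarrow> submodule (M i) complex_ring V"
  using closed by (simp add: closed_subspace_def)

lemma in_carrier: "\<lbrakk>i \<in> I; x \<in> M i\<rbrakk> \<Longrightarrow> x \<in> carrier V"
  using sub[of i] by (auto simp: submodule_iff)

lemma comp_in: "\<lbrakk>i \<in> I; x \<in> carrier V\<rbrakk> \<Longrightarrow> comp i x \<in> M i"
  using closed by (rule orth_proj_in(1))

lemma comp_carrier [simp]: "\<lbrakk>i \<in> I; x \<in> carrier V\<rbrakk> \<Longrightarrow> comp i x \<in> carrier V"
  using comp_in in_carrier by blast

lemma compI:
  assumes "i \<in> I" "x \<in> carrier V" "y \<in> M i" "\<And>z. z \<in> M i \<Longrightarrow> cinner V x z = cinner V y z"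
  shows "comp i x = y"
  using assms in_carrier
  by (intro orth_projI) (auto simp: cinner_simps)

lemma cinner_partial_sums:
  assumes "finite F" "finite F'" "F \<subseteq> I" "F' \<subseteq> I" "\<And>i. i \<in> I \<Longrightarrow> x i \<in> M i"
  shows "cinner V (\<Oplus>i\<in>F. x i) (\<Oplus>i\<in>F'. x i) = of_real (\<Sum>i\<in>F \<inter> F'. (vnorm V (x i))\<^sup>2)"
proof -
  have c: "x i \<in> carrier V" if "i \<in> I" for i using that assms(5) in_carrier by blast
  have F': "(\<Oplus>i\<in>F'. x i) \<in> carrier V" using assms c by (intro finsum_closed) auto
  have "cinner V (\<Oplus>i\<in>F. x i) (\<Oplus>i\<in>F'. x i) = (\<Sum>i\<in>F. cinner V (x i) (\<Oplus>i\<in>F'. x i))"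
    using assms c F' by (intro cinner_finsum_left) auto
  also have "\<dots> = (\<Sum>i\<in>F. \<Sum>j\<in>F'. cinner V (x i) (x j))"
    using assms c by (intro sum.cong refl cinner_finsum_right) auto
  also have "\<dots> = (\<Sum>i\<in>F. \<Sum>j\<in>F'. if j = i then of_real ((vnorm V (x i))\<^sup>2) else 0)"
    using assms c orth[OF _ _ _ assms(5,5)]
    by (intro sum.cong refl) (auto simp: cinner_self subset_iff)
  also have "\<dots> = (\<Sum>i\<in>F. if i \<in> F' then of_real ((vnorm V (x i))\<^sup>2) else 0)"
    using assms by (intro sum.cong refl) (simp add: sum.delta)
  also have "\<dots> = of_real (\<Sum>i\<in>F \<inter> F'. (vnorm V (x i))\<^sup>2)"
    using assms by (auto simp: sum.inter_restrict intro!: sum.cong)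
  finally show ?thesis .
qed

lemma vdist_partial_sums:
  assumes "finite F'" "F \<subseteq> F'" "F' \<subseteq> I" "\<And>i. i \<in> I \<Longrightarrow> x i \<in> M i"
  shows "(vdist V (\<Oplus>i\<in>F. x i) (\<Oplus>i\<in>F'. x i))\<^sup>2 =
    (\<Sum>i\<in>F'. (vnorm V (x i))\<^sup>2) - (\<Sum>i\<in>F. (vnorm V (x i))\<^sup>2)"
proof -
  have c: "x i \<in> carrier V" if "i \<in> I" for i using that assms(4) in_carrier by blast
  have F: "finite F" "F \<subseteq> I" using assms by (auto intro: finite_subset)
  have X: "(\<Oplus>i\<in>F. x i) \<in> carrier V" "(\<Oplus>i\<in>F'. x i) \<in> carrier V"
    using assms F c by (auto intro!: finsum_closed)
  moreover have "F \<inter> F' = F" "F' \<inter> F = F" using assms by auto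
  moreover have "(vnorm V (\<Oplus>i\<in>F. x i))\<^sup>2 = (\<Sum>i\<in>F. (vnorm V (x i))\<^sup>2)"
    "(vnorm V (\<Oplus>i\<in>F'. x i))\<^sup>2 = (\<Sum>i\<in>F'. (vnorm V (x i))\<^sup>2)"
    using assms F X by (simp_all only: vnorm_sq cinner_partial_sums Int_absorb Re_complex_of_real)
  ultimately show ?thesis
    using assms F X by (simp add: vdist_def vnorm_diff_sq cinner_partial_sums)
qed

text \<open>The partial sums over an increasing sequence of finite sets that exhausts the sum of squares
  form a Cauchy sequence, by orthogonality.  The index set may be uncountable; indices that the
  sequence never reaches carry the zero component.\<close>

lemma synthesis:
  assumes x: "\<And>i. i \<in> I \<Longrightarrow> x i \<in> M i" and s: "(\<lambda>i. (vnorm V (x i))\<^sup>2) summable_on I"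
  obtains S y where "\<And>n. finite (S n)" "\<And>n. S n \<subseteq> I" "vlim (\<lambda>n::nat. \<Oplus>i\<in>S n. x i) y"
    "\<And>i. i \<in> I \<Longrightarrow> comp i y = x i"
proof -
  let ?s = "\<lambda>i. (vnorm V (x i))\<^sup>2"
  define tot where "tot = infsum ?s I"
  have c: "x i \<in> carrier V" if "i \<in> I" for i using that x in_carrier by blast
  have hs: "(?s has_sum tot) I" using s by (simp add: tot_def)
  have "\<exists>S. finite S \<and> S \<subseteq> I \<and>
      (\<forall>F. finite F \<and> S \<subseteq> F \<and> F \<subseteq> I \<longrightarrow> dist (sum ?s F) tot < inverse (real (Suc n)))" for n
    using tendstoD[OF hs[unfolded has_sum_def], of "inverse (real (Suc n))"]
    by (simp add: eventually_finite_subsets_at_top)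
  then obtain R where R: "\<And>n. finite (R n)" "\<And>n. R n \<subseteq> I"
    "\<And>n F. \<lbrakk>finite F; R n \<subseteq> F; F \<subseteq> I\<rbrakk> \<Longrightarrow> dist (sum ?s F) tot < inverse (real (Suc n))"
    by metis
  define S where "S n = (\<Union>m\<le>n. R m)" for n
  have S: "finite (S n)" "S n \<subseteq> I" for n using R by (auto simp: S_def)
  have mono: "S m \<subseteq> S n" if "m \<le> n" for m n using that by (force simp: S_def)
  have near: "dist (sum ?s F) tot < inverse (real (Suc n))" if "finite F" "S n \<subseteq> F" "F \<subseteq> I" for n F
    using that by (intro R(3)) (auto simp: S_def)
  let ?X = "\<lambda>n. \<Oplus>i\<in>S n. x i"
  have X: "?X n \<in> carrier V" for n using S c by (intro finsum_closed) auto
  have close: "(vdist V (?X m) (?X n))\<^sup>2 < 2 * inverse (real (Suc m))" if mn: "m \<le> n" for m n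
    using near[OF S(1) order.refl S(2), of m] near[OF S(1) mono[OF mn] S(2)]
    by (simp add: vdist_partial_sums[OF S(1) mono[OF mn] S(2) x] dist_real_def)
  have "?X \<in> cauchy_seqs V"
    unfolding cauchy_seqs_def mem_Collect_eq
  proof (intro conjI allI impI X)
    fix e :: real assume e: "e > 0"
    obtain N where N: "inverse (real (Suc N)) < (e / 2)\<^sup>2 / 2"
      using reals_Archimedean[of "(e / 2)\<^sup>2 / 2"] e by auto
    have N': "vdist V (?X N) (?X n) < e / 2" if "n \<ge> N" for n
    proof (rule power2_less_imp_less)
      show "(vdist V (?X N) (?X n))\<^sup>2 < (e / 2)\<^sup>2" using close[OF that] N by linarith
    qed (use e in simp)
    show "\<exists>N. \<forall>m\<ge>N. \<forall>n\<ge>N. vdist V (?X m) (?X n) < e"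
    proof (intro exI[of _ N] allI impI)
      fix m n assume "N \<le> m" "N \<le> n"
      then show "vdist V (?X m) (?X n) < e"
        using N'[of m] N'[of n] vdist_triangle[of "?X m" "?X N" "?X n", OF X X X] vdist_commute[OF X X, of m N]
        by linarith
    qed
  qed
  then obtain y where y: "vlim ?X y" by (rule cauchy_vlim)
  have "comp i y = x i" if i: "i \<in> I" for i
  proof (rule compI[OF i _ x[OF i]])
    fix z assume z: "z \<in> M i"
    have zc: "z \<in> carrier V" using in_carrier[OF i z] .
    have val: "cinner V (?X n) z = (if i \<in> S n then cinner V (x i) z else 0)" for n
    proof -
      have "cinner V (?X n) z = (\<Sum>j\<in>S n. cinner V (x j) z)"
        using S c zc by (intro cinner_finsum_left) auto
      also have "\<dots> = (\<Sum>j\<in>S n. if j = i then cinner V (x i) z else 0)"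
        using S(2)[of n] orth[OF _ i _ x z] by (intro sum.cong refl) (auto simp: subset_iff)
      finally show ?thesis using S by (simp add: sum.delta')
    qed
    have "\<forall>\<^sub>F n in sequentially. cinner V (?X n) z = cinner V (x i) z"
    proof (cases "\<exists>N. i \<in> S N")
      case True
      then obtain N where "i \<in> S N" by blast
      then have "i \<in> S n" if "n \<ge> N" for n using mono[OF that] by blast
      then show ?thesis by (auto simp: val eventually_sequentially)
    next
      case False
      have le: "?s i \<le> 2 * inverse (real (Suc n))" for n
      proof -
        have "sum ?s (insert i (S n)) = ?s i + sum ?s (S n)" using False S by simp
        then show ?thesis
          using near[OF S(1) order.refl S(2), of n] near[of "insert i (S n)" n, OF _ subset_insertI] S i
          by (auto simp: dist_real_def)
      qed
      have "(\<lambda>n. 2 * inverse (real (Suc n))) \<longlonglongrightarrow> 0"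
        using tendsto_mult[OF tendsto_const LIMSEQ_inverse_real_of_nat, of 2] by simp
      then have "?s i \<le> 0" by (rule LIMSEQ_le_const) (use le in blast)
      then have "x i = \<zero>" using vnorm_eq_0_iff[OF c[OF i]] by simp
      then show ?thesis using False zc by (simp add: val)
    qed
    then have "(\<lambda>n. cinner V (?X n) z) \<longlonglongrightarrow> cinner V (x i) z" by (rule tendsto_eventually)
    then show "cinner V y z = cinner V (x i) z"
      by (rule LIMSEQ_unique[OF vlim_cinner[OF y vlim_const[OF zc]]])
  qed (rule vlimD(2)[OF y])
  then show ?thesis using that S y by blast
qed

lemma vnorm_residual:
  assumes "finite F" "F \<subseteq> I" and x: "x \<in> carrier V"
  shows "(vdist V (\<Oplus>i\<in>F. comp i x) x)\<^sup>2 = (vnorm V x)\<^sup>2 - (\<Sum>i\<in>F. (vnorm V (comp i x))\<^sup>2)"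
proof -
  let ?X = "\<Oplus>i\<in>F. comp i x"
  have X: "?X \<in> carrier V" using assms by (intro finsum_closed) auto
  have "cinner V ?X x = (\<Sum>i\<in>F. cinner V (comp i x) x)"
    using assms by (intro cinner_finsum_left) auto
  also have "\<dots> = (\<Sum>i\<in>F. of_real ((vnorm V (comp i x))\<^sup>2))"
  proof (intro sum.cong refl)
    fix i assume "i \<in> F"
    then have i: "i \<in> I" using assms by auto
    show "cinner V (comp i x) x = of_real ((vnorm V (comp i x))\<^sup>2)"
      using cinner_orth_proj(2)[OF closed[OF i] x comp_in[OF i x]] cinner_self[of "comp i x"] i x
      by simp
  qed
  finally have 1: "Re (cinner V ?X x) = (\<Sum>i\<in>F. (vnorm V (comp i x))\<^sup>2)" by simp
  have 2: "(vnorm V ?X)\<^sup>2 = (\<Sum>i\<in>F. (vnorm V (comp i x))\<^sup>2)"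
    using assms X by (simp add: vnorm_sq[OF X] cinner_partial_sums comp_in)
  show ?thesis using X x 1 2 by (simp add: vdist_def vnorm_diff_sq)
qed

lemma comp_summable:
  assumes x: "x \<in> carrier V"
  shows "(\<lambda>i. (vnorm V (comp i x))\<^sup>2) summable_on I"
proof (rule nonneg_bdd_above_summable_on)
  show "bdd_above (sum (\<lambda>i. (vnorm V (comp i x))\<^sup>2) ` {F. F \<subseteq> I \<and> finite F})"
  proof (rule bdd_aboveI2)
    fix F assume "F \<in> {F. F \<subseteq> I \<and> finite F}"
    then show "(\<Sum>i\<in>F. (vnorm V (comp i x))\<^sup>2) \<le> (vnorm V x)\<^sup>2"
      using vnorm_residual[of F x] x zero_le_power2[of "vdist V (\<Oplus>i\<in>F. comp i x) x"] by auto
  qed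
qed simp

lemma eq_by_comp:
  assumes "x \<in> carrier V" "y \<in> carrier V" "\<And>i. i \<in> I \<Longrightarrow> comp i x = comp i y"
  shows "x = y"
proof -
  have "x \<ominus> y = \<zero>"
  proof (rule total)
    fix i z assume i: "i \<in> I" "z \<in> M i"
    have "cinner V x z = cinner V y z"
      using assms(3)[OF i(1)] assms(1,2) i
      by (simp flip: cinner_orth_proj(1)[OF closed])
    then show "cinner V (x \<ominus> y) z = 0" using assms i in_carrier by (simp add: cinner_simps)
  qed (use assms in simp)
  then show ?thesis using assms by (simp add: diff_eq_zero_iff)
qed

text \<open>By synthesis and totality \<open>x\<close> is a limit of partial sums of its own components.  Enlarging the
  index set of a partial sum only brings it closer to \<open>x\<close>, which turns convergence along a sequence
  into convergence along the net of all finite sets.\<close>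

lemma parseval:
  assumes x: "x \<in> carrier V" and y: "y \<in> carrier V"
  shows "((\<lambda>i. cinner V (comp i x) (comp i y)) has_sum cinner V x y) I"
proof -
  obtain S x' where S: "\<And>n. finite (S n)" "\<And>n. S n \<subseteq> I"
    and lim: "vlim (\<lambda>n::nat. \<Oplus>i\<in>S n. comp i x) x'" and eq: "\<And>i. i \<in> I \<Longrightarrow> comp i x' = comp i x"
    by (rule synthesis[OF comp_in[OF _ x] comp_summable[OF x]]) (assumption | rule that)+
  have "x' = x" by (rule eq_by_comp[OF vlimD(2)[OF lim] x eq])
  with lim have lim: "vlim (\<lambda>n. \<Oplus>i\<in>S n. comp i x) x" by simp
  show ?thesis
    unfolding has_sum_def tendsto_iff eventually_finite_subsets_at_top
  proof (intro allI impI)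
    fix e :: real assume e: "e > 0"
    define d where "d = e / (vnorm V y + 1)"
    have vy: "vnorm V y + 1 > 0" using vnorm_nonneg[OF y] by linarith
    then have d: "d > 0" using e by (simp add: d_def)
    have "d * (vnorm V y + 1) = e" using vy by (simp add: d_def)
    then have dy: "d * vnorm V y < e" using d by (simp add: distrib_left)
    obtain n where n: "vdist V (\<Oplus>i\<in>S n. comp i x) x < d"
      using order_tendstoD(2)[OF vlimD(3)[OF lim] d] by (auto simp: eventually_sequentially)
    show "\<exists>X. finite X \<and> X \<subseteq> I \<and> (\<forall>F. finite F \<and> X \<subseteq> F \<and> F \<subseteq> I \<longrightarrow>
        dist (\<Sum>i\<in>F. cinner V (comp i x) (comp i y)) (cinner V x y) < e)"
    proof (intro exI[of _ "S n"] conjI allI impI S)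
      fix F assume F: "finite F \<and> S n \<subseteq> F \<and> F \<subseteq> I"
      let ?X = "\<Oplus>i\<in>F. comp i x"
      have X: "?X \<in> carrier V" using F x by (intro finsum_closed) auto
      have "(\<Sum>i\<in>S n. (vnorm V (comp i x))\<^sup>2) \<le> (\<Sum>i\<in>F. (vnorm V (comp i x))\<^sup>2)"
        using F by (intro sum_mono2) auto
      then have "(vdist V ?X x)\<^sup>2 \<le> (vdist V (\<Oplus>i\<in>S n. comp i x) x)\<^sup>2"
        using F S x by (simp add: vnorm_residual)
      then have le: "vdist V ?X x \<le> vdist V (\<Oplus>i\<in>S n. comp i x) x"
        by (rule power2_le_imp_le) (use vlimD(1)[OF lim, of n] x in auto)
      have "(\<Sum>i\<in>F. cinner V (comp i x) (comp i y)) = (\<Sum>i\<in>F. cinner V (comp i x) y)"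
        using F x y by (intro sum.cong refl cinner_orth_proj closed comp_in) auto
      also have "\<dots> = cinner V ?X y"
        using F x y by (intro cinner_finsum_left[symmetric]) auto
      finally have "dist (\<Sum>i\<in>F. cinner V (comp i x) (comp i y)) (cinner V x y) =
          cmod (cinner V (?X \<ominus> x) y)"
        using X x y by (simp add: dist_norm cinner_simps)
      also have "\<dots> \<le> vdist V ?X x * vnorm V y"
        unfolding vdist_def using X x y by (intro cauchy_schwarz) auto
      also have "\<dots> \<le> d * vnorm V y"
        using le n y by (intro mult_right_mono) auto
      finally show "dist (\<Sum>i\<in>F. cinner V (comp i x) (comp i y)) (cinner V x y) < e"
        using dy by linarith
    qed
  qed
qed

theorem unitary_decomposition:
  "unitary V (hilbert_sum I (\<lambda>i. V\<lparr>carrier := M i\<rparr>)) (\<lambda>x. \<lambda>i\<in>I. comp i x)"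
proof -
  let ?W = "hilbert_sum I (\<lambda>i. V\<lparr>carrier := M i\<rparr>)"
  let ?U = "\<lambda>x. \<lambda>i\<in>I. comp i x"
  have mem: "?U x \<in> carrier ?W" if x: "x \<in> carrier V" for x
  proof -
    have "(\<lambda>i. (vnorm V (?U x i))\<^sup>2) summable_on I"
      using comp_summable[OF x] by (rule summable_on_cong[THEN iffD1, rotated]) simp
    then show ?thesis by (simp add: hilbert_sum_def subspace_vnorm comp_in x)
  qed
  have add: "comp i (x \<oplus> y) = comp i x \<oplus> comp i y"
    if "i \<in> I" "x \<in> carrier V" "y \<in> carrier V" for i x y
    using that sub[of i] comp_in[of i] in_carrier[of i]
    by (intro compI) (auto simp: submodule_iff cinner_simps cinner_orth_proj(1)[OF closed])
  have smult: "comp i (c \<odot> x) = c \<odot> comp i x" if "i \<in> I" "x \<in> carrier V" for i c x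
    using that sub[of i] comp_in[of i] in_carrier[of i]
    by (intro compI) (auto simp: submodule_iff cinner_simps cinner_orth_proj(1)[OF closed])
  have "vlinear V ?W ?U"
    using mem add smult by (auto simp: vlinear_def hilbert_sum_def fun_eq_iff)
  moreover have "bij_betw ?U (carrier V) (carrier ?W)"
    unfolding bij_betw_def
  proof (intro conjI inj_onI equalityI subsetI)
    fix x y assume xy: "x \<in> carrier V" "y \<in> carrier V" "?U x = ?U y"
    show "x = y"
    proof (rule eq_by_comp[OF xy(1,2)])
      show "comp i x = comp i y" if "i \<in> I" for i
        using fun_cong[OF xy(3), of i] that by simp
    qed
  next
    fix u assume u: "u \<in> carrier ?W"
    then have "\<And>i. i \<in> I \<Longrightarrow> u i \<in> M i" "(\<lambda>i. (vnorm V (u i))\<^sup>2) summable_on I"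
      by (auto simp: hilbert_sum_def subspace_vnorm)
    then obtain S y where y: "vlim (\<lambda>n::nat. \<Oplus>i\<in>S n. u i) y" "\<And>i. i \<in> I \<Longrightarrow> comp i y = u i"
      by (rule synthesis) (assumption | rule that)+
    have "u \<in> extensional I" using u by (simp add: hilbert_sum_def PiE_def)
    then have "u = ?U y" by (rule extensionalityI) (simp_all add: y(2))
    then show "u \<in> ?U ` carrier V" using vlimD(2)[OF y(1)] by blast
  qed (use mem in auto)
  moreover have "cinner ?W (?U x) (?U y) = cinner V x y" if "x \<in> carrier V" "y \<in> carrier V" for x y
  proof -
    have "cinner ?W (?U x) (?U y) = (\<Sum>\<^sub>\<infinity>i\<in>I. cinner V (comp i x) (comp i y))"
      by (simp add: hilbert_sum_def cong: infsum_cong)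
    then show ?thesis using infsumI[OF parseval[OF that]] by simp
  qed
  ultimately show ?thesis by (simp add: unitary_def)
qed

end


section \<open>Linear extension from a free space\<close>

lemma vlinear_finsum:
  assumes "module complex_ring V" "module complex_ring W" "vlinear V W T"
    and "finite S" "\<And>i. i \<in> S \<Longrightarrow> f i \<in> carrier V"
  shows "T (\<Oplus>\<^bsub>V\<^esub>i\<in>S. f i) = (\<Oplus>\<^bsub>W\<^esub>i\<in>S. T (f i))"
proof -
  interpret V: module complex_ring V by fact
  interpret W: module complex_ring W by fact
  from assms(4,5) show ?thesis
  proof (induction S)
    case empty
    then show ?case using vlinear_zero[OF assms(1-3)] by simp
  next
    case (insert i S)
    then have "(\<Oplus>\<^bsub>V\<^esub>i\<in>S. f i) \<in> carrier V" by (intro V.finsum_closed) auto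
    then show ?case
      using insert by (simp add: Pi_def vlinearD[OF assms(3)])
  qed
qed

definition lin_ext :: "'w ip_space \<Rightarrow> ('x \<Rightarrow> 'w) \<Rightarrow> ('x \<Rightarrow> complex) \<Rightarrow> 'w" where
  "lin_ext W h f = (\<Oplus>\<^bsub>W\<^esub>x\<in>supp f. f x \<odot>\<^bsub>W\<^esub> h x)"

lemma supp_simps:
  "supp (\<lambda>_. 0) = {}" "supp (single x) = {x}"
  "supp (\<lambda>x. f x + g x) \<subseteq> supp f \<union> supp g" "supp (\<lambda>x. c * f x) \<subseteq> supp f"
  by (auto simp: supp_def single_def)

context complex_ip_space
begin

lemma lin_ext_closed:
  assumes "\<And>x. x \<in> supp f \<Longrightarrow> h x \<in> carrier V"
  shows "lin_ext V h f \<in> carrier V"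
  unfolding lin_ext_def using assms by (intro finsum_closed) auto

lemma cinner_lin_ext:
  assumes "finite S" "supp f \<subseteq> S" "\<And>x. x \<in> supp f \<Longrightarrow> h x \<in> carrier V" "z \<in> carrier V"
  shows "cinner V (lin_ext V h f) z = (\<Sum>x\<in>S. f x * cinner V (h x) z)"
proof -
  have "finite (supp f)" using assms by (auto intro: finite_subset)
  then have "cinner V (lin_ext V h f) z = (\<Sum>x\<in>supp f. cinner V (f x \<odot> h x) z)"
    unfolding lin_ext_def using assms by (intro cinner_finsum_left) auto
  also have "\<dots> = (\<Sum>x\<in>supp f. f x * cinner V (h x) z)"
    using assms by (intro sum.cong refl cinner_smult_left) auto
  also have "\<dots> = (\<Sum>x\<in>S. f x * cinner V (h x) z)"
    using assms by (intro sum.mono_neutral_left) (auto simp: supp_def)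
  finally show ?thesis .
qed

lemma cinner_lin_ext_lin_ext:
  assumes "finite (supp f)" "finite (supp g)"
    and "\<And>x. x \<in> supp f \<Longrightarrow> h x \<in> carrier V" "\<And>x. x \<in> supp g \<Longrightarrow> h x \<in> carrier V"
  shows "cinner V (lin_ext V h f) (lin_ext V h g) =
    (\<Sum>x\<in>supp f. \<Sum>y\<in>supp g. f x * cnj (g y) * cinner V (h x) (h y))"
proof -
  have g: "lin_ext V h g \<in> carrier V" using assms(4) by (rule lin_ext_closed)
  have "cinner V (h x) (lin_ext V h g) = (\<Sum>y\<in>supp g. cnj (g y) * cinner V (h x) (h y))"
    if x: "x \<in> supp f" for x
  proof -
    have "cinner V (h x) (lin_ext V h g) = cnj (cinner V (lin_ext V h g) (h x))"
      using g assms(3)[OF x] by (rule cinner_commute[rotated])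
    also have "\<dots> = (\<Sum>y\<in>supp g. cnj (g y) * cnj (cinner V (h y) (h x)))"
      using assms x by (simp add: cinner_lin_ext[of "supp g"])
    also have "\<dots> = (\<Sum>y\<in>supp g. cnj (g y) * cinner V (h x) (h y))"
    proof (intro sum.cong refl arg_cong2[of _ _ _ _ "(*)"])
      fix y assume "y \<in> supp g"
      then show "cnj (cinner V (h y) (h x)) = cinner V (h x) (h y)"
        using assms x by (intro cinner_commute[symmetric]) auto
    qed
    finally show ?thesis .
  qed
  then show ?thesis
    using assms g by (simp add: cinner_lin_ext[of "supp f"] sum_distrib_left mult.assoc)
qed

lemma lin_ext_single: "h x \<in> carrier V \<Longrightarrow> lin_ext V h (single x) = h x"
  using smult_one[of "h x"] by (simp add: lin_ext_def supp_simps(2)) (simp add: single_def)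

lemma lin_ext_in_submodule:
  assumes "submodule M complex_ring V" "finite (supp f)" "\<And>x. x \<in> supp f \<Longrightarrow> h x \<in> M"
  shows "lin_ext V h f \<in> M"
  unfolding lin_ext_def using assms by (intro submodule_finsum) (auto simp: submodule_iff)

lemma lin_ext_compose:
  assumes "vlinear V V T" "finite (supp f)" "\<And>x. x \<in> supp f \<Longrightarrow> h x \<in> carrier V"
  shows "T (lin_ext V h f) = lin_ext V (\<lambda>x. T (h x)) f"
proof -
  have "T (lin_ext V h f) = (\<Oplus>x\<in>supp f. T (f x \<odot> h x))"
    unfolding lin_ext_def using assms
    by (intro vlinear_finsum[OF module_axioms module_axioms]) auto
  also have "\<dots> = lin_ext V (\<lambda>x. T (h x)) f"
    unfolding lin_ext_def using assms vlinearD[OF assms(1)]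
    by (intro M.finsum_cong') auto
  finally show ?thesis .
qed

text \<open>Left multiplication by an algebra element on the free space moves symbols and adds up the
  coefficients of symbols that become equal; a linear extension sees such a map as a composition.\<close>

lemma lin_ext_pushforward:
  assumes f: "finite (supp f)" and h: "\<And>x. x \<in> supp f \<Longrightarrow> h (m x) \<in> carrier V"
  defines "g \<equiv> \<lambda>y. \<Sum>x | x \<in> supp f \<and> m x = y. f x"
  shows "supp g \<subseteq> m ` supp f" and "lin_ext V h g = lin_ext V (\<lambda>x. h (m x)) f"
proof -
  show sub: "supp g \<subseteq> m ` supp f"
  proof
    fix y assume "y \<in> supp g"
    then have "g y \<noteq> 0" by (simp add: supp_def)
    then have "{x. x \<in> supp f \<and> m x = y} \<noteq> {}"
      unfolding g_def by (intro notI) (simp only: sum.empty)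
    then show "y \<in> m ` supp f" by auto
  qed
  show "lin_ext V h g = lin_ext V (\<lambda>x. h (m x)) f"
  proof (rule eq_by_testing)
    fix z assume z: "z \<in> carrier V"
    have "cinner V (lin_ext V h g) z = (\<Sum>y\<in>m ` supp f. g y * cinner V (h y) z)"
      using sub f h z by (intro cinner_lin_ext) auto
    also have "\<dots> = (\<Sum>y\<in>m ` supp f. \<Sum>x | x \<in> supp f \<and> m x = y. f x * cinner V (h (m x)) z)"
      by (intro sum.cong refl) (simp add: g_def sum_distrib_right)
    also have "\<dots> = (\<Sum>x\<in>supp f. f x * cinner V (h (m x)) z)"
      using f by (rule sum.image_gen[symmetric])
    also have "\<dots> = cinner V (lin_ext V (\<lambda>x. h (m x)) f) z"
      using f h z by (intro cinner_lin_ext[symmetric]) auto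
    finally show "cinner V (lin_ext V h g) z = cinner V (lin_ext V (\<lambda>x. h (m x)) f) z" .
  qed (use sub h in \<open>auto intro!: lin_ext_closed\<close>)
qed

end

lemma carrier_free_space:
  "f \<in> carrier (free_space G A gr K \<rho>) \<longleftrightarrow> finite (supp f) \<and> supp f \<subseteq> carrier A \<times> rep_dom \<rho>"
  by (simp add: free_space_def)

lemma free_space_ops:
  "\<zero>\<^bsub>free_space G A gr K \<rho>\<^esub> = (\<lambda>_. 0)"
  "f \<oplus>\<^bsub>free_space G A gr K \<rho>\<^esub> g = (\<lambda>x. f x + g x)"
  "c \<odot>\<^bsub>free_space G A gr K \<rho>\<^esub> f = (\<lambda>x. c * f x)"
  by (simp_all add: free_space_def)

lemma free_space_closed:
  "(\<lambda>_. 0) \<in> carrier (free_space G A gr K \<rho>)"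
  "\<lbrakk>f \<in> carrier (free_space G A gr K \<rho>); g \<in> carrier (free_space G A gr K \<rho>)\<rbrakk> \<Longrightarrow>
    (\<lambda>x. f x + g x) \<in> carrier (free_space G A gr K \<rho>)"
  "f \<in> carrier (free_space G A gr K \<rho>) \<Longrightarrow> (\<lambda>x. c * f x) \<in> carrier (free_space G A gr K \<rho>)"
  "\<lbrakk>a \<in> carrier A; v \<in> rep_dom \<rho>\<rbrakk> \<Longrightarrow> single (a, v) \<in> carrier (free_space G A gr K \<rho>)"
  unfolding carrier_free_space using supp_simps(3)[of f g] supp_simps(4)[of c f]
  by (auto simp: supp_simps(1,2) intro: finite_subset)

lemma module_free_space: "module complex_ring (free_space G A gr K \<rho>)"
proof (rule moduleI[OF cring_complex_ring])
  show "abelian_group (free_space G A gr K \<rho>)"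
  proof (rule abelian_groupI)
    fix f assume f: "f \<in> carrier (free_space G A gr K \<rho>)"
    show "\<exists>g\<in>carrier (free_space G A gr K \<rho>).
        g \<oplus>\<^bsub>free_space G A gr K \<rho>\<^esub> f = \<zero>\<^bsub>free_space G A gr K \<rho>\<^esub>"
      by (rule bexI[OF _ free_space_closed(3)[OF f, of "-1"]]) (simp add: free_space_ops)
  qed (simp_all add: free_space_ops free_space_closed add_ac)
qed (simp_all add: free_space_ops free_space_closed algebra_simps)

lemma vlinear_lin_ext:
  assumes "complex_ip_space V" and h: "\<And>x. x \<in> carrier A \<times> rep_dom \<rho> \<Longrightarrow> h x \<in> carrier V"
  shows "vlinear (free_space G A gr K \<rho>) V (lin_ext V h)"
proof -
  interpret V: complex_ip_space V by fact
  let ?F = "free_space G A gr K \<rho>"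
  have c: "lin_ext V h f \<in> carrier V" if "f \<in> carrier ?F" for f
    using that h by (intro V.lin_ext_closed) (auto simp: carrier_free_space)
  have test: "cinner V (lin_ext V h f) z = (\<Sum>x\<in>S. f x * cinner V (h x) z)"
    if "f \<in> carrier ?F" "finite S" "supp f \<subseteq> S" "z \<in> carrier V" for f S z
    using that h by (intro V.cinner_lin_ext) (auto simp: carrier_free_space)
  have "lin_ext V h (\<lambda>x. f x + g x) = lin_ext V h f \<oplus>\<^bsub>V\<^esub> lin_ext V h g"
    if f: "f \<in> carrier ?F" and g: "g \<in> carrier ?F" for f g
  proof (rule V.eq_by_testing)
    fix z assume z: "z \<in> carrier V"
    have S: "finite (supp f \<union> supp g)" using f g by (simp add: carrier_free_space)
    show "cinner V (lin_ext V h (\<lambda>x. f x + g x)) z = cinner V (lin_ext V h f \<oplus>\<^bsub>V\<^esub> lin_ext V h g) z"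
      using z f g S supp_simps(3)[of f g]
      by (simp add: V.cinner_add_left c test[of _ "supp f \<union> supp g"] free_space_closed
          distrib_right sum.distrib)
  qed (use c[OF f] c[OF g] c[OF free_space_closed(2)[OF f g]] in simp_all)
  moreover have "lin_ext V h (\<lambda>x. k * f x) = k \<odot>\<^bsub>V\<^esub> lin_ext V h f"
    if f: "f \<in> carrier ?F" for f k
  proof (rule V.eq_by_testing)
    fix z assume z: "z \<in> carrier V"
    have S: "finite (supp f)" using f by (simp add: carrier_free_space)
    show "cinner V (lin_ext V h (\<lambda>x. k * f x)) z = cinner V (k \<odot>\<^bsub>V\<^esub> lin_ext V h f) z"
      using z f S supp_simps(4)[of k f]
      by (simp add: V.cinner_smult_left c test[of _ "supp f"] free_space_closed
          sum_distrib_left mult.assoc)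
  qed (use c[OF f] c[OF free_space_closed(3)[OF f]] in simp_all)
  ultimately show ?thesis by (auto simp: vlinear_def free_space_ops c)
qed


section \<open>Bounded systems of imprimitivity\<close>

text \<open>The conjugate \<open>fHf\<inverse>\<close> is the stabilizer of the coset \<open>fH\<close>, so its left cosets correspond to
  those of \<open>H\<close> by evaluation at \<open>fH\<close>.  Degrees enter the later arguments only through their action
  on cosets.\<close>

lemma stabilizer_coset:
  fixes G :: "'g monoid" (structure)
  assumes G: "group G" and H: "subgroup H G" and f: "f \<in> carrier G" and k: "k \<in> carrier G"
  shows "k <# conj_subgroup G f H = {g \<in> carrier G. g <# (f <# H) = k <# (f <# H)}"
proof (intro equalityI subsetI)
  interpret group G by fact
  have HG: "H \<subseteq> carrier G" using H by (rule subgroup.subset)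
  have coset: "g <# (f <# H) = (g \<otimes> f) <# H" if "g \<in> carrier G" for g
    using that f HG by (simp add: lcos_m_assoc)
  {
    fix g assume "g \<in> k <# conj_subgroup G f H"
    then obtain h where h: "h \<in> H" "g = k \<otimes> (f \<otimes> h \<otimes> inv f)"
      by (auto simp: conj_subgroup_def l_coset_def r_coset_def)
    have hG: "h \<in> carrier G" using h HG by auto
    then have g: "g \<in> carrier G" using h f k by simp
    have "g \<otimes> f = (k \<otimes> f) \<otimes> h" using h hG f k by (simp add: m_assoc)
    then have "g \<otimes> f \<in> (k \<otimes> f) <# H" using h by (auto simp: l_coset_def)
    then show "g \<in> {g \<in> carrier G. g <# (f <# H) = k <# (f <# H)}"
      using g f k by (simp add: coset l_repr_independence[OF _ _ H])
  next
    fix g assume "g \<in> {g \<in> carrier G. g <# (f <# H) = k <# (f <# H)}"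
    then have "g \<in> carrier G \<and> g <# (f <# H) = k <# (f <# H)" by simp
    then have g: "g \<in> carrier G" "(g \<otimes> f) <# H = (k \<otimes> f) <# H"
      using coset[of g] coset[OF k] by simp_all
    have "g \<otimes> f \<in> (g \<otimes> f) <# H"
      using subgroup.one_closed[OF H] g f by (force simp: l_coset_def)
    then obtain h where h: "h \<in> H" "g \<otimes> f = k \<otimes> f \<otimes> h" using g by (auto simp: l_coset_def)
    have "g = g \<otimes> f \<otimes> inv f" using g f by (simp add: m_assoc)
    also have "\<dots> = k \<otimes> (f \<otimes> h \<otimes> inv f)"
      unfolding h(2) using f k h HG by (simp add: m_assoc subset_eq)
    finally show "g \<in> k <# conj_subgroup G f H"
      using h by (auto simp: conj_subgroup_def l_coset_def r_coset_def)
  }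
qed

lemma conj_coset_mult:
  fixes G :: "'g monoid" (structure)
  assumes G: "group G" and H: "subgroup H G" and f: "f \<in> carrier G" and k: "k \<in> carrier G"
  shows "(k <# conj_subgroup G f H) #> f = k <# (f <# H)"
proof -
  interpret group G by fact
  have "snd (conj_system G f (undefined, \<lambda>s _. s)) (k <# conj_subgroup G f H) =
      (\<lambda>_ :: 'g set. (k \<otimes> f) <# H)"
    by (rule conj_system_coset[OF G H f k])
  then show ?thesis
    using f k subgroup.subset[OF H] by (simp add: conj_system_def lcos_m_assoc fun_eq_iff)
qed

lemma conj_subgroup_stabilizer:
  fixes G :: "'g monoid" (structure)
  assumes G: "group G" and H: "subgroup H G" and f: "f \<in> carrier G"
  shows "conj_subgroup G f H = {g \<in> carrier G. g <# (f <# H) = f <# H}"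
proof -
  interpret group G by fact
  have HG: "H \<subseteq> carrier G" using H by (rule subgroup.subset)
  then have "conj_subgroup G f H \<subseteq> carrier G"
    unfolding conj_subgroup_def using f by (intro r_coset_subset_G l_coset_subset_G) auto
  then have "conj_subgroup G f H = \<one> <# conj_subgroup G f H" by (simp add: lcos_mult_one)
  also have "\<dots> = {g \<in> carrier G. g <# (f <# H) = f <# H}"
    using stabilizer_coset[OF G H f one_closed] f HG by (simp add: lcos_m_assoc)
  finally show ?thesis .
qed

lemma (in group) lcosets_translate:
  assumes "subgroup H G" "t \<in> lcosets H" "g \<in> carrier G"
  shows "g <# t \<in> lcosets H"
  using assms subgroup.subset[OF assms(1)] by (auto simp: LCOSETS_def lcos_m_assoc)

context graded_star_algebra
begin

lemma gr_carrier: "g \<in> carrier G \<Longrightarrow> gr g \<subseteq> carrier A"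
  using submoduleE(1)[OF gr_submodule] .

lemma graded_part_carrier:
  assumes X: "X \<subseteq> carrier G"
  shows "graded_part A gr X \<subseteq> carrier A"
proof
  fix a assume "a \<in> graded_part A gr X"
  then obtain S f where S: "S \<subseteq> X" "f \<in> (\<Pi> g\<in>S. gr g)" "a = (\<Oplus>\<^bsub>A\<^esub>g\<in>S. f g)"
    unfolding graded_part_def by blast
  have "f g \<in> carrier A" if "g \<in> S" for g
    using S X that gr_carrier[of g] by (auto dest: Pi_mem)
  then show "a \<in> carrier A" unfolding S(3) by (intro M.finsum_closed) auto
qed

lemma homogeneous_components:
  assumes a: "a \<in> carrier A"
  obtains f where "finite {g \<in> carrier G. f g \<noteq> \<zero>\<^bsub>A\<^esub>}"
    "\<And>g. g \<in> carrier G \<Longrightarrow> f g \<in> gr g"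
    "a = (\<Oplus>\<^bsub>A\<^esub>g\<in>{g \<in> carrier G. f g \<noteq> \<zero>\<^bsub>A\<^esub>}. f g)"
    "\<And>X. graded_proj G A gr X a = (\<Oplus>\<^bsub>A\<^esub>g\<in>{g \<in> X. f g \<noteq> \<zero>\<^bsub>A\<^esub>}. f g)"
proof -
  obtain f where f: "homogeneous_decomp G A gr a f" "(THE f. homogeneous_decomp G A gr a f) = f"
    using gr_direct[OF a] by (metis the1_equality)
  then show ?thesis
    by (intro that[of f]) (auto simp: homogeneous_decomp_def graded_proj_def Let_def)
qed

lemma graded_proj_in:
  assumes a: "a \<in> carrier A" and X: "X \<subseteq> carrier G"
  shows "graded_proj G A gr X a \<in> graded_part A gr X"
proof -
  obtain f where f: "finite {g \<in> carrier G. f g \<noteq> \<zero>\<^bsub>A\<^esub>}" "\<And>g. g \<in> carrier G \<Longrightarrow> f g \<in> gr g"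
    "\<And>X. graded_proj G A gr X a = (\<Oplus>\<^bsub>A\<^esub>g\<in>{g \<in> X. f g \<noteq> \<zero>\<^bsub>A\<^esub>}. f g)"
    using homogeneous_components[OF a] by blast
  have "finite {g \<in> X. f g \<noteq> \<zero>\<^bsub>A\<^esub>}"
    using X by (intro finite_subset[OF _ f(1)]) auto
  then show ?thesis
    unfolding f(3) graded_part_def using X f(2) by blast
qed

end

text \<open>A bounded representation is defined on the whole space, so the operators and the space determine
  it.\<close>

locale bounded_imprimitivity = graded_star_algebra G A gr + V: hilbert_space V
  for G :: "'g monoid" and A :: "'a star_algebra" and gr :: "'g \<Rightarrow> 'a set" and V :: "'v ip_space" +
  fixes op :: "'a \<Rightarrow> 'v \<Rightarrow> 'v" and E :: "'g set \<Rightarrow> 'v \<Rightarrow> 'v" and H :: "'g set"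
  assumes H: "subgroup H G"
    and system: "imprimitivity_system G A gr H
      (\<lparr>rep_space = V, rep_dom = carrier V, rep_op = op\<rparr>, E)"
    and bounded: "bounded_rep A \<lparr>rep_space = V, rep_dom = carrier V, rep_op = op\<rparr>"
begin

lemma op_vlinear: "a \<in> carrier A \<Longrightarrow> vlinear V V (op a)"
  using system by (simp add: imprimitivity_system_def star_rep_def Let_def)

lemmas op_lin = vlinearD[OF op_vlinear]
lemmas op_closed [simp] = op_lin(1)

lemma op_hom:
  "\<lbrakk>a \<in> carrier A; b \<in> carrier A; x \<in> carrier V\<rbrakk> \<Longrightarrow> op (a \<oplus>\<^bsub>A\<^esub> b) x = op a x \<oplus>\<^bsub>V\<^esub> op b x"
  "\<lbrakk>a \<in> carrier A; x \<in> carrier V\<rbrakk> \<Longrightarrow> op (c \<odot>\<^bsub>A\<^esub> a) x = c \<odot>\<^bsub>V\<^esub> op a x"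
  "\<lbrakk>a \<in> carrier A; b \<in> carrier A; x \<in> carrier V\<rbrakk> \<Longrightarrow> op (a \<otimes>\<^bsub>A\<^esub> b) x = op a (op b x)"
  "x \<in> carrier V \<Longrightarrow> op \<one>\<^bsub>A\<^esub> x = x"
  using system by (auto simp: imprimitivity_system_def star_rep_def Let_def)

lemma op_adjoint:
  "\<lbrakk>a \<in> carrier A; x \<in> carrier V; y \<in> carrier V\<rbrakk> \<Longrightarrow>
    cinner V (op a x) y = cinner V x (op (star A a) y)"
  using system by (simp add: imprimitivity_system_def star_rep_def Let_def)

lemma op_zero: "x \<in> carrier V \<Longrightarrow> op \<zero>\<^bsub>A\<^esub> x = \<zero>\<^bsub>V\<^esub>"
  using op_hom(2)[of "\<zero>\<^bsub>A\<^esub>" x 0] V.smult_l_null[of "op \<zero>\<^bsub>A\<^esub> x"] smult_l_null[of "\<zero>\<^bsub>A\<^esub>"] by simp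

lemma op_finsum:
  assumes "finite S" "\<And>i. i \<in> S \<Longrightarrow> f i \<in> carrier A" "x \<in> carrier V"
  shows "op (\<Oplus>\<^bsub>A\<^esub>i\<in>S. f i) x = (\<Oplus>\<^bsub>V\<^esub>i\<in>S. op (f i) x)"
  using assms
proof (induction S)
  case empty
  then show ?case by (simp add: op_zero)
next
  case (insert i S)
  then have "(\<Oplus>\<^bsub>A\<^esub>i\<in>S. f i) \<in> carrier A" by (intro M.finsum_closed) auto
  then show ?case using insert by (simp add: Pi_def op_hom)
qed

lemma E_vlinear: "t \<in> lcosets\<^bsub>G\<^esub> H \<Longrightarrow> vlinear V V (E t)"
  using system by (simp add: imprimitivity_system_def orthogonal_projection_def Let_def)

lemmas E_lin = vlinearD[OF E_vlinear]
lemmas E_closed [simp] = E_lin(1)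

lemma E_idem: "\<lbrakk>t \<in> lcosets\<^bsub>G\<^esub> H; x \<in> carrier V\<rbrakk> \<Longrightarrow> E t (E t x) = E t x"
  using system by (simp add: imprimitivity_system_def orthogonal_projection_def Let_def)

lemma E_adjoint:
  "\<lbrakk>t \<in> lcosets\<^bsub>G\<^esub> H; x \<in> carrier V; y \<in> carrier V\<rbrakk> \<Longrightarrow> cinner V (E t x) y = cinner V x (E t y)"
  using system by (simp add: imprimitivity_system_def orthogonal_projection_def Let_def)

lemma E_orth:
  "\<lbrakk>t \<in> lcosets\<^bsub>G\<^esub> H; s \<in> lcosets\<^bsub>G\<^esub> H; t \<noteq> s; x \<in> carrier V\<rbrakk> \<Longrightarrow> E t (E s x) = \<zero>\<^bsub>V\<^esub>"
  using system by (simp add: imprimitivity_system_def Let_def)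

lemma E_sum:
  "\<lbrakk>x \<in> carrier V; e > 0\<rbrakk> \<Longrightarrow> \<exists>S. finite S \<and> S \<subseteq> lcosets\<^bsub>G\<^esub> H \<and>
    (\<forall>S'. finite S' \<and> S \<subseteq> S' \<and> S' \<subseteq> lcosets\<^bsub>G\<^esub> H \<longrightarrow> vdist V (\<Oplus>\<^bsub>V\<^esub>t\<in>S'. E t x) x < e)"
  using system by (simp add: imprimitivity_system_def Let_def)

lemma E_op:
  "\<lbrakk>g \<in> carrier G; t \<in> lcosets\<^bsub>G\<^esub> H; a \<in> gr g; x \<in> carrier V\<rbrakk> \<Longrightarrow>
    E (g <#\<^bsub>G\<^esub> t) (op a x) = op a (E t x)"
  using system by (simp add: imprimitivity_system_def Let_def)

lemma E_total:
  assumes x: "x \<in> carrier V" and 0: "\<And>t. t \<in> lcosets\<^bsub>G\<^esub> H \<Longrightarrow> E t x = \<zero>\<^bsub>V\<^esub>"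
  shows "x = \<zero>\<^bsub>V\<^esub>"
proof (rule ccontr)
  assume "x \<noteq> \<zero>\<^bsub>V\<^esub>"
  then have "vdist V \<zero>\<^bsub>V\<^esub> x \<noteq> 0" using x by (simp add: V.vdist_eq_0_iff)
  then have "vdist V \<zero>\<^bsub>V\<^esub> x > 0" using V.vdist_nonneg[OF V.M.zero_closed x] by linarith
  then obtain S where "S \<subseteq> lcosets\<^bsub>G\<^esub> H" "vdist V (\<Oplus>\<^bsub>V\<^esub>t\<in>S. E t x) x < vdist V \<zero>\<^bsub>V\<^esub> x"
    using E_sum[OF x] by blast
  moreover have "(\<Oplus>\<^bsub>V\<^esub>t\<in>S. E t x) = \<zero>\<^bsub>V\<^esub>"
    using 0 \<open>S \<subseteq> lcosets\<^bsub>G\<^esub> H\<close> by (intro V.M.add.finprod_one_eqI) auto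
  ultimately show False by simp
qed

lemma E_contraction:
  assumes t: "t \<in> lcosets\<^bsub>G\<^esub> H" and x: "x \<in> carrier V"
  shows "vnorm V (E t x) \<le> vnorm V x"
proof (cases "vnorm V (E t x) = 0")
  case False
  then have pos: "vnorm V (E t x) > 0" using V.vnorm_nonneg[OF E_closed[OF t x]] by linarith
  have "cinner V (E t x) (E t x) = cinner V x (E t x)"
    using t x by (simp add: E_adjoint E_idem)
  then have "(vnorm V (E t x))\<^sup>2 \<le> cmod (cinner V x (E t x))"
    using t x complex_Re_le_cmod[of "cinner V x (E t x)"] by (simp add: V.vnorm_sq)
  also have "\<dots> \<le> vnorm V x * vnorm V (E t x)" using t x by (intro V.cauchy_schwarz) auto
  finally show ?thesis using pos by (simp add: power2_eq_square)
qed (use x in simp)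

lemma vlim_E:
  assumes t: "t \<in> lcosets\<^bsub>G\<^esub> H" and X: "V.vlim X x"
  shows "V.vlim (\<lambda>n. E t (X n)) (E t x)"
proof (rule V.vlim_squeeze[OF _ _ _ V.vlimD(3)[OF X]])
  fix n
  show "vdist V (E t (X n)) (E t x) \<le> vdist V (X n) x"
    using t V.vlimD(1,2)[OF X] E_contraction[OF t, of "X n \<ominus>\<^bsub>V\<^esub> x"]
    by (simp add: vdist_def vlinear_diff[OF V.module_axioms V.module_axioms E_vlinear[OF t]])
qed (use t V.vlimD[OF X] in auto)

lemma op_lipschitz:
  assumes a: "a \<in> carrier A"
  obtains C where "C \<ge> 0"
    "\<And>x y. \<lbrakk>x \<in> carrier V; y \<in> carrier V\<rbrakk> \<Longrightarrow> vdist V (op a x) (op a y) \<le> C * vdist V x y"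
proof -
  have "\<exists>C. \<forall>x\<in>carrier V. vnorm V (op a x) \<le> C * vnorm V x"
    using bounded a by (simp add: bounded_rep_def)
  then obtain C where C: "\<And>x. x \<in> carrier V \<Longrightarrow> vnorm V (op a x) \<le> C * vnorm V x" by blast
  have "vdist V (op a x) (op a y) \<le> \<bar>C\<bar> * vdist V x y"
    if xy: "x \<in> carrier V" "y \<in> carrier V" for x y
  proof -
    have "vdist V (op a x) (op a y) = vnorm V (op a (x \<ominus>\<^bsub>V\<^esub> y))"
      using xy a
      by (simp add: vdist_def vlinear_diff[OF V.module_axioms V.module_axioms op_vlinear[OF a]])
    also have "\<dots> \<le> C * vdist V x y" unfolding vdist_def using xy by (intro C) simp
    also have "\<dots> \<le> \<bar>C\<bar> * vdist V x y" using xy by (intro mult_right_mono) auto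
    finally show ?thesis .
  qed
  then show ?thesis by (intro that[of "\<bar>C\<bar>"]) auto
qed

lemma vlim_op:
  assumes a: "a \<in> carrier A" and X: "V.vlim X x"
  shows "V.vlim (\<lambda>n. op a (X n)) (op a x)"
proof -
  obtain C where C: "\<And>x y. \<lbrakk>x \<in> carrier V; y \<in> carrier V\<rbrakk> \<Longrightarrow>
      vdist V (op a x) (op a y) \<le> C * vdist V x y"
    using op_lipschitz[OF a] by blast
  show ?thesis
  proof (rule V.vlim_squeeze)
    show "(\<lambda>n. C * vdist V (X n) x) \<longlonglongrightarrow> 0"
      using tendsto_mult[OF tendsto_const V.vlimD(3)[OF X], of C] by simp
  qed (use a V.vlimD[OF X] C in auto)
qed

text \<open>The vector \<open>op a v\<close> lies in the range of the projection of the translated coset, and distinct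
  projections annihilate each other.\<close>

lemma E_op_homogeneous:
  assumes t: "t \<in> lcosets\<^bsub>G\<^esub> H" and s: "s \<in> lcosets\<^bsub>G\<^esub> H" and v: "v \<in> carrier V" "E t v = v"
    and g: "g \<in> carrier G" "a \<in> gr g"
  shows "E s (op a v) = (if g <#\<^bsub>G\<^esub> t = s then op a v else \<zero>\<^bsub>V\<^esub>)"
proof -
  have a: "a \<in> carrier A" using gr_carrier g by auto
  have gt: "g <#\<^bsub>G\<^esub> t \<in> lcosets\<^bsub>G\<^esub> H" by (rule G.lcosets_translate[OF H t g(1)])
  have "op a v = E (g <#\<^bsub>G\<^esub> t) (op a v)" using E_op[OF g(1) t g(2) v(1)] v(2) by simp
  then show ?thesis using E_orth[OF s gt _ op_closed[OF a v(1)]] by metis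
qed

text \<open>Composing with a projection amounts to discarding homogeneous components.\<close>

lemma E_op_graded_proj:
  assumes t: "t \<in> lcosets\<^bsub>G\<^esub> H" and s: "s \<in> lcosets\<^bsub>G\<^esub> H" and v: "v \<in> carrier V" "E t v = v"
    and a: "a \<in> carrier A"
  shows "E s (op a v) = op (graded_proj G A gr {g \<in> carrier G. g <#\<^bsub>G\<^esub> t = s} a) v"
proof -
  let ?X = "{g \<in> carrier G. g <#\<^bsub>G\<^esub> t = s}"
  obtain f where f: "finite {g \<in> carrier G. f g \<noteq> \<zero>\<^bsub>A\<^esub>}" "\<And>g. g \<in> carrier G \<Longrightarrow> f g \<in> gr g"
    "a = (\<Oplus>\<^bsub>A\<^esub>g\<in>{g \<in> carrier G. f g \<noteq> \<zero>\<^bsub>A\<^esub>}. f g)"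
    "\<And>X. graded_proj G A gr X a = (\<Oplus>\<^bsub>A\<^esub>g\<in>{g \<in> X. f g \<noteq> \<zero>\<^bsub>A\<^esub>}. f g)"
    using homogeneous_components[OF a] by blast
  let ?S = "{g \<in> carrier G. f g \<noteq> \<zero>\<^bsub>A\<^esub>}" and ?S' = "{g \<in> ?X. f g \<noteq> \<zero>\<^bsub>A\<^esub>}"
  have fc: "f g \<in> carrier A" if "g \<in> carrier G" for g using f(2)[OF that] gr_carrier[OF that] by auto
  have S': "finite ?S'" by (rule finite_subset[OF _ f(1)]) auto
  have "E s (op a v) = E s (\<Oplus>\<^bsub>V\<^esub>g\<in>?S. op (f g) v)"
    using f(1) fc v by (subst f(3), subst op_finsum) auto
  also have "\<dots> = (\<Oplus>\<^bsub>V\<^esub>g\<in>?S. E s (op (f g) v))"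
    using f(1) fc v by (intro vlinear_finsum[OF V.module_axioms V.module_axioms E_vlinear[OF s]]) auto
  also have "\<dots> = (\<Oplus>\<^bsub>V\<^esub>g\<in>?S'. op (f g) v)"
  proof (rule V.eq_by_testing)
    fix z assume z: "z \<in> carrier V"
    have "cinner V (\<Oplus>\<^bsub>V\<^esub>g\<in>?S. E s (op (f g) v)) z = (\<Sum>g\<in>?S. cinner V (E s (op (f g) v)) z)"
      using f(1) fc v z s by (intro V.cinner_finsum_left) auto
    also have "\<dots> = (\<Sum>g\<in>?S. if g <#\<^bsub>G\<^esub> t = s then cinner V (op (f g) v) z else 0)"
    proof (intro sum.cong refl)
      fix g assume "g \<in> ?S"
      then show "cinner V (E s (op (f g) v)) z =
          (if g <#\<^bsub>G\<^esub> t = s then cinner V (op (f g) v) z else 0)"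
        using z E_op_homogeneous[OF t s v, of g "f g"] f(2)[of g] by simp
    qed
    also have "\<dots> = (\<Sum>g\<in>{g \<in> ?S. g <#\<^bsub>G\<^esub> t = s}. cinner V (op (f g) v) z)"
      using f(1) by (rule sum.inter_filter[symmetric])
    also have "{g \<in> ?S. g <#\<^bsub>G\<^esub> t = s} = ?S'" by auto
    also have "(\<Sum>g\<in>?S'. cinner V (op (f g) v) z) = cinner V (\<Oplus>\<^bsub>V\<^esub>g\<in>?S'. op (f g) v) z"
      using S' fc v z by (intro V.cinner_finsum_left[symmetric]) auto
    finally show "cinner V (\<Oplus>\<^bsub>V\<^esub>g\<in>?S. E s (op (f g) v)) z = cinner V (\<Oplus>\<^bsub>V\<^esub>g\<in>?S'. op (f g) v) z" .
  qed (use fc v s in \<open>auto intro!: V.finsum_closed\<close>)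
  also have "\<dots> = op (graded_proj G A gr ?X a) v"
    using S' fc v by (subst f(4), subst op_finsum) auto
  finally show ?thesis .
qed

lemma E_op_graded_part:
  assumes t: "t \<in> lcosets\<^bsub>G\<^esub> H" and s: "s \<in> lcosets\<^bsub>G\<^esub> H" and v: "v \<in> carrier V"
    and a: "a \<in> graded_part A gr {g \<in> carrier G. g <#\<^bsub>G\<^esub> t = s}"
  shows "E s (op a v) = op a (E t v)"
proof -
  obtain S f where S: "finite S" "S \<subseteq> {g \<in> carrier G. g <#\<^bsub>G\<^esub> t = s}"
    "f \<in> (\<Pi> g\<in>S. gr g)" "a = (\<Oplus>\<^bsub>A\<^esub>g\<in>S. f g)"
    using a unfolding graded_part_def by blast
  have fg: "f g \<in> gr g" if "g \<in> S" for g using S(3) that by (rule Pi_mem)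
  have fc: "f g \<in> carrier A" if "g \<in> S" for g using S(2) fg[OF that] that gr_carrier by blast
  have "E s (op a v) = E s (\<Oplus>\<^bsub>V\<^esub>g\<in>S. op (f g) v)"
    using S(1) fc v by (subst S(4), subst op_finsum) auto
  also have "\<dots> = (\<Oplus>\<^bsub>V\<^esub>g\<in>S. E s (op (f g) v))"
    using S(1) fc v by (intro vlinear_finsum[OF V.module_axioms V.module_axioms E_vlinear[OF s]]) auto
  also have "\<dots> = (\<Oplus>\<^bsub>V\<^esub>g\<in>S. op (f g) (E t v))"
  proof (rule V.M.finsum_cong'[OF refl])
    fix g assume "g \<in> S"
    then show "E s (op (f g) v) = op (f g) (E t v)"
      using S(2) fg E_op[of g t "f g" v] t v by auto
  qed (use fc v t in auto)
  also have "\<dots> = op a (E t v)"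
    using S(1) fc v t by (subst S(4), subst op_finsum) auto
  finally show ?thesis .
qed

end


section \<open>The subsystem generated by an invariant subspace of one projection\<close>

text \<open>The group element \<open>f\<close> stands for the coset \<open>fH\<close>; the degrees in \<open>fHf\<inverse>\<close> fix this coset, so it
  makes sense to ask that they leave a part \<open>L\<close> of the range of its projection invariant.\<close>

locale induced_component = bounded_imprimitivity G A gr V op E H
  for G :: "'g monoid" and A :: "'a star_algebra" and gr :: "'g \<Rightarrow> 'a set" and V :: "'v ip_space"
    and op :: "'a \<Rightarrow> 'v \<Rightarrow> 'v" and E :: "'g set \<Rightarrow> 'v \<Rightarrow> 'v" and H :: "'g set" +
  fixes f :: 'g and L :: "'v set"
  assumes f: "f \<in> carrier G"
    and L: "closed_subspace V L"
    and L_E: "v \<in> L \<Longrightarrow> E (f <#\<^bsub>G\<^esub> H) v = v"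
    and L_op: "\<lbrakk>a \<in> graded_part A gr (conj_subgroup G f H); v \<in> L\<rbrakk> \<Longrightarrow> op a v \<in> L"
begin

abbreviation t :: "'g set" where "t \<equiv> f <#\<^bsub>G\<^esub> H"
abbreviation K :: "'g set" where "K \<equiv> conj_subgroup G f H"

definition \<rho> :: "('a, 'v) rep" where
  "\<rho> = \<lparr>rep_space = V\<lparr>carrier := L\<rparr>, rep_dom = L, rep_op = op\<rparr>"

lemma rho_simps [simp]:
  "rep_space \<rho> = V\<lparr>carrier := L\<rparr>" "rep_dom \<rho> = L" "rep_op \<rho> = op"
  by (simp_all add: \<rho>_def)

lemma t: "t \<in> lcosets\<^bsub>G\<^esub> H"
  using f by (auto simp: LCOSETS_def)

lemma K_carrier: "K \<subseteq> carrier G"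
  using conj_subgroup_stabilizer[OF G.is_group H f] by auto

lemma L_sub: "submodule L complex_ring V"
  using L by (simp add: closed_subspace_def)

lemma L_carrier: "v \<in> L \<Longrightarrow> v \<in> carrier V"
  using L_sub by (auto simp: V.submodule_iff)

lemma star_rep_rho: "star_rep (subalgebra_on A gr K) \<rho>"
proof -
  interpret L: hilbert_space "V\<lparr>carrier := L\<rparr>" by (rule V.closed_subspace_hilbert[OF L])
  have sub: "a \<in> carrier A" if "a \<in> graded_part A gr K" for a
    using graded_part_carrier[OF K_carrier] that by auto
  have "vclosure (V\<lparr>carrier := L\<rparr>) L = L"
    using L.vclosure_subset_carrier[of L] L.vclosure_superset[of L] by auto
  then show ?thesis
    using L.hilbert_space_axioms L.carrier_is_submodule sub L_carrier L_op
    by (auto simp: star_rep_def vlinear_def op_lin op_hom op_adjoint)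
qed

lemma bounded_rep_rho: "bounded_rep (subalgebra_on A gr K) \<rho>"
proof -
  have "\<exists>C. \<forall>x\<in>L. vnorm V (op a x) \<le> C * vnorm V x" if "a \<in> graded_part A gr K" for a
    using bounded graded_part_carrier[OF K_carrier] that L_carrier
    by (fastforce simp: bounded_rep_def)
  then show ?thesis by (simp add: bounded_rep_def V.subspace_vnorm)
qed

text \<open>The form of the induction process is the inner product of the vectors \<open>op a v\<close>: only those
  components of \<open>star b a\<close> whose degree fixes the coset \<open>t\<close> bring \<open>v\<close> back to the range of \<open>E t\<close>.\<close>

lemma induction_form:
  assumes a: "a \<in> carrier A" and b: "b \<in> carrier A" and v: "v \<in> L" and w: "w \<in> L"
  shows "cinner V (op (graded_proj G A gr K (star A b \<otimes>\<^bsub>A\<^esub> a)) v) w = cinner V (op a v) (op b w)"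
proof -
  have c: "star A b \<otimes>\<^bsub>A\<^esub> a \<in> carrier A" using a b star_closed by simp
  note vw = L_carrier[OF v] L_carrier[OF w]
  have "cinner V (op (graded_proj G A gr K (star A b \<otimes>\<^bsub>A\<^esub> a)) v) w =
      cinner V (E t (op (star A b \<otimes>\<^bsub>A\<^esub> a) v)) w"
    by (simp add: E_op_graded_proj[OF t t vw(1) L_E[OF v] c]
        flip: conj_subgroup_stabilizer[OF G.is_group H f])
  also have "\<dots> = cinner V (op (star A b \<otimes>\<^bsub>A\<^esub> a) v) w"
    using vw c t by (simp add: E_adjoint L_E[OF w])
  also have "\<dots> = cinner V (op a v) (op b w)"
    using a b vw star_closed by (simp add: op_hom op_adjoint star_star)
  finally show ?thesis .
qed

abbreviation F :: "('a \<times> 'v \<Rightarrow> complex) ip_space" where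
  "F \<equiv> free_space G A gr K \<rho>"

definition \<Phi> :: "('a \<times> 'v \<Rightarrow> complex) \<Rightarrow> 'v" where
  "\<Phi> = lin_ext V (\<lambda>(a, v). op a v)"

lemma carrier_F: "u \<in> carrier F \<longleftrightarrow> finite (supp u) \<and> supp u \<subseteq> carrier A \<times> L"
  by (simp add: carrier_free_space)

lemma vlinear_Phi: "vlinear F V \<Phi>"
  unfolding \<Phi>_def
  by (rule vlinear_lin_ext[OF V.complex_ip_space_axioms]) (auto dest: L_carrier)

lemmas Phi_lin = vlinearD[OF vlinear_Phi, unfolded free_space_ops]

lemma Phi_single: "\<lbrakk>a \<in> carrier A; v \<in> L\<rbrakk> \<Longrightarrow> \<Phi> (single (a, v)) = op a v"
  by (simp add: \<Phi>_def V.lin_ext_single L_carrier)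

lemma single_F: "\<lbrakk>a \<in> carrier A; v \<in> L\<rbrakk> \<Longrightarrow> single (a, v) \<in> carrier F"
  by (rule free_space_closed(4)) simp_all

lemma Phi_form:
  assumes u: "u \<in> carrier F" and u': "u' \<in> carrier F"
  shows "cinner V (\<Phi> u) (\<Phi> u') = cinner F u u'"
proof -
  have "cinner V (\<Phi> u) (\<Phi> u') = (\<Sum>x\<in>supp u. \<Sum>y\<in>supp u'. u x * cnj (u' y) *
      cinner V (case x of (a, v) \<Rightarrow> op a v) (case y of (a, v) \<Rightarrow> op a v))"
    unfolding \<Phi>_def using u u'
    by (intro V.cinner_lin_ext_lin_ext) (auto simp: carrier_F dest!: L_carrier)
  also have "\<dots> = (\<Sum>x\<in>supp u. case x of (a, v) \<Rightarrow> \<Sum>y\<in>supp u'. case y of (b, w) \<Rightarrow>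
      u (a, v) * cnj (u' (b, w)) * cinner V (op (graded_proj G A gr K (star A b \<otimes>\<^bsub>A\<^esub> a)) v) w)"
    using u u' by (intro sum.cong refl) (auto simp: carrier_F induction_form subset_iff intro!: sum.cong)
  finally show ?thesis by (simp add: free_space_def)
qed

lemma Phi_lmult:
  assumes a: "a \<in> carrier A" and u: "u \<in> carrier F"
  shows "free_lmult A a u \<in> carrier F" and "\<Phi> (free_lmult A a u) = op a (\<Phi> u)"
proof -
  let ?m = "\<lambda>x. (a \<otimes>\<^bsub>A\<^esub> fst x, snd x)" and ?h = "\<lambda>(a, v). op a v"
  have fin: "finite (supp u)" using u by (simp add: carrier_F)
  have h: "?h (?m x) \<in> carrier V" if "x \<in> supp u" for x
    using that u a L_carrier by (auto simp: carrier_F)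
  have sub: "supp (free_lmult A a u) \<subseteq> ?m ` supp u"
    unfolding free_lmult_def by (rule V.lin_ext_pushforward(1)[where m = ?m and h = ?h, OF fin h])
  have "?m ` supp u \<subseteq> carrier A \<times> L" using u a by (auto simp: carrier_F)
  then show "free_lmult A a u \<in> carrier F"
    unfolding carrier_F using sub finite_subset[OF sub finite_imageI[OF fin]] by blast
  have "\<Phi> (free_lmult A a u) = lin_ext V (\<lambda>x. ?h (?m x)) u"
    unfolding \<Phi>_def free_lmult_def by (rule V.lin_ext_pushforward(2)[where m = ?m and h = ?h, OF fin h])
  also have "\<dots> = lin_ext V (\<lambda>x. op a (?h x)) u"
    unfolding lin_ext_def
  proof (rule V.M.finsum_cong')
    have pt: "u x \<odot>\<^bsub>V\<^esub> ?h (?m x) = u x \<odot>\<^bsub>V\<^esub> op a (?h x) \<and> u x \<odot>\<^bsub>V\<^esub> op a (?h x) \<in> carrier V"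
      if x: "x \<in> supp u" for x
    proof -
      obtain b v where "x = (b, v)" "b \<in> carrier A" "v \<in> L"
        using u x by (cases x) (auto simp: carrier_F)
      then show ?thesis using a L_carrier[of v] by (simp add: op_hom(3))
    qed
    show "(\<lambda>x. u x \<odot>\<^bsub>V\<^esub> op a (?h x)) \<in> supp u \<rightarrow> carrier V" using pt by blast
    show "u x \<odot>\<^bsub>V\<^esub> ?h (?m x) = u x \<odot>\<^bsub>V\<^esub> op a (?h x)" if "x \<in> supp u" for x
      using pt[OF that] by blast
  qed (rule refl)
  also have "\<dots> = op a (\<Phi> u)"
    unfolding \<Phi>_def using u L_carrier
    by (intro V.lin_ext_compose[symmetric] op_vlinear[OF a]) (auto simp: carrier_F)
  finally show "\<Phi> (free_lmult A a u) = op a (\<Phi> u)" .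
qed

text \<open>Each generator of the tensor relations is such a combination of three symbols, with a
  coefficient \<open>0\<close> where only two occur.\<close>

lemma Phi_combination:
  assumes "a \<in> carrier A" "v \<in> L" "b \<in> carrier A" "w \<in> L" "c \<in> carrier A" "z \<in> L"
  shows "(\<lambda>x. single (a, v) x - p * single (b, w) x - q * single (c, z) x) \<in> carrier F"
    and "\<Phi> (\<lambda>x. single (a, v) x - p * single (b, w) x - q * single (c, z) x) =
      op a v \<oplus>\<^bsub>V\<^esub> ((- p) \<odot>\<^bsub>V\<^esub> op b w \<oplus>\<^bsub>V\<^esub> (- q) \<odot>\<^bsub>V\<^esub> op c z)"
proof -
  have eq: "(\<lambda>x. single (a, v) x - p * single (b, w) x - q * single (c, z) x) =
      (\<lambda>x. single (a, v) x + ((- p) * single (b, w) x + (- q) * single (c, z) x))"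
    by (simp add: fun_eq_iff)
  note s = single_F[OF assms(1,2)] single_F[OF assms(3,4)] single_F[OF assms(5,6)]
  note m = free_space_closed(3)[OF s(2), of "- p"] free_space_closed(3)[OF s(3), of "- q"]
  note m' = free_space_closed(2)[OF m]
  show "(\<lambda>x. single (a, v) x - p * single (b, w) x - q * single (c, z) x) \<in> carrier F"
    unfolding eq by (rule free_space_closed(2)[OF s(1) m'])
  show "\<Phi> (\<lambda>x. single (a, v) x - p * single (b, w) x - q * single (c, z) x) =
      op a v \<oplus>\<^bsub>V\<^esub> ((- p) \<odot>\<^bsub>V\<^esub> op b w \<oplus>\<^bsub>V\<^esub> (- q) \<odot>\<^bsub>V\<^esub> op c z)"
    unfolding eq Phi_lin(2)[OF s(1) m'] Phi_lin(2)[OF m] Phi_lin(3)[OF s(2)] Phi_lin(3)[OF s(3)]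
    using assms by (simp add: Phi_single)
qed

lemma tensor_relations_kernel:
  "tensor_relations A (graded_part A gr K) \<rho> \<subseteq> {u \<in> carrier F. \<Phi> u = \<zero>\<^bsub>V\<^esub>}"
proof -
  have K: "b \<in> carrier A" if "b \<in> graded_part A gr K" for b
    using graded_part_carrier[OF K_carrier] that by auto
  have L': "v \<oplus>\<^bsub>V\<^esub> w \<in> L" "c \<odot>\<^bsub>V\<^esub> v \<in> L" if "v \<in> L" "w \<in> L" for v w c
    using L_sub that by (auto simp: V.submodule_iff)
  have R: "u \<in> {u \<in> carrier F. \<Phi> u = \<zero>\<^bsub>V\<^esub>}"
    if u: "u = (\<lambda>x. single (a, v) x - p * single (b, w) x - q * single (c, z) x)"
      and m: "a \<in> carrier A" "v \<in> L" "b \<in> carrier A" "w \<in> L" "c \<in> carrier A" "z \<in> L"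
      and e: "op a v = p \<odot>\<^bsub>V\<^esub> op b w \<oplus>\<^bsub>V\<^esub> q \<odot>\<^bsub>V\<^esub> op c z" for u a v p b w q c z
  proof -
    have c: "op b w \<in> carrier V" "op c z \<in> carrier V" using m L_carrier by auto
    have "\<Phi> u = op a v \<oplus>\<^bsub>V\<^esub> ((- p) \<odot>\<^bsub>V\<^esub> op b w \<oplus>\<^bsub>V\<^esub> (- q) \<odot>\<^bsub>V\<^esub> op c z)"
      unfolding u by (rule Phi_combination(2)[OF m])
    also have "\<dots> = \<zero>\<^bsub>V\<^esub>"
      unfolding e using c by (intro V.eq_by_testing) (simp_all add: V.cinner_simps)
    finally show ?thesis using Phi_combination(1)[OF m] u by simp
  qed
  have z: "0 \<odot>\<^bsub>V\<^esub> x = \<zero>\<^bsub>V\<^esub>" "1 \<odot>\<^bsub>V\<^esub> x = x" if "x \<in> carrier V" for x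
    using that V.smult_l_null[of x] V.smult_one[of x] by simp_all
  have r1: "(\<lambda>x. single (a \<oplus>\<^bsub>A\<^esub> b, v) x - single (a, v) x - single (b, v) x)
      \<in> {u \<in> carrier F. \<Phi> u = \<zero>\<^bsub>V\<^esub>}" if "a \<in> carrier A" "b \<in> carrier A" "v \<in> L" for a b v
    using that L_carrier
    by (intro R[of _ "a \<oplus>\<^bsub>A\<^esub> b" v 1 a v 1 b v]) (auto simp: op_hom z)
  have r2: "(\<lambda>x. single (a, v \<oplus>\<^bsub>V\<^esub> w) x - single (a, v) x - single (a, w) x)
      \<in> {u \<in> carrier F. \<Phi> u = \<zero>\<^bsub>V\<^esub>}" if "a \<in> carrier A" "v \<in> L" "w \<in> L" for a v w
    using that L_carrier L'
    by (intro R[of _ a "v \<oplus>\<^bsub>V\<^esub> w" 1 a v 1 a w]) (auto simp: op_lin z)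
  have r3: "(\<lambda>x. single (c \<odot>\<^bsub>A\<^esub> a, v) x - c * single (a, v) x)
      \<in> {u \<in> carrier F. \<Phi> u = \<zero>\<^bsub>V\<^esub>}" if "a \<in> carrier A" "v \<in> L" for c a v
    using that L_carrier
    by (intro R[of _ "c \<odot>\<^bsub>A\<^esub> a" v c a v 0 a v]) (auto simp: op_hom z)
  have r4: "(\<lambda>x. single (a, c \<odot>\<^bsub>V\<^esub> v) x - c * single (a, v) x)
      \<in> {u \<in> carrier F. \<Phi> u = \<zero>\<^bsub>V\<^esub>}" if "a \<in> carrier A" "v \<in> L" for c a v
    using that L_carrier L'
    by (intro R[of _ a "c \<odot>\<^bsub>V\<^esub> v" c a v 0 a v]) (auto simp: op_lin z)
  have r5: "(\<lambda>x. single (a \<otimes>\<^bsub>A\<^esub> b, v) x - single (a, op b v) x)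
      \<in> {u \<in> carrier F. \<Phi> u = \<zero>\<^bsub>V\<^esub>}" if "a \<in> carrier A" "b \<in> graded_part A gr K" "v \<in> L" for a b v
    using that L_carrier L_op K
    by (intro R[of _ "a \<otimes>\<^bsub>A\<^esub> b" v 1 a "op b v" 0 a v]) (auto simp: op_hom z)
  have ops: "add (V\<lparr>carrier := L\<rparr>) = add V" "smult (V\<lparr>carrier := L\<rparr>) = smult V" by simp_all
  show ?thesis
    unfolding tensor_relations_def Let_def rho_simps ops
    by (intro Un_least subsetI; elim CollectE exE conjE; hypsubst; rule r1 r2 r3 r4 r5; assumption)
qed

abbreviation N :: "('a \<times> 'v \<Rightarrow> complex) set" where "N \<equiv> tensor_kernel G A gr K \<rho>"
abbreviation T :: "('a \<times> 'v \<Rightarrow> complex) set ip_space" where "T \<equiv> tensor_space G A gr K \<rho>"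
abbreviation P :: "('a \<times> 'v \<Rightarrow> complex) set set ip_space" where "P \<equiv> ind_pre_space G A gr K \<rho>"
abbreviation W :: "('a, 'v) ind_vector ip_space" where "W \<equiv> hilbert_completion P"
abbreviation cls :: "('a \<times> 'v \<Rightarrow> complex) \<Rightarrow> ('a, 'v) ind_vector" where
  "cls \<equiv> ind_class G A gr K \<rho>"

text \<open>The map induced by \<open>a \<otimes> v \<mapsto> op a v\<close> on the tensor product, and then on its quotient by the
  null vectors.\<close>

definition \<Phi>1 :: "('a \<times> 'v \<Rightarrow> complex) set \<Rightarrow> 'v" where "\<Phi>1 X = \<Phi> (SOME x. x \<in> X)"
definition \<Phi>2 :: "('a \<times> 'v \<Rightarrow> complex) set set \<Rightarrow> 'v" where "\<Phi>2 X = \<Phi>1 (SOME x. x \<in> X)"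

lemma module_F: "module complex_ring F"
  by (rule module_free_space)

lemma kernel_submodule: "submodule {u \<in> carrier F. \<Phi> u = \<zero>\<^bsub>V\<^esub>} complex_ring F"
  by (rule vlinear_kernel_submodule[OF module_F V.complex_ip_space_axioms vlinear_Phi])

lemma Q1: "quotient_setup F N"
proof (intro quotient_setup.intro quotient_setup_axioms.intro module_F)
  show "submodule N complex_ring F"
    unfolding tensor_kernel_def
    by (rule vspan_submodule[OF module_F]) (use tensor_relations_kernel in auto)
qed

lemma N_kernel: "u \<in> N \<Longrightarrow> \<Phi> u = \<zero>\<^bsub>V\<^esub>"
  using vspan_minimal[OF kernel_submodule tensor_relations_kernel] by (auto simp: tensor_kernel_def)

lemma Phi1:
  "u \<in> carrier F \<Longrightarrow> \<Phi>1 (N +>\<^bsub>F\<^esub> u) = \<Phi> u"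
  "vlinear T V \<Phi>1"
  "\<lbrakk>X \<in> carrier T; Y \<in> carrier T\<rbrakk> \<Longrightarrow> cinner V (\<Phi>1 X) (\<Phi>1 Y) = cinner T X Y"
  unfolding \<Phi>1_def tensor_space_def
  by (rule quotient_setup.quotient_map[OF Q1 V.module_axioms vlinear_Phi]; simp add: Phi_form N_kernel)+

lemma module_T: "module complex_ring T"
  unfolding tensor_space_def by (rule quotient_setup.module_quotient[OF Q1])

lemma inducible_rho: "inducible G A gr K \<rho>"
  unfolding inducible_def Let_def
proof (intro ballI)
  fix \<eta> assume \<eta>: "\<eta> \<in> carrier T"
  then have "\<Phi>1 \<eta> \<in> carrier V" by (rule vlinearD(1)[OF Phi1(2)])
  then show "cinner T \<eta> \<eta> \<in> \<real> \<and> 0 \<le> Re (cinner T \<eta> \<eta>)"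
    by (simp add: V.cinner_self flip: Phi1(3)[OF \<eta> \<eta>])
qed

text \<open>The null vectors form a submodule because they are the kernel of a linear map into a definite
  space.\<close>

lemma null_vectors_T: "null_vectors T = {X \<in> carrier T. \<Phi>1 X = \<zero>\<^bsub>V\<^esub>}"
proof -
  have "cinner T X X = 0 \<longleftrightarrow> \<Phi>1 X = \<zero>\<^bsub>V\<^esub>" if X: "X \<in> carrier T" for X
  proof -
    have "\<Phi>1 X \<in> carrier V" by (rule vlinearD(1)[OF Phi1(2) X])
    then have "cinner V (\<Phi>1 X) (\<Phi>1 X) = 0 \<longleftrightarrow> \<Phi>1 X = \<zero>\<^bsub>V\<^esub>"
      by (metis V.cinner_definite V.cinner_zero(1))
    then show ?thesis by (simp only: Phi1(3)[OF X X])
  qed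
  then show ?thesis by (auto simp: null_vectors_def)
qed

lemma Q2: "quotient_setup T (null_vectors T)"
proof (intro quotient_setup.intro quotient_setup_axioms.intro module_T)
  show "submodule (null_vectors T) complex_ring T"
    unfolding null_vectors_T
    by (rule vlinear_kernel_submodule[OF module_T V.complex_ip_space_axioms Phi1(2)])
qed

lemma null_vectors_kernel: "X \<in> null_vectors T \<Longrightarrow> \<Phi>1 X = \<zero>\<^bsub>V\<^esub>"
  by (simp add: null_vectors_T)

lemma Phi2:
  "X \<in> carrier T \<Longrightarrow> \<Phi>2 (null_vectors T +>\<^bsub>T\<^esub> X) = \<Phi>1 X"
  "vlinear P V \<Phi>2"
  "\<lbrakk>Y \<in> carrier P; Z \<in> carrier P\<rbrakk> \<Longrightarrow> cinner V (\<Phi>2 Y) (\<Phi>2 Z) = cinner P Y Z"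
  unfolding \<Phi>2_def ind_pre_space_def
  by (rule quotient_setup.quotient_map[OF Q2 V.module_axioms Phi1(2)];
      (assumption | erule (1) Phi1(3) | erule null_vectors_kernel))+

lemma carrier_T: "carrier T = (\<lambda>u. N +>\<^bsub>F\<^esub> u) ` carrier F"
  unfolding tensor_space_def by (rule quotient_setup.carrier_quotient[OF Q1])

lemma carrier_P: "carrier P = (\<lambda>X. null_vectors T +>\<^bsub>T\<^esub> X) ` carrier T"
  unfolding ind_pre_space_def by (rule quotient_setup.carrier_quotient[OF Q2])

lemma complex_ip_space_P: "complex_ip_space P"
proof (rule complex_ip_space_pullback[OF _ V.complex_ip_space_axioms Phi2(2) _ Phi2(3)])
  show "module complex_ring P"
    unfolding ind_pre_space_def by (rule quotient_setup.module_quotient[OF Q2])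
  show "inj_on \<Phi>2 (carrier P)"
  proof (rule inj_onI)
    fix X Y assume "X \<in> carrier P" "Y \<in> carrier P" "\<Phi>2 X = \<Phi>2 Y"
    then obtain X' Y' where *: "X = null_vectors T +>\<^bsub>T\<^esub> X'" "Y = null_vectors T +>\<^bsub>T\<^esub> Y'"
      "X' \<in> carrier T" "Y' \<in> carrier T" "\<Phi>1 X' = \<Phi>1 Y'"
      by (auto simp: carrier_P Phi2(1))
    interpret T: module complex_ring T by (rule module_T)
    from * have "\<Phi>1 (X' \<ominus>\<^bsub>T\<^esub> Y') = \<zero>\<^bsub>V\<^esub>"
      using vlinearD(1)[OF Phi1(2)]
      by (simp add: vlinear_diff[OF module_T V.module_axioms Phi1(2)] V.diff_eq_zero_iff)
    then have "X' \<ominus>\<^bsub>T\<^esub> Y' \<in> null_vectors T"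
      using * by (simp add: null_vectors_T)
    then show "X = Y" using * by (simp add: quotient_setup.coset_eq_iff[OF Q2])
  qed
qed

definition M :: "'v set" where "M = vclosure V (\<Phi> ` carrier F)"

definition \<Psi> :: "'v \<Rightarrow> ('a, 'v) ind_vector" where "\<Psi> = completion_point P V \<Phi>2"

lemma image_Phi2: "\<Phi>2 ` carrier P = \<Phi> ` carrier F"
proof -
  have "\<Phi>2 ` carrier P = \<Phi>1 ` carrier T" by (force simp: carrier_P Phi2(1) image_image)
  also have "\<dots> = \<Phi> ` carrier F" by (force simp: carrier_T Phi1(1) image_image)
  finally show ?thesis .
qed

lemma image_Phi_carrier: "\<Phi> ` carrier F \<subseteq> carrier V"
  using Phi_lin(1) by auto

lemma image_Phi_submodule: "submodule (\<Phi> ` carrier F) complex_ring V"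
  by (rule vlinear_image_submodule[OF module_F V.complex_ip_space_axioms vlinear_Phi])

lemma image_Phi_M: "\<Phi> ` carrier F \<subseteq> M"
  unfolding M_def by (rule V.vclosure_superset[OF image_Phi_carrier])

lemma M_closed: "closed_subspace V M"
  unfolding closed_subspace_def M_def
  using V.vclosure_submodule[OF image_Phi_submodule] V.vclosure_idem[OF image_Phi_carrier] by simp

lemma M_sub: "submodule M complex_ring V"
  using M_closed by (simp add: closed_subspace_def)

lemma M_carrier: "x \<in> M \<Longrightarrow> x \<in> carrier V"
  using M_sub by (auto simp: V.submodule_iff)

lemma M_approx:
  assumes "x \<in> M"
  obtains X where "\<And>n. X n \<in> \<Phi> ` carrier F" "V.vlim X x"
  using assms by (auto simp: M_def V.vclosure_iff_vlim[OF image_Phi_carrier])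

lemma generator_image: "\<lbrakk>a \<in> carrier A; v \<in> L\<rbrakk> \<Longrightarrow> op a v \<in> \<Phi> ` carrier F"
  by (metis Phi_single imageI single_F)

lemma L_M: "v \<in> L \<Longrightarrow> v \<in> M"
  using generator_image[OF one_closed, of v] image_Phi_M by (auto simp: op_hom L_carrier)

lemma op_M:
  assumes a: "a \<in> carrier A" and x: "x \<in> M"
  shows "op a x \<in> M"
proof -
  obtain X where X: "\<And>n. X n \<in> \<Phi> ` carrier F" "V.vlim X x" by (rule M_approx[OF x]) (assumption | rule that)+
  have im: "op a y \<in> \<Phi> ` carrier F" if y: "y \<in> \<Phi> ` carrier F" for y
  proof -
    obtain u where u: "y = \<Phi> u" "u \<in> carrier F" using y by blast
    show ?thesis
      unfolding u(1) Phi_lmult(2)[OF a u(2), symmetric] by (rule imageI[OF Phi_lmult(1)[OF a u(2)]])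
  qed
  show ?thesis
    unfolding M_def V.vclosure_iff_vlim[OF image_Phi_carrier]
    by (intro exI[of _ "\<lambda>n. op a (X n)"] conjI allI vlim_op[OF a X(2)] im X(1))
qed

text \<open>Each \<open>E s\<close> maps the generators \<open>op a v\<close> to generators of the same kind, with \<open>a\<close> replaced by
  the sum of those components that move \<open>t\<close> to \<open>s\<close>.\<close>

lemma E_Phi_in:
  assumes s: "s \<in> lcosets\<^bsub>G\<^esub> H" and Z: "submodule Z complex_ring V" and u: "u \<in> carrier F"
    and gen: "\<And>a v. \<lbrakk>a \<in> graded_part A gr {g \<in> carrier G. g <#\<^bsub>G\<^esub> t = s}; v \<in> L\<rbrakk> \<Longrightarrow> op a v \<in> Z"
  shows "E s (\<Phi> u) \<in> Z"
proof -
  have "E s (\<Phi> u) = lin_ext V (\<lambda>x. E s (case x of (a, v) \<Rightarrow> op a v)) u"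
    unfolding \<Phi>_def using u L_carrier
    by (intro V.lin_ext_compose E_vlinear s) (auto simp: carrier_F)
  also have "\<dots> \<in> Z"
  proof (rule V.lin_ext_in_submodule[OF Z])
    fix x assume "x \<in> supp u"
    then obtain a v where x: "x = (a, v)" "a \<in> carrier A" "v \<in> L" using u by (auto simp: carrier_F)
    then show "E s (case x of (a, v) \<Rightarrow> op a v) \<in> Z"
      using E_op_graded_proj[OF t s L_carrier L_E] gen[OF graded_proj_in] by simp
  qed (use u in \<open>simp add: carrier_F\<close>)
  finally show ?thesis .
qed

lemma E_M:
  assumes s: "s \<in> lcosets\<^bsub>G\<^esub> H" and x: "x \<in> M"
  shows "E s x \<in> M"
proof -
  obtain X where X: "\<And>n. X n \<in> \<Phi> ` carrier F" "V.vlim X x" by (rule M_approx[OF x]) (assumption | rule that)+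
  have im: "E s y \<in> \<Phi> ` carrier F" if "y \<in> \<Phi> ` carrier F" for y
  proof -
    obtain u where u: "y = \<Phi> u" "u \<in> carrier F" using \<open>y \<in> \<Phi> ` carrier F\<close> by blast
    show ?thesis
      unfolding u(1) using graded_part_carrier[of "{g \<in> carrier G. g <#\<^bsub>G\<^esub> t = s}"]
      by (intro E_Phi_in[OF s image_Phi_submodule u(2)] generator_image) auto
  qed
  show ?thesis
    unfolding M_def V.vclosure_iff_vlim[OF image_Phi_carrier]
    by (intro exI[of _ "\<lambda>n. E s (X n)"] conjI allI vlim_E[OF s X(2)] im X(1))
qed

definition \<pi>M :: "('a, 'v) rep" where
  "\<pi>M = \<lparr>rep_space = V\<lparr>carrier := M\<rparr>, rep_dom = M, rep_op = op\<rparr>"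

lemma piM_simps [simp]:
  "rep_space \<pi>M = V\<lparr>carrier := M\<rparr>" "rep_dom \<pi>M = M" "rep_op \<pi>M = op"
  by (simp_all add: \<pi>M_def)

lemma component_system: "imprimitivity_system G A gr H (\<pi>M, E)"
proof -
  interpret S: hilbert_space "V\<lparr>carrier := M\<rparr>" by (rule V.closed_subspace_hilbert[OF M_closed])
  have "vclosure (V\<lparr>carrier := M\<rparr>) M = M"
    using S.vclosure_subset_carrier[of M] S.vclosure_superset[of M] by auto
  then have "star_rep A \<pi>M"
    using S.hilbert_space_axioms S.carrier_is_submodule M_carrier op_M
    by (auto simp: star_rep_def vlinear_def op_lin op_hom op_adjoint)
  moreover have "orthogonal_projection (V\<lparr>carrier := M\<rparr>) (E s)" if "s \<in> lcosets\<^bsub>G\<^esub> H" for s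
    using that M_carrier E_M
    by (auto simp: orthogonal_projection_def vlinear_def E_lin E_idem E_adjoint)
  moreover have "\<exists>S. finite S \<and> S \<subseteq> lcosets\<^bsub>G\<^esub> H \<and> (\<forall>S'. finite S' \<and> S \<subseteq> S' \<and> S' \<subseteq> lcosets\<^bsub>G\<^esub> H \<longrightarrow>
      vdist (V\<lparr>carrier := M\<rparr>) (\<Oplus>\<^bsub>V\<lparr>carrier := M\<rparr>\<^esub>t\<in>S'. E t x) x < e)"
    if x: "x \<in> M" and e: "e > 0" for x and e :: real
  proof -
    have "vdist (V\<lparr>carrier := M\<rparr>) (\<Oplus>\<^bsub>V\<lparr>carrier := M\<rparr>\<^esub>t\<in>S'. E t x) x = vdist V (\<Oplus>\<^bsub>V\<^esub>t\<in>S'. E t x) x"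
      if S': "finite S'" "S' \<subseteq> lcosets\<^bsub>G\<^esub> H" for S'
    proof -
      have EM: "E s x \<in> M" if "s \<in> S'" for s using that S' x E_M by auto
      show ?thesis
        using V.submodule_finsum[OF M_sub S'(1) EM] x
        by (simp add: V.subspace_finsum[OF M_sub S'(1) EM] V.subspace_vdist[OF M_sub])
    qed
    then show ?thesis using E_sum[OF M_carrier[OF x] e] by auto
  qed
  moreover have "E s x \<in> M \<and> E (g <#\<^bsub>G\<^esub> s) (op a x) = op a (E s x)"
    if "g \<in> carrier G" "s \<in> lcosets\<^bsub>G\<^esub> H" "a \<in> gr g" "x \<in> M" for g s a x
    using that by (simp add: E_M E_op M_carrier)
  ultimately show ?thesis
    by (simp add: imprimitivity_system_def E_orth M_carrier)
qed

lemma Psi_real: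
  "unitary (V\<lparr>carrier := M\<rparr>) W \<Psi>"
  "X \<in> carrier P \<Longrightarrow> \<Psi> (\<Phi>2 X) = completion_embed P X"
  "\<Psi> \<zero>\<^bsub>V\<^esub> = \<zero>\<^bsub>W\<^esub>"
  unfolding \<Psi>_def M_def image_Phi2[symmetric]
  by (rule completion_realised[OF complex_ip_space_P V.hilbert_space_axioms Phi2(2)];
      simp add: Phi2(3))+

lemma unitary_Psi: "unitary (V\<lparr>carrier := M\<rparr>) W \<Psi>"
  by (rule Psi_real)

lemma Psi_lin:
  "x \<in> M \<Longrightarrow> \<Psi> x \<in> carrier W"
  "\<lbrakk>x \<in> M; y \<in> M\<rbrakk> \<Longrightarrow> \<Psi> (x \<oplus>\<^bsub>V\<^esub> y) = \<Psi> x \<oplus>\<^bsub>W\<^esub> \<Psi> y"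
  "x \<in> M \<Longrightarrow> \<Psi> (c \<odot>\<^bsub>V\<^esub> x) = c \<odot>\<^bsub>W\<^esub> \<Psi> x"
  "\<lbrakk>x \<in> M; y \<in> M\<rbrakk> \<Longrightarrow> cinner W (\<Psi> x) (\<Psi> y) = cinner V x y"
  "carrier W = \<Psi> ` M" "inj_on \<Psi> M"
  using unitary_Psi by (auto simp: unitary_def vlinear_def bij_betw_def)

lemma complex_ip_space_W: "complex_ip_space W"
  using V.subspace_complex_ip_space[OF M_sub] unitary_Psi
  by (rule complex_ip_space_transport) (simp add: Psi_real)

lemma vdist_Psi:
  assumes "x \<in> M" "y \<in> M"
  shows "vdist W (\<Psi> x) (\<Psi> y) = vdist V x y"
proof -
  interpret S: complex_ip_space "V\<lparr>carrier := M\<rparr>" by (rule V.subspace_complex_ip_space[OF M_sub])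
  interpret W: complex_ip_space W by (rule complex_ip_space_W)
  have "vdist W (\<Psi> x) (\<Psi> y) = vdist (V\<lparr>carrier := M\<rparr>) x y"
    using unitary_Psi assms
    by (intro vdist_isometry[OF S.module_axioms W.module_axioms]) (auto simp: unitary_def)
  then show ?thesis using assms by (simp add: V.subspace_vdist[OF M_sub])
qed

lemma cls_eq:
  assumes u: "u \<in> carrier F"
  shows "cls u = \<Psi> (\<Phi> u)"
proof -
  let ?X = "N +>\<^bsub>F\<^esub> u"
  have X: "?X \<in> carrier T" using u by (simp add: carrier_T)
  then have "null_vectors T +>\<^bsub>T\<^esub> ?X \<in> carrier P" by (simp add: carrier_P)
  from Psi_real(2)[OF this] show ?thesis
    using u X by (simp add: ind_class_def Let_def Phi2(1) Phi1(1))
qed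

end


context induced_component
begin

subsection \<open>The closure of the induced representation\<close>

abbreviation core :: "('a, ('a, 'v) ind_vector) rep" where "core \<equiv> ind_rep_core G A gr K \<rho>"

lemma core_space: "rep_space core = W"
  by (simp add: ind_rep_core_def Let_def)

lemma core_dom: "rep_dom core = \<Psi> ` \<Phi> ` carrier F"
  unfolding image_image by (simp add: ind_rep_core_def Let_def cls_eq cong: image_cong_simp)

text \<open>The operators of the induced representation are defined through a chosen representative; the
  choice is harmless because \<open>\<Psi>\<close> is injective.\<close>

lemma core_op:
  assumes a: "a \<in> carrier A" and x: "x \<in> \<Phi> ` carrier F"
  shows "rep_op core a (\<Psi> x) = \<Psi> (op a x)"
proof -
  define u where "u = (SOME u. u \<in> carrier F \<and> cls u = \<Psi> x)"
  have "\<exists>u. u \<in> carrier F \<and> cls u = \<Psi> x" using x cls_eq by auto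
  then have "u \<in> carrier F \<and> cls u = \<Psi> x" unfolding u_def by (rule someI_ex)
  then have u: "u \<in> carrier F" "cls u = \<Psi> x" by simp_all
  have ux: "\<Phi> u = x"
  proof (rule inj_onD[OF Psi_lin(6)])
    show "\<Psi> (\<Phi> u) = \<Psi> x" using u cls_eq by simp
  qed (use u(1) x image_Phi_M in auto)
  have "rep_op core a (\<Psi> x) = cls (free_lmult A a u)"
    by (simp add: ind_rep_core_def Let_def u_def)
  also have "\<dots> = \<Psi> (op a x)"
    using Phi_lmult[OF a u(1)] by (simp add: cls_eq ux)
  finally show ?thesis .
qed

text \<open>Since each \<open>op a\<close> is continuous, a sequence in the domain that converges to \<open>x\<close> converges in
  the graph topology as well, and the value of the closure is forced.  The closure of the induced
  representation is therefore defined on the whole completion.\<close>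

lemma graph_limit_op:
  assumes x: "x \<in> M"
  shows "graph_limit A core (\<Psi> x) (\<lambda>a. \<Psi> (op a x))"
  unfolding graph_limit_def core_space
proof (intro conjI allI impI)
  show "\<Psi> x \<in> carrier W" using x by (rule Psi_lin(1))
  show "(\<lambda>a. \<Psi> (op a x)) \<in> carrier A \<rightarrow> carrier W" using x by (auto intro: Psi_lin(1) op_M)
  fix S and e :: real assume S: "finite S \<and> S \<subseteq> carrier A \<and> 0 < e"
  obtain X where X: "\<And>n. X n \<in> \<Phi> ` carrier F" "V.vlim X x"
    by (rule M_approx[OF x]) (assumption | rule that)+
  have "\<forall>\<^sub>F n in sequentially. \<forall>a\<in>S. vdist V (op a (X n)) (op a x) < e"
  proof (rule eventually_ball_finite)
    show "\<forall>a\<in>S. \<forall>\<^sub>F n in sequentially. vdist V (op a (X n)) (op a x) < e"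
    proof
      fix a assume "a \<in> S"
      then have "a \<in> carrier A" using S by blast
      then show "\<forall>\<^sub>F n in sequentially. vdist V (op a (X n)) (op a x) < e"
        using order_tendstoD(2)[OF V.vlimD(3)[OF vlim_op[OF _ X(2)]]] S by blast
    qed
  qed (use S in blast)
  moreover have "\<forall>\<^sub>F n in sequentially. vdist V (X n) x < e"
    using S V.vlimD(3)[OF X(2)] by (auto intro: order_tendstoD(2))
  ultimately have "\<forall>\<^sub>F n in sequentially.
      vdist V (X n) x < e \<and> (\<forall>a\<in>S. vdist V (op a (X n)) (op a x) < e)"
    by eventually_elim simp
  then obtain n where n: "vdist V (X n) x < e" "\<And>a. a \<in> S \<Longrightarrow> vdist V (op a (X n)) (op a x) < e"
    by (auto simp: eventually_sequentially)
  have XM: "X n \<in> M" using X(1) image_Phi_M by blast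
  show "\<exists>y\<in>rep_dom core. vdist W y (\<Psi> x) < e \<and>
      (\<forall>a\<in>S. vdist W (rep_op core a y) (\<Psi> (op a x)) < e)"
  proof (rule bexI[of _ "\<Psi> (X n)"])
    show "\<Psi> (X n) \<in> rep_dom core" using X(1) by (simp add: core_dom)
    have "vdist W (rep_op core a (\<Psi> (X n))) (\<Psi> (op a x)) < e" if a: "a \<in> S" for a
    proof -
      have "a \<in> carrier A" using a S by auto
      then show ?thesis using n(2)[OF a] x XM by (simp add: core_op X(1) vdist_Psi op_M)
    qed
    then show "vdist W (\<Psi> (X n)) (\<Psi> x) < e \<and>
        (\<forall>a\<in>S. vdist W (rep_op core a (\<Psi> (X n))) (\<Psi> (op a x)) < e)"
      using n(1) x XM by (simp add: vdist_Psi)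
  qed
qed

lemma graph_limit_unique:
  assumes x: "x \<in> M" and g: "graph_limit A core (\<Psi> x) g" and a: "a \<in> carrier A"
  shows "g a = \<Psi> (op a x)"
proof (rule ccontr)
  interpret W: complex_ip_space W by (rule complex_ip_space_W)
  assume ne: "g a \<noteq> \<Psi> (op a x)"
  let ?z = "\<Psi> (op a x)"
  have ga: "g a \<in> carrier W" using g a by (auto simp: graph_limit_def core_space)
  have z: "?z \<in> carrier W" using x a by (intro Psi_lin(1) op_M)
  have "vdist W (g a) ?z \<noteq> 0" using ne ga z by (simp add: W.vdist_eq_0_iff)
  then have d: "vdist W (g a) ?z > 0" using W.vdist_nonneg[OF ga z] by linarith
  obtain C where C: "C \<ge> 0"
    "\<And>x y. \<lbrakk>x \<in> carrier V; y \<in> carrier V\<rbrakk> \<Longrightarrow> vdist V (op a x) (op a y) \<le> C * vdist V x y"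
    by (rule op_lipschitz[OF a]) (assumption | rule that)+
  define e where "e = vdist W (g a) ?z / (1 + C)"
  have e: "e > 0" using d C(1) by (simp add: e_def)
  have "\<exists>y\<in>rep_dom core. vdist W y (\<Psi> x) < e \<and> (\<forall>a\<in>{a}. vdist W (rep_op core a y) (g a) < e)"
    using g a e unfolding graph_limit_def core_space by blast
  then obtain y where y: "y \<in> \<Phi> ` carrier F" "vdist W (\<Psi> y) (\<Psi> x) < e"
    "vdist W (rep_op core a (\<Psi> y)) (g a) < e"
    unfolding core_dom by blast
  have yM: "y \<in> M" using y(1) image_Phi_M by blast
  have c: "\<Psi> (op a y) \<in> carrier W" using yM a by (intro Psi_lin(1) op_M)
  have 1: "vdist W (g a) (\<Psi> (op a y)) < e"
    using y(3) W.vdist_commute[OF ga c] by (simp add: core_op[OF a y(1)])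
  have "vdist W (\<Psi> (op a y)) ?z \<le> C * vdist V y x"
    using C(2)[of y x] x yM M_carrier a by (simp add: vdist_Psi op_M)
  also have "\<dots> \<le> C * e" using y(2) x yM C(1) by (intro mult_left_mono) (auto simp: vdist_Psi)
  finally have "vdist W (g a) ?z < e + C * e"
    using W.vdist_triangle[OF ga c z] 1 by linarith
  also have "\<dots> = e * (1 + C)" by (simp add: algebra_simps)
  also have "\<dots> = vdist W (g a) ?z" using C(1) by (simp add: e_def)
  finally show False by simp
qed

lemma ind_rep_space: "rep_space (ind_rep G A gr K \<rho>) = W"
  by (simp add: ind_rep_def rep_closure_def core_space)

lemma ind_rep_dom: "rep_dom (ind_rep G A gr K \<rho>) = carrier W"
proof -
  have "{x. \<exists>g. graph_limit A core x g} = carrier W"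
  proof (intro equalityI subsetI)
    fix \<xi> assume "\<xi> \<in> carrier W"
    then show "\<xi> \<in> {x. \<exists>g. graph_limit A core x g}" using graph_limit_op by (auto simp: Psi_lin(5))
  qed (auto simp: graph_limit_def core_space)
  then show ?thesis by (simp add: ind_rep_def rep_closure_def)
qed

lemma ind_rep_op:
  assumes a: "a \<in> carrier A" and x: "x \<in> M"
  shows "rep_op (ind_rep G A gr K \<rho>) a (\<Psi> x) = \<Psi> (op a x)"
proof -
  have "graph_limit A core (\<Psi> x) (SOME g. graph_limit A core (\<Psi> x) g)"
    by (rule someI[of "graph_limit A core (\<Psi> x)", OF graph_limit_op[OF x]])
  then show ?thesis
    using graph_limit_unique[OF x _ a] by (simp add: ind_rep_def rep_closure_def)
qed


subsection \<open>The induced projections\<close>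

text \<open>On \<open>M\<close> the projection \<open>E (kt)\<close> has the closed span of the vectors \<open>op a v\<close>, with degrees of \<open>a\<close>
  in the coset of \<open>k\<close>, as its range: it maps the dense span of all \<open>op a v\<close> into this span and fixes
  it pointwise.\<close>

lemma ind_projection:
  assumes k: "k \<in> carrier G" and x: "x \<in> M"
  shows "orth_proj W (vclosure W (vspan W
      {cls (single (a, v)) |a v. a \<in> graded_part A gr (k <#\<^bsub>G\<^esub> K) \<and> v \<in> L})) (\<Psi> x) =
    \<Psi> (E (k <#\<^bsub>G\<^esub> t) x)"
proof -
  interpret W: complex_ip_space W by (rule complex_ip_space_W)
  let ?s = "k <#\<^bsub>G\<^esub> t"
  have s: "?s \<in> lcosets\<^bsub>G\<^esub> H" by (rule G.lcosets_translate[OF H t k])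
  let ?D = "{g \<in> carrier G. g <#\<^bsub>G\<^esub> t = ?s}"
  let ?R = "{op a v |a v. a \<in> graded_part A gr ?D \<and> v \<in> L}"
  have D: "k <#\<^bsub>G\<^esub> K = ?D" by (rule stabilizer_coset[OF G.is_group H f k])
  have A: "a \<in> carrier A" if "a \<in> graded_part A gr ?D" for a
    using graded_part_carrier[of ?D] that by auto
  have R_M: "?R \<subseteq> M" using A L_M op_M by auto
  have "cls (single (a, v)) = \<Psi> (op a v)" if "a \<in> graded_part A gr ?D" "v \<in> L" for a v
    using that A by (simp add: cls_eq single_F Phi_single)
  then have gens: "{cls (single (a, v)) |a v. a \<in> graded_part A gr ?D \<and> v \<in> L} = \<Psi> ` ?R" by force
  have PR: "\<Psi> ` ?R \<subseteq> carrier W" using R_M Psi_lin(1) by blast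
  have span: "submodule (vspan W (\<Psi> ` ?R)) complex_ring W"
    by (rule vspan_submodule[OF W.module_axioms PR])
  then have span_W: "vspan W (\<Psi> ` ?R) \<subseteq> carrier W" by (simp add: W.submodule_iff)
  have Ex: "E ?s x \<in> M" by (rule E_M[OF s x])
  have "orth_proj W (vclosure W (vspan W (\<Psi> ` ?R))) (\<Psi> x) = \<Psi> (E ?s x)"
  proof (rule W.orth_projI)
    \<comment> \<open>membership in the span on the side of \<open>W\<close>, pulled back to a submodule of \<open>V\<close>\<close>
    let ?Z = "{z \<in> M. \<Psi> z \<in> vspan W (\<Psi> ` ?R)}"
    have zero: "\<Psi> \<zero>\<^bsub>V\<^esub> = \<zero>\<^bsub>W\<^esub>" by (rule Psi_real(3))
    have Z: "submodule ?Z complex_ring V"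
      using M_sub span by (auto simp: V.submodule_iff W.submodule_iff Psi_lin zero subset_iff)
    have R_Z: "op a v \<in> ?Z" if "a \<in> graded_part A gr ?D" "v \<in> L" for a v
      using that R_M vspan_superset[of "\<Psi> ` ?R" W] by blast
    have E_Z: "E ?s y \<in> ?Z" if "y \<in> \<Phi> ` carrier F" for y
      using that E_Phi_in[OF s Z _ R_Z] by blast
    obtain X where X: "\<And>n. X n \<in> \<Phi> ` carrier F" "V.vlim X x"
      by (rule M_approx[OF x]) (assumption | rule that)+
    have "W.vlim (\<lambda>n. \<Psi> (E ?s (X n))) (\<Psi> (E ?s x))"
      unfolding W.vlim_def using E_Z[OF X(1)] Ex V.vlimD(3)[OF vlim_E[OF s X(2)]]
      by (auto simp: vdist_Psi intro: Psi_lin(1))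
    then show "\<Psi> (E ?s x) \<in> vclosure W (vspan W (\<Psi> ` ?R))"
      unfolding W.vclosure_iff_vlim[OF span_W] using E_Z[OF X(1)]
      by (intro exI[of _ "\<lambda>n. \<Psi> (E ?s (X n))"]) simp
    fix z assume z: "z \<in> vclosure W (vspan W (\<Psi> ` ?R))"
    show "cinner W (\<Psi> x \<ominus>\<^bsub>W\<^esub> \<Psi> (E ?s x)) z = 0"
    proof (rule W.orthogonal_vspan[OF PR _ _ z])
      show "\<Psi> x \<ominus>\<^bsub>W\<^esub> \<Psi> (E ?s x) \<in> carrier W" using x Ex by (simp add: Psi_lin(1))
      fix w assume "w \<in> \<Psi> ` ?R"
      then obtain a v where w: "w = \<Psi> (op a v)" "a \<in> graded_part A gr ?D" "v \<in> L" by blast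
      have av: "op a v \<in> M" using w R_M by blast
      have "E ?s (op a v) = op a v"
        using E_op_graded_part[OF t s L_carrier w(2)] w(3) by (simp add: L_E)
      then have "cinner V (E ?s x) (op a v) = cinner V x (op a v)"
        using E_adjoint[OF s M_carrier[OF x] M_carrier[OF av]] by simp
      then show "cinner W (\<Psi> x \<ominus>\<^bsub>W\<^esub> \<Psi> (E ?s x)) w = 0"
        unfolding w(1) using x Ex av by (simp add: W.cinner_diff_left Psi_lin)
    qed
  qed (use W.vclosure_subset_carrier Psi_lin(1)[OF x] in auto)
  then show ?thesis unfolding D gens .
qed

lemma component_equivalent:
  "unitarily_equivalent A (lcosets\<^bsub>G\<^esub> K) (conj_system G f (\<pi>M, E)) (ind_system G A gr K \<rho>)"
proof -
  have proj: "\<Psi> (E (s #>\<^bsub>G\<^esub> f) x) = orth_proj W (vclosure W (vspan W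
      {cls (single (a, v)) |a v. a \<in> graded_part A gr s \<and> v \<in> L})) (\<Psi> x)"
    if s: "s \<in> lcosets\<^bsub>G\<^esub> K" and x: "x \<in> M" for s x
  proof -
    obtain k where k: "s = k <#\<^bsub>G\<^esub> K" "k \<in> carrier G" using s by (auto simp: LCOSETS_def)
    show ?thesis
      unfolding k(1) ind_projection[OF k(2) x] conj_coset_mult[OF G.is_group H f k(2)] ..
  qed
  have "intertwines A (lcosets\<^bsub>G\<^esub> K) \<Psi> (conj_system G f (\<pi>M, E)) (ind_system G A gr K \<rho>)"
    using unitary_Psi proj
    by (simp add: intertwines_def conj_system_def ind_system_def Let_def ind_rep_space ind_rep_dom
        ind_rep_op flip: Psi_lin(5))
  then show ?thesis unfolding unitarily_equivalent_def by blast
qed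

end


section \<open>Exhausting the system coset by coset\<close>

context bounded_imprimitivity
begin

definition generated :: "'v set \<Rightarrow> 'v set" where
  "generated L = vclosure V (vspan V {op a v |a v. a \<in> carrier A \<and> v \<in> L})"

lemma orthogonal_generated:
  assumes L: "L \<subseteq> carrier V" and x: "x \<in> carrier V"
    and orth: "\<And>a v. \<lbrakk>a \<in> carrier A; v \<in> L\<rbrakk> \<Longrightarrow> cinner V x (op a v) = 0"
    and y: "y \<in> generated L"
  shows "cinner V x y = 0"
  by (rule V.orthogonal_vspan[OF _ x _ y[unfolded generated_def]]) (use L orth in auto)

text \<open>The relation \<open>r\<close> says which cosets come earlier.  The residual space is the orthogonal complement
  of what the ranges of the earlier projections generate.\<close>

definition residual :: "('g set \<times> 'g set) set \<Rightarrow> 'g set \<Rightarrow> 'v set" where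
  "residual r t = {x \<in> carrier V. \<forall>s\<in>lcosets\<^bsub>G\<^esub> H. (s, t) \<in> r \<longrightarrow>
     (\<forall>a\<in>carrier A. E s (op a x) = \<zero>\<^bsub>V\<^esub>)}"

definition fibre :: "('g set \<times> 'g set) set \<Rightarrow> 'g set \<Rightarrow> 'v set" where
  "fibre r t = {x \<in> residual r t. E t x = x}"

lemma zero_maps:
  "a \<in> carrier A \<Longrightarrow> op a \<zero>\<^bsub>V\<^esub> = \<zero>\<^bsub>V\<^esub>" "t \<in> lcosets\<^bsub>G\<^esub> H \<Longrightarrow> E t \<zero>\<^bsub>V\<^esub> = \<zero>\<^bsub>V\<^esub>"
  using vlinear_zero[OF V.module_axioms V.module_axioms] op_vlinear E_vlinear by blast+

lemma residual_op:
  assumes x: "x \<in> residual r t" and a: "a \<in> carrier A"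
  shows "op a x \<in> residual r t"
  unfolding residual_def
proof (intro CollectI conjI ballI impI)
  show "op a x \<in> carrier V" using x a by (simp add: residual_def)
  fix s b assume s: "s \<in> lcosets\<^bsub>G\<^esub> H" "(s, t) \<in> r" and b: "b \<in> carrier A"
  have "E s (op (b \<otimes>\<^bsub>A\<^esub> a) x) = \<zero>\<^bsub>V\<^esub>"
    using x s a b by (simp add: residual_def)
  then show "E s (op b (op a x)) = \<zero>\<^bsub>V\<^esub>"
    using x a b by (simp add: residual_def op_hom(3))
qed

text \<open>Commuting \<open>E u\<close> past an element \<open>b\<close> replaces \<open>b\<close> by the part of it that moves \<open>u\<close> to \<open>s\<close>, and that
  part is again an algebra element, to which membership of \<open>x\<close> applies.\<close>

lemma residual_E:
  assumes x: "x \<in> residual r t" and u: "u \<in> lcosets\<^bsub>G\<^esub> H"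
  shows "E u x \<in> residual r t"
  unfolding residual_def
proof (intro CollectI conjI ballI impI)
  have xc: "x \<in> carrier V" using x by (simp add: residual_def)
  then show "E u x \<in> carrier V" using u by simp
  fix s b assume s: "s \<in> lcosets\<^bsub>G\<^esub> H" "(s, t) \<in> r" and b: "b \<in> carrier A"
  let ?X = "{g \<in> carrier G. g <#\<^bsub>G\<^esub> u = s}"
  let ?b = "graded_proj G A gr ?X b"
  have b': "?b \<in> graded_part A gr ?X" using b by (rule graded_proj_in) auto
  then have bc: "?b \<in> carrier A" using graded_part_carrier[of ?X] by auto
  have "E s (op b (E u x)) = op ?b (E u x)"
    using xc u by (intro E_op_graded_proj[OF u s(1) _ _ b]) (auto simp: E_idem)
  also have "\<dots> = E s (op ?b x)" by (rule E_op_graded_part[OF u s(1) xc b', symmetric])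
  also have "\<dots> = \<zero>\<^bsub>V\<^esub>" using x s bc by (simp add: residual_def)
  finally show "E s (op b (E u x)) = \<zero>\<^bsub>V\<^esub>" .
qed

lemma fibre_closed:
  assumes t: "t \<in> lcosets\<^bsub>G\<^esub> H"
  shows "closed_subspace V (fibre r t)"
  unfolding closed_subspace_def
proof (intro conjI subsetI)
  show "submodule (fibre r t) complex_ring V"
    using t V.smult_r_null[simplified]
    by (auto simp: V.submodule_iff fibre_def residual_def zero_maps op_lin(2,3) E_lin(2,3))
  have sub: "fibre r t \<subseteq> carrier V" by (auto simp: fibre_def residual_def)
  fix x assume "x \<in> vclosure V (fibre r t)"
  then obtain X where X: "\<And>n. X n \<in> fibre r t" "V.vlim X x"
    unfolding V.vclosure_iff_vlim[OF sub] by blast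
  have "E t x = x"
  proof (rule V.vlim_unique[OF vlim_E[OF t X(2)]])
    have "(\<lambda>n. E t (X n)) = X" using X(1) by (simp add: fibre_def fun_eq_iff)
    then show "V.vlim (\<lambda>n. E t (X n)) x" using X(2) by simp
  qed
  moreover have "E s (op a x) = \<zero>\<^bsub>V\<^esub>"
    if s: "s \<in> lcosets\<^bsub>G\<^esub> H" "(s, t) \<in> r" and a: "a \<in> carrier A" for s a
  proof (rule V.vlim_unique[OF vlim_E[OF s(1) vlim_op[OF a X(2)]]])
    have "(\<lambda>n. E s (op a (X n))) = (\<lambda>_. \<zero>\<^bsub>V\<^esub>)"
      using X(1) s a by (auto simp: fibre_def residual_def fun_eq_iff)
    then show "V.vlim (\<lambda>n. E s (op a (X n))) \<zero>\<^bsub>V\<^esub>" by (simp add: V.vlim_const)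
  qed
  ultimately show "x \<in> fibre r t"
    using V.vlimD(2)[OF X(2)] by (simp add: fibre_def residual_def)
qed

lemma fibre_carrier: "fibre r t \<subseteq> carrier V"
  by (auto simp: fibre_def residual_def)

lemma fibre_component:
  assumes f: "f \<in> carrier G" and t: "t = f <#\<^bsub>G\<^esub> H"
  shows "induced_component G A gr V op E H f (fibre r t)"
proof -
  have tT: "t \<in> lcosets\<^bsub>G\<^esub> H" using f t by (auto simp: LCOSETS_def)
  show ?thesis
  proof unfold_locales
    show "f \<in> carrier G" by (rule f)
    show "closed_subspace V (fibre r t)" by (rule fibre_closed[OF tT])
    show "E (f <#\<^bsub>G\<^esub> H) v = v" if "v \<in> fibre r t" for v
      using that t by (simp add: fibre_def)
    fix a v assume a: "a \<in> graded_part A gr (conj_subgroup G f H)" and v: "v \<in> fibre r t"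
    have K: "conj_subgroup G f H = {g \<in> carrier G. g <#\<^bsub>G\<^esub> t = t}"
      unfolding t by (rule conj_subgroup_stabilizer[OF G.is_group H f])
    have ac: "a \<in> carrier A" using a K graded_part_carrier[of "conj_subgroup G f H"] by auto
    have vr: "v \<in> residual r t" "E t v = v" using v by (simp_all add: fibre_def)
    then have "E t (op a v) = op a v"
      using E_op_graded_part[OF tT tT _ a[unfolded K], of v] by (simp add: residual_def)
    then show "op a v \<in> fibre r t" using residual_op[OF vr(1) ac] by (simp add: fibre_def)
  qed
qed

text \<open>Generators satisfy \<open>\<langle>op a v, op b w\<rangle> = \<langle>E s v, op (a\<^sup>*b) w\<rangle> = \<langle>v, E s (op (a\<^sup>*b) w)\<rangle>\<close>, and the last
  vector vanishes because \<open>w\<close> is residual for \<open>t\<close> and \<open>s\<close> is earlier.\<close>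

lemma fibres_orthogonal:
  assumes st: "(s, t) \<in> r" and s: "s \<in> lcosets\<^bsub>G\<^esub> H"
    and x: "x \<in> generated (fibre r s)" and y: "y \<in> generated (fibre r t)"
  shows "cinner V x y = 0"
proof -
  have gen: "cinner V (op a v) (op b w) = 0"
    if "a \<in> carrier A" "v \<in> fibre r s" "b \<in> carrier A" "w \<in> fibre r t" for a v b w
  proof -
    have vw: "v \<in> carrier V" "w \<in> carrier V"
      using that fibre_carrier[of r s] fibre_carrier[of r t] by auto
    have c: "star A a \<otimes>\<^bsub>A\<^esub> b \<in> carrier A" using that star_closed by simp
    have "cinner V (op a v) (op b w) = cinner V v (op (star A a \<otimes>\<^bsub>A\<^esub> b) w)"
      using that vw star_closed by (simp add: op_adjoint op_hom(3))
    also have "\<dots> = cinner V (E s v) (op (star A a \<otimes>\<^bsub>A\<^esub> b) w)"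
      using that by (simp add: fibre_def)
    also have "\<dots> = cinner V v (E s (op (star A a \<otimes>\<^bsub>A\<^esub> b) w))"
      using s vw c by (simp add: E_adjoint)
    also have "E s (op (star A a \<otimes>\<^bsub>A\<^esub> b) w) = \<zero>\<^bsub>V\<^esub>"
      using that st s c by (simp add: fibre_def residual_def)
    finally show ?thesis using vw by simp
  qed
  have yc: "y \<in> carrier V" and xc: "x \<in> carrier V"
    using x y V.vclosure_subset_carrier unfolding generated_def by auto
  have "cinner V y x = 0"
  proof (rule orthogonal_generated[OF fibre_carrier yc _ x])
    fix a v assume av: "a \<in> carrier A" "v \<in> fibre r s"
    then have c: "op a v \<in> carrier V" using fibre_carrier[of r s] by auto
    have "cinner V (op a v) y = 0"
      using c gen[OF av] by (rule orthogonal_generated[OF fibre_carrier _ _ y])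
    then show "cinner V y (op a v) = 0" using V.cinner_commute[OF yc c] by simp
  qed
  then show ?thesis using V.cinner_commute[OF xc yc] by simp
qed

lemma in_generated: "\<lbrakk>L \<subseteq> carrier V; a \<in> carrier A; v \<in> L\<rbrakk> \<Longrightarrow> op a v \<in> generated L"
proof -
  assume L: "L \<subseteq> carrier V" and av: "a \<in> carrier A" "v \<in> L"
  let ?S = "{op a v |a v. a \<in> carrier A \<and> v \<in> L}"
  have "?S \<subseteq> carrier V" using L by auto
  then have "vspan V ?S \<subseteq> carrier V"
    using vspan_submodule[OF V.module_axioms] by (simp add: V.submodule_iff)
  then show ?thesis
    using V.vclosure_superset vspan_superset[of ?S V] av unfolding generated_def by blast
qed

text \<open>A vector orthogonal to all generated subspaces is residual for every coset, by induction along
  \<open>r\<close>: at each coset its compression \<open>E t (op a x)\<close> falls into the fibre and is orthogonal to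
  itself.\<close>

lemma fibres_total:
  assumes r: "wf r" and x: "x \<in> carrier V"
    and orth: "\<And>t y. \<lbrakk>t \<in> lcosets\<^bsub>G\<^esub> H; y \<in> generated (fibre r t)\<rbrakk> \<Longrightarrow> cinner V x y = 0"
  shows "x = \<zero>\<^bsub>V\<^esub>"
proof -
  have "\<forall>a\<in>carrier A. E t (op a x) = \<zero>\<^bsub>V\<^esub>" if "t \<in> lcosets\<^bsub>G\<^esub> H" for t
    using r that
  proof (induction t rule: wf_induct_rule)
    case (less t)
    show ?case
    proof
      fix a assume a: "a \<in> carrier A"
      let ?z = "E t (op a x)"
      have t: "t \<in> lcosets\<^bsub>G\<^esub> H" by (rule less.prems)
      have "x \<in> residual r t" using less.IH x by (auto simp: residual_def)
      then have "?z \<in> residual r t" using a t by (intro residual_E residual_op)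
      then have z: "?z \<in> fibre r t" using a t x by (simp add: fibre_def E_idem)
      have zc: "?z \<in> carrier V" using a t x by simp
      have "cinner V ?z ?z = cinner V (op a x) ?z"
        using a t x by (simp add: E_adjoint E_idem)
      also have "\<dots> = cinner V x (op (star A a) ?z)"
        using a t x by (intro op_adjoint) auto
      also have "\<dots> = 0"
        using a z by (intro orth[OF t] in_generated fibre_carrier star_closed)
      finally show "?z = \<zero>\<^bsub>V\<^esub>" by (rule V.cinner_definite[OF zc])
    qed
  qed
  then have "E t x = \<zero>\<^bsub>V\<^esub>" if "t \<in> lcosets\<^bsub>G\<^esub> H" for t
    using that one_closed op_hom(4)[OF x] by metis
  then show ?thesis by (rule E_total[OF x])
qed

end

context induced_component
begin

lemma M_generated: "M = generated L"
proof -
  let ?S = "{op a v |a v. a \<in> carrier A \<and> v \<in> L}"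
  have S: "?S \<subseteq> carrier V" using L_carrier by auto
  have "\<Phi> ` carrier F = vspan V ?S"
  proof
    have "\<Phi> u \<in> vspan V ?S" if "u \<in> carrier F" for u
      unfolding \<Phi>_def using that vspan_superset[of ?S V]
      by (intro V.lin_ext_in_submodule vspan_submodule[OF V.module_axioms S])
        (auto simp: carrier_F)
    then show "\<Phi> ` carrier F \<subseteq> vspan V ?S" by blast
    show "vspan V ?S \<subseteq> \<Phi> ` carrier F"
      using generator_image by (intro vspan_minimal image_Phi_submodule) blast
  qed
  then show ?thesis by (simp add: M_def generated_def)
qed

end

text \<open>A closed subspace invariant under a family of operators and their adjoints is reducing: its
  orthogonal projection commutes with the family.  So the unitary of the orthogonal decomposition
  intertwines.\<close>

lemma direct_sum_of_components:
  fixes G :: "'g monoid" and V :: "'v ip_space"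
  assumes "bounded_imprimitivity G A gr V op E H"
    and orth: "orthogonal_family V I M"
    and op_M: "\<And>i a x. \<lbrakk>i \<in> I; a \<in> carrier A; x \<in> M i\<rbrakk> \<Longrightarrow> op a x \<in> M i"
    and E_M: "\<And>i s x. \<lbrakk>i \<in> I; s \<in> lcosets\<^bsub>G\<^esub> H; x \<in> M i\<rbrakk> \<Longrightarrow> E s x \<in> M i"
  shows "is_direct_sum A (lcosets\<^bsub>G\<^esub> H) I (\<lparr>rep_space = V, rep_dom = carrier V, rep_op = op\<rparr>, E)
    (\<lambda>i. (\<lparr>rep_space = V\<lparr>carrier := M i\<rparr>, rep_dom = M i, rep_op = op\<rparr>, E))"
proof -
  interpret bounded_imprimitivity G A gr V op E H by fact
  interpret O: orthogonal_family V I M by fact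
  let ?U = "\<lambda>x. \<lambda>i\<in>I. orth_proj V (M i) x"
  let ?\<sigma> = "\<lambda>i. (\<lparr>rep_space = V\<lparr>carrier := M i\<rparr>, rep_dom = M i, rep_op = op\<rparr>, E)"
  let ?sum = "hilbert_sum I (\<lambda>i. V\<lparr>carrier := M i\<rparr>)"
  note U = O.unitary_decomposition
  have img: "?U ` carrier V = carrier ?sum"
    using U by (auto simp: unitary_def bij_betw_def)
  have comp_op: "O.comp i (op a x) = op a (O.comp i x)"
    if i: "i \<in> I" and a: "a \<in> carrier A" and x: "x \<in> carrier V" for i a x
  proof (rule O.compI[OF i])
    show "op a (O.comp i x) \<in> M i" by (rule op_M[OF i a O.comp_in[OF i x]])
    fix z assume z: "z \<in> M i"
    have zc: "z \<in> carrier V" by (rule O.in_carrier[OF i z])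
    have az: "op (star A a) z \<in> M i" using op_M[OF i star_closed[OF a] z] .
    have "cinner V (op a x) z = cinner V x (op (star A a) z)" by (rule op_adjoint[OF a x zc])
    also have "\<dots> = cinner V (O.comp i x) (op (star A a) z)"
      by (rule V.cinner_orth_proj(1)[OF O.closed[OF i] x az, symmetric])
    also have "\<dots> = cinner V (op a (O.comp i x)) z"
      by (rule op_adjoint[OF a O.comp_carrier[OF i x] zc, symmetric])
    finally show "cinner V (op a x) z = cinner V (op a (O.comp i x)) z" .
  qed (use a x in simp)
  have comp_E: "O.comp i (E s x) = E s (O.comp i x)"
    if i: "i \<in> I" and s: "s \<in> lcosets\<^bsub>G\<^esub> H" and x: "x \<in> carrier V" for i s x
  proof (rule O.compI[OF i])
    show "E s (O.comp i x) \<in> M i" by (rule E_M[OF i s O.comp_in[OF i x]])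
    fix z assume z: "z \<in> M i"
    have zc: "z \<in> carrier V" by (rule O.in_carrier[OF i z])
    have "cinner V (E s x) z = cinner V x (E s z)" by (rule E_adjoint[OF s x zc])
    also have "\<dots> = cinner V (O.comp i x) (E s z)"
      by (rule V.cinner_orth_proj(1)[OF O.closed[OF i] x E_M[OF i s z], symmetric])
    also have "\<dots> = cinner V (E s (O.comp i x)) z"
      by (rule E_adjoint[OF s O.comp_carrier[OF i x] zc, symmetric])
    finally show "cinner V (E s x) z = cinner V (E s (O.comp i x)) z" .
  qed (use s x in simp)
  have op_U: "?U (op a x) = (\<lambda>i\<in>I. op a (?U x i))" if "a \<in> carrier A" "x \<in> carrier V" for a x
    using that by (simp add: comp_op fun_eq_iff)
  have E_U: "?U (E s x) = (\<lambda>i\<in>I. E s (?U x i))" if "s \<in> lcosets\<^bsub>G\<^esub> H" "x \<in> carrier V" for s x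
    using that by (simp add: comp_E fun_eq_iff)
  have summable: "(\<lambda>i. (vnorm V (u i))\<^sup>2) summable_on I" if "u \<in> carrier ?sum" for u
    using that by (simp add: hilbert_sum_def V.subspace_vnorm)
  have dom: "?U ` carrier V = rep_dom (fst (system_sum A I ?\<sigma>))"
  proof
    show "?U ` carrier V \<subseteq> rep_dom (fst (system_sum A I ?\<sigma>))"
    proof
      fix u assume "u \<in> ?U ` carrier V"
      then obtain x where x: "x \<in> carrier V" "u = ?U x" by blast
      have u: "u \<in> carrier ?sum" using x img by blast
      have "(\<lambda>i. (vnorm V (op a (u i)))\<^sup>2) summable_on I" if a: "a \<in> carrier A" for a
      proof -
        have "?U (op a x) \<in> carrier ?sum" using img op_closed[OF a x(1)] by blast
        then have "(\<lambda>i. (vnorm V ((\<lambda>i\<in>I. op a (u i)) i))\<^sup>2) summable_on I"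
          unfolding op_U[OF a x(1)] x(2)[symmetric] by (rule summable)
        then show ?thesis by (rule summable_on_cong[THEN iffD1, rotated]) simp
      qed
      then show "u \<in> rep_dom (fst (system_sum A I ?\<sigma>))"
        using u summable[OF u] by (simp add: system_sum_def V.subspace_vnorm hilbert_sum_def)
    qed
    show "rep_dom (fst (system_sum A I ?\<sigma>)) \<subseteq> ?U ` carrier V"
      unfolding img by (auto simp: system_sum_def hilbert_sum_def)
  qed
  have "intertwines A (lcosets\<^bsub>G\<^esub> H) ?U
      (\<lparr>rep_space = V, rep_dom = carrier V, rep_op = op\<rparr>, E) (system_sum A I ?\<sigma>)"
    using U dom op_U E_U by (simp add: intertwines_def system_sum_def)
  then show ?thesis using O.sub by (simp add: is_direct_sum_def)
qed

theorem theorem2: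
  fixes G :: "'g monoid" and H :: "'g set"
    and A :: "'a star_algebra" and gr :: "'g \<Rightarrow> 'a set"
    and \<pi> :: "('a, 'v) rep" and E :: "'g set \<Rightarrow> 'v \<Rightarrow> 'v"
    and k :: "'g set \<Rightarrow> 'g"
  assumes "graded_star_algebra G A gr"
    and "subgroup H G"
    and "imprimitivity_system G A gr H (\<pi>, E)"
    and "bounded_rep A \<pi>"
    and "\<And>t. t \<in> lcosets\<^bsub>G\<^esub> H \<Longrightarrow> k t \<in> t"
  shows "\<exists>\<rho> :: 'g set \<Rightarrow> ('a, 'v) rep.
    (\<forall>t\<in>lcosets\<^bsub>G\<^esub> H.
       star_rep (subalgebra_on A gr (conj_subgroup G (k t) H)) (\<rho> t) \<and>
       bounded_rep (subalgebra_on A gr (conj_subgroup G (k t) H)) (\<rho> t) \<and>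
       inducible G A gr (conj_subgroup G (k t) H) (\<rho> t)) \<and>
    (\<exists>\<sigma> :: 'g set \<Rightarrow> ('g, 'a, 'v) system.
       (\<forall>t\<in>lcosets\<^bsub>G\<^esub> H. imprimitivity_system G A gr H (\<sigma> t)) \<and>
       is_direct_sum A (lcosets\<^bsub>G\<^esub> H) (lcosets\<^bsub>G\<^esub> H) (\<pi>, E) \<sigma> \<and>
       (\<forall>t\<in>lcosets\<^bsub>G\<^esub> H.
          unitarily_equivalent A (lcosets\<^bsub>G\<^esub> (conj_subgroup G (k t) H))
            (conj_system G (k t) (\<sigma> t))
            (ind_system G A gr (conj_subgroup G (k t) H) (\<rho> t))))"
proof -
  define V op where "V = rep_space \<pi>" and "op = rep_op \<pi>"
  have pi: "\<pi> = \<lparr>rep_space = V, rep_dom = carrier V, rep_op = op\<rparr>"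
    using assms(4) by (simp add: V_def op_def bounded_rep_def)
  interpret graded_star_algebra G A gr by fact
  have "hilbert_space V"
    using assms(3) by (simp add: imprimitivity_system_def star_rep_def Let_def V_def)
  then interpret V: hilbert_space V .
  interpret S: bounded_imprimitivity G A gr V op E H
    by (intro bounded_imprimitivity.intro bounded_imprimitivity_axioms.intro
        graded_star_algebra_axioms V.hilbert_space_axioms assms(2)
        assms(3)[unfolded pi] assms(4)[unfolded pi])
  let ?T = "lcosets\<^bsub>G\<^esub> H"
  \<comment> \<open>the strict part of a well-ordering of all sets of group elements\<close>
  obtain r :: "('g set \<times> 'g set) set" where r: "wf r" "\<And>s t. s \<noteq> t \<Longrightarrow> (s, t) \<in> r \<or> (t, s) \<in> r"
  proof -
    obtain r0 :: "('g set \<times> 'g set) set" where r0: "well_order_on UNIV r0"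
      using well_order_on by blast
    show ?thesis
    proof (rule that)
      show "wf (r0 - Id)" using r0 by (simp add: well_order_on_def)
      show "(s, t) \<in> r0 - Id \<or> (t, s) \<in> r0 - Id" if "s \<noteq> t" for s t
        using r0 that by (auto simp: well_order_on_def linear_order_on_def total_on_def)
    qed
  qed
  let ?L = "S.fibre r" and ?M = "\<lambda>t. S.generated (S.fibre r t)"
  have comp: "induced_component G A gr V op E H (k t) (?L t)" if t: "t \<in> ?T" for t
  proof (rule S.fibre_component)
    obtain g where g: "g \<in> carrier G" "t = g <#\<^bsub>G\<^esub> H" using t by (auto simp: LCOSETS_def)
    have kt: "k t \<in> g <#\<^bsub>G\<^esub> H" using assms(5)[OF t] g(2) by simp
    show "k t \<in> carrier G"
      using kt G.l_coset_subset_G[OF subgroup.subset[OF assms(2)] g(1)] by blast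
    show "t = k t <#\<^bsub>G\<^esub> H"
      using G.l_repr_independence[OF kt g(1) assms(2)] g(2) by simp
  qed
  define \<rho> where "\<rho> t = \<lparr>rep_space = V\<lparr>carrier := ?L t\<rparr>, rep_dom = ?L t, rep_op = op\<rparr>" for t
  define \<sigma> where "\<sigma> t = (\<lparr>rep_space = V\<lparr>carrier := ?M t\<rparr>, rep_dom = ?M t, rep_op = op\<rparr>, E)" for t
  have rho: "\<rho> t = induced_component.\<rho> V op (?L t)" if "t \<in> ?T" for t
    by (simp add: \<rho>_def induced_component.\<rho>_def[OF comp[OF that]])
  have sigma: "\<sigma> t = (induced_component.\<pi>M G A gr V op H (k t) (?L t), E)" if "t \<in> ?T" for t
    by (simp add: \<sigma>_def induced_component.\<pi>M_def[OF comp[OF that]]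
        induced_component.M_generated[OF comp[OF that]])
  have "orthogonal_family V ?T ?M"
  proof unfold_locales
    show "closed_subspace V (?M t)" if "t \<in> ?T" for t
      using induced_component.M_closed[OF comp[OF that]]
      by (simp add: induced_component.M_generated[OF comp[OF that]])
    show "cinner V x y = 0" if st: "s \<in> ?T" "t \<in> ?T" "s \<noteq> t" and xy: "x \<in> ?M s" "y \<in> ?M t"
      for s t x y
    proof (cases "(s, t) \<in> r")
      case True
      then show ?thesis by (rule S.fibres_orthogonal[OF _ st(1) xy])
    next
      case False
      then have "(t, s) \<in> r" using r(2)[OF st(3)] by blast
      then have "cinner V y x = 0" by (rule S.fibres_orthogonal[OF _ st(2) xy(2,1)])
      moreover have "x \<in> carrier V" "y \<in> carrier V"
        using xy V.vclosure_subset_carrier unfolding S.generated_def by auto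
      ultimately show ?thesis using V.cinner_commute[of x y] by simp
    qed
    show "x = \<zero>\<^bsub>V\<^esub>" if "x \<in> carrier V" "\<And>i y. \<lbrakk>i \<in> ?T; y \<in> ?M i\<rbrakk> \<Longrightarrow> cinner V x y = 0" for x
      using S.fibres_total[OF r(1) that] .
  qed
  then have "is_direct_sum A ?T ?T (\<pi>, E) \<sigma>"
    unfolding pi \<sigma>_def
  proof (rule direct_sum_of_components[OF S.bounded_imprimitivity_axioms])
    show "op a x \<in> ?M t" if "t \<in> ?T" "a \<in> carrier A" "x \<in> ?M t" for t a x
      using induced_component.op_M[OF comp[OF that(1)] that(2)] that(3)
      by (simp add: induced_component.M_generated[OF comp[OF that(1)]])
    show "E s x \<in> ?M t" if "t \<in> ?T" "s \<in> ?T" "x \<in> ?M t" for t s x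
      using induced_component.E_M[OF comp[OF that(1)] that(2)] that(3)
      by (simp add: induced_component.M_generated[OF comp[OF that(1)]])
  qed
  moreover have "star_rep (subalgebra_on A gr (conj_subgroup G (k t) H)) (\<rho> t) \<and>
       bounded_rep (subalgebra_on A gr (conj_subgroup G (k t) H)) (\<rho> t) \<and>
       inducible G A gr (conj_subgroup G (k t) H) (\<rho> t)" if "t \<in> ?T" for t
    unfolding rho[OF that]
    using induced_component.star_rep_rho[OF comp[OF that]]
      induced_component.bounded_rep_rho[OF comp[OF that]]
      induced_component.inducible_rho[OF comp[OF that]] by blast
  moreover have "imprimitivity_system G A gr H (\<sigma> t)" if "t \<in> ?T" for t
    unfolding sigma[OF that] by (rule induced_component.component_system[OF comp[OF that]])
  moreover have "unitarily_equivalent A (lcosets\<^bsub>G\<^esub> (conj_subgroup G (k t) H))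
      (conj_system G (k t) (\<sigma> t)) (ind_system G A gr (conj_subgroup G (k t) H) (\<rho> t))"
    if "t \<in> ?T" for t
    unfolding sigma[OF that] rho[OF that]
    by (rule induced_component.component_equivalent[OF comp[OF that]])
  ultimately show ?thesis by blast
qed

end
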